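(* Let $\mathbb{C}\{x_1,\dots,x_n\}$ be the ring of convergent power series and let $0\ne f\in\langle x_1,\dots,x_n\rangle\lhd\mathbb{C}\{x_1,\dots,x_n\}$. Then the extended Jacobian ideal \[ \tilde{\mathcal J}_f=\left\langle \frac{\partial f}{\partial x_1},\dots,\frac{\partial f}{\partial x_n},f\right\rangle \] is a monomial ideal if and only if $f$ is right equivalent to a Thom--Sebastiani polynomial.
   Context: An ideal of $\mathbb{C}\{x_1,\dots,x_n\}$ is called monomial if it is generated by monomials in terms of some local coordinates (i.e. some regular system of parameters $y_1,\dots,y_n$ of $\mathbb{C}\{x_1,\dots,x_n\}$, equivalently the images of $x_1,\dots,x_n$ under some $\mathbb{C}$-algebra automorphism). Two power series $f,f'$ are right equivalent if $\varphi(f)=f'$ for some $\mathbb{C}$-algebra automorphism $\varphi$ of $\mathbb{C}\{x_1,\dots,x_n\}$. A Thom--Sebastiani polynomial is a nonzero sum of non-constant monomials in pairwise disjoint sets of variables, i.e. $\sum_{j=1}^k x^{\alpha_j}$ with $k\ge1$, $0\ne\alpha_j\in\mathbb{N}^n$ and the supports $\{i:(\alpha_j)_i\neq0\}$ pairwise disjoint. *)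

theory Defs
  imports "HOL-Analysis.Analysis"
begin

text \<open>Power series in the variables indexed by the finite type 'n, with complex
coefficients: a power series is its coefficient function on multi-indices
('n \<Rightarrow> nat).  The ring C{x_1,...,x_n} is the set of convergent ones.\<close>

type_synonym 'n ps = "('n \<Rightarrow> nat) \<Rightarrow> complex"

definition mdeg :: "('n::finite \<Rightarrow> nat) \<Rightarrow> nat" where
  "mdeg \<alpha> = (\<Sum>i\<in>UNIV. \<alpha> i)"

definition convergent_ps :: "'n::finite ps \<Rightarrow> bool" where
  "convergent_ps f \<longleftrightarrow> (\<exists>r::real. r > 0 \<and> (\<lambda>\<alpha>. norm (f \<alpha>) * r ^ mdeg \<alpha>) summable_on UNIV)"

definition CS :: "'n::finite ps set" where
  "CS = {f. convergent_ps f}"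

definition ps_zero :: "'n ps" where "ps_zero = (\<lambda>\<alpha>. 0)"
definition ps_one :: "'n ps" where "ps_one = (\<lambda>\<alpha>. if \<alpha> = (\<lambda>i. 0) then 1 else 0)"
definition ps_add :: "'n ps \<Rightarrow> 'n ps \<Rightarrow> 'n ps" where "ps_add f g = (\<lambda>\<alpha>. f \<alpha> + g \<alpha>)"
definition ps_smult :: "complex \<Rightarrow> 'n ps \<Rightarrow> 'n ps" where "ps_smult c f = (\<lambda>\<alpha>. c * f \<alpha>)"

definition ps_mult :: "'n::finite ps \<Rightarrow> 'n ps \<Rightarrow> 'n ps" where
  "ps_mult f g = (\<lambda>\<alpha>. \<Sum>\<beta>\<in>{\<beta>. \<forall>i. \<beta> i \<le> \<alpha> i}. f \<beta> * g (\<lambda>i. \<alpha> i - \<beta> i))"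

definition monom_ps :: "('n \<Rightarrow> nat) \<Rightarrow> 'n ps" where
  "monom_ps \<beta> = (\<lambda>\<alpha>. if \<alpha> = \<beta> then 1 else 0)"

definition pderiv_ps :: "'n \<Rightarrow> 'n ps \<Rightarrow> 'n ps" where
  "pderiv_ps i f = (\<lambda>\<alpha>. of_nat (\<alpha> i + 1) * f (\<alpha>(i := \<alpha> i + 1)))"

definition is_ideal_ps :: "'n::finite ps set \<Rightarrow> bool" where
  "is_ideal_ps I \<longleftrightarrow> I \<subseteq> CS \<and> ps_zero \<in> I \<and>
     (\<forall>f\<in>I. \<forall>g\<in>I. ps_add f g \<in> I) \<and> (\<forall>a\<in>CS. \<forall>f\<in>I. ps_mult a f \<in> I)"

definition ideal_gen :: "'n::finite ps set \<Rightarrow> 'n ps set" where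
  "ideal_gen S = \<Inter>{I. is_ideal_ps I \<and> S \<subseteq> I}"

definition is_alg_aut :: "('n::finite ps \<Rightarrow> 'n ps) \<Rightarrow> bool" where
  "is_alg_aut \<phi> \<longleftrightarrow> bij_betw \<phi> CS CS \<and> \<phi> ps_one = ps_one \<and>
     (\<forall>f\<in>CS. \<forall>g\<in>CS. \<phi> (ps_add f g) = ps_add (\<phi> f) (\<phi> g)) \<and>
     (\<forall>f\<in>CS. \<forall>g\<in>CS. \<phi> (ps_mult f g) = ps_mult (\<phi> f) (\<phi> g)) \<and>
     (\<forall>c. \<forall>f\<in>CS. \<phi> (ps_smult c f) = ps_smult c (\<phi> f))"

text \<open>Monomial ideal: generated by monomials in some local coordinates
y_i = \<phi>(x_i), i.e. by images \<phi>(x^\<alpha>) of monomials under an automorphism.\<close>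
definition monomial_ideal :: "'n::finite ps set \<Rightarrow> bool" where
  "monomial_ideal I \<longleftrightarrow> (\<exists>\<phi> M. is_alg_aut \<phi> \<and> I = ideal_gen (\<phi> ` monom_ps ` M))"

definition right_equiv :: "'n::finite ps \<Rightarrow> 'n ps \<Rightarrow> bool" where
  "right_equiv f f' \<longleftrightarrow> (\<exists>\<phi>. is_alg_aut \<phi> \<and> \<phi> f = f')"

definition supp_mi :: "('n \<Rightarrow> nat) \<Rightarrow> 'n set" where
  "supp_mi \<alpha> = {i. \<alpha> i \<noteq> 0}"

definition thom_sebastiani :: "'n::finite ps \<Rightarrow> bool" where
  "thom_sebastiani g \<longleftrightarrow> (\<exists>as :: ('n \<Rightarrow> nat) list. as \<noteq> [] \<and>
     (\<forall>j<length as. as ! j \<noteq> (\<lambda>i. 0)) \<and>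
     (\<forall>j<length as. \<forall>k<length as. j \<noteq> k \<longrightarrow> supp_mi (as ! j) \<inter> supp_mi (as ! k) = {}) \<and>
     g = (\<lambda>\<alpha>. \<Sum>j<length as. monom_ps (as ! j) \<alpha>))"

definition ext_jacobian :: "'n::finite ps \<Rightarrow> 'n ps set" where
  "ext_jacobian f = ideal_gen (insert f (range (\<lambda>i. pderiv_ps i f)))"

end

theory Submission
  imports Defs "HOL-Library.Function_Algebras" "HOL-Computational_Algebra.Polynomial"
begin

text \<open>After an automorphism the extended Jacobian ideal \<open>J\<close> of \<open>f\<close> is generated by monomials; let \<open>G\<close> be
  the set of its minimal monomial generators. No monomial of \<open>f\<close> is in \<open>G\<close>, so modulo \<open>\<mm>J\<close> the partial
  derivatives span \<open>J\<close>, and a nonzero maximal minor of their coefficient matrix provides an injection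
  \<open>\<iota>\<close> from \<open>G\<close> into the variables such that \<open>x\<^sub>i x\<^sup>\<beta>\<close>, \<open>i = \<iota> \<beta>\<close>, occurs in \<open>f\<close> for all \<open>\<beta> \<in> G\<close>. A counting
  argument shows that, once \<open>\<iota>\<close> is replaced by the identity on the generators of degree one, the distinct
  monomials among these products have disjoint supports; let \<open>g\<close> be their sum.

  For all \<open>t \<in> \<complex>\<close> outside the finite zero set of one minor, \<open>f + t (g - f)\<close> has Jacobian ideal \<open>J\<close> by
  Nakayama's lemma, and \<open>g - f \<in> \<mm>J\<close>. So locally in \<open>t\<close> there is an analytic vector field \<open>\<xi>\<^sub>t\<close>, vanishing
  at the origin, with \<open>\<xi>\<^sub>t (f + t (g - f)) = g - f\<close>, and its flow trivializes the family. Since \<open>\<complex>\<close> minus a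
  finite set is connected, \<open>f\<close> and \<open>g\<close> are right equivalent. The flow is built as a power series in \<open>t\<close> whose
  coefficients are operators on power series, so that no substitution of power series is needed.\<close>

subsection \<open>Multi-indices\<close>

text \<open>Two obstacles shape the proof. First, the flow must act on every convergent series for
  the same times \<open>t\<close>, although radii of convergence have no positive lower bound. This
  works because the fields vanish at the origin: the degree lost by differentiating is regained by
  multiplying, so the constant in the estimate does not involve the rate of the argument. Second,
  one and the same minor must be nonzero at both ends of the pencil from \<open>f\<close> to
  \<open>g\<close>. So the representatives come from a nonzero term of a minor of \<open>f\<close>
  whose rows are the image of \<open>G\<close> under \<open>\<iota>\<close>, and the correction of
  \<open>\<iota>\<close> keeps this image; in these rows \<open>g\<close> has one nonzero entry per
  column. That no monomial of \<open>f\<close> is a minimal generator has a simple reason: lowering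
  it in a variable that it contains gives a monomial of a partial derivative. The chain rule for
  abstract automorphisms rests on the fact that a derivation is determined by its values on the
  variables.\<close>

definition unit_mi :: "'n \<Rightarrow> 'n \<Rightarrow> nat" where
  "unit_mi i = (\<lambda>k. if k = i then 1 else 0)"

lemma unit_mi_apply: "unit_mi i k = (if k = i then 1 else 0)"
  by (simp add: unit_mi_def)

lemma unit_mi_self [simp]: "unit_mi i i = 1"
  by (simp add: unit_mi_def)

lemma unit_mi_neq_zero [simp]: "unit_mi i \<noteq> 0"
  by (metis unit_mi_self zero_fun_apply zero_neq_one)

lemma mi_le_iff: "(\<alpha> :: 'n \<Rightarrow> nat) \<le> \<beta> \<longleftrightarrow> (\<forall>i. \<alpha> i \<le> \<beta> i)"
  by (simp add: le_fun_def)

lemma mi_diff_add [simp]: "\<beta> \<le> \<alpha> \<Longrightarrow> (\<alpha> - \<beta>) + \<beta> = (\<alpha> :: 'n \<Rightarrow> nat)"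
  by (auto simp: fun_eq_iff mi_le_iff)

lemma mi_add_diff [simp]: "\<beta> \<le> \<alpha> \<Longrightarrow> \<beta> + (\<alpha> - \<beta>) = (\<alpha> :: 'n \<Rightarrow> nat)"
  by (auto simp: fun_eq_iff mi_le_iff)

lemma mi_add_minus [simp]: "(\<beta> + \<alpha>) - \<beta> = (\<alpha> :: 'n \<Rightarrow> nat)"
  by (auto simp: fun_eq_iff)

lemma mi_le_add [simp]: "\<beta> \<le> \<alpha> + \<beta>" "\<beta> \<le> \<beta> + (\<alpha> :: 'n \<Rightarrow> nat)"
  by (auto simp: mi_le_iff)

lemma unit_le_iff [simp]: "unit_mi i \<le> \<alpha> \<longleftrightarrow> \<alpha> i \<noteq> 0"
  by (auto simp: mi_le_iff unit_mi_def)

lemma mi_nonzero_ex: "\<alpha> \<noteq> (0 :: 'n \<Rightarrow> nat) \<Longrightarrow> \<exists>i. \<alpha> i \<noteq> 0"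
  by (auto simp: fun_eq_iff)

lemma fun_upd_unit: "\<alpha>(i := \<alpha> i + 1) = \<alpha> + unit_mi i"
  by (auto simp: fun_eq_iff unit_mi_def)

lemma mdeg_add [simp]: "mdeg (\<alpha> + \<beta>) = mdeg \<alpha> + mdeg \<beta>"
  by (simp add: mdeg_def sum.distrib)

lemma mdeg_zero [simp]: "mdeg 0 = 0"
  by (simp add: mdeg_def)

lemma mdeg_unit [simp]: "mdeg (unit_mi i) = 1"
  by (simp add: mdeg_def unit_mi_def)

lemma mdeg_ge: "\<alpha> i \<le> mdeg \<alpha>"
  unfolding mdeg_def by (rule member_le_sum) auto

lemma mdeg_eq_0_iff [simp]: "mdeg \<alpha> = 0 \<longleftrightarrow> \<alpha> = 0"
  by (auto simp: mdeg_def fun_eq_iff)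

lemma mdeg_mono: "\<alpha> \<le> \<beta> \<Longrightarrow> mdeg \<alpha> \<le> mdeg \<beta>"
  by (auto simp: mdeg_def mi_le_iff intro: sum_mono)

lemma mdeg_le_imp_eq: "\<alpha> \<le> \<beta> \<Longrightarrow> mdeg \<beta> \<le> mdeg \<alpha> \<Longrightarrow> \<alpha> = \<beta>"
  by (metis add_diff_cancel_left' add_cancel_left_right diff_is_0_eq' mdeg_add mdeg_eq_0_iff mi_add_diff)

lemma finite_mi_le [simp]: "finite {\<beta>. \<beta> \<le> (\<alpha> :: 'n::finite \<Rightarrow> nat)}"
proof -
  have "{\<beta>. \<beta> \<le> \<alpha>} = PiE UNIV (\<lambda>i. {..\<alpha> i})"
    by (auto simp: mi_le_iff PiE_def Pi_def)
  then show ?thesis by (simp add: finite_PiE)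
qed

lemma finite_mdeg_le: "finite {\<alpha> :: 'n::finite \<Rightarrow> nat. mdeg \<alpha> \<le> m}"
  by (rule finite_subset[OF _ finite_mi_le[of "\<lambda>_. m"]])
     (auto simp: mi_le_iff intro: order_trans[OF mdeg_ge])

lemma finite_mdeg [simp]: "finite {\<alpha> :: 'n::finite \<Rightarrow> nat. mdeg \<alpha> = m}"
  by (rule finite_subset[OF _ finite_mdeg_le[of m]]) auto

lemma mi_shift: "\<beta> + \<gamma> = \<alpha> + unit_mi i \<Longrightarrow> \<beta> i \<noteq> 0 \<Longrightarrow> (\<beta> - unit_mi i) + \<gamma> = \<alpha>"
  by (metis (no_types, lifting) add.assoc add.commute add_right_cancel mi_diff_add unit_le_iff)

text \<open>Pairs avoid the truncated subtraction of \<open>ps_mult\<close>: commutativity and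
  associativity become bijections between index sets.\<close>

definition splits :: "('n \<Rightarrow> nat) \<Rightarrow> (('n \<Rightarrow> nat) \<times> ('n \<Rightarrow> nat)) set" where
  "splits \<alpha> = {(\<beta>, \<gamma>). \<beta> + \<gamma> = \<alpha>}"

lemma finite_splits [simp]: "finite (splits (\<alpha> :: 'n::finite \<Rightarrow> nat))"
  by (rule finite_subset[of _ "{\<beta>. \<beta> \<le> \<alpha>} \<times> {\<beta>. \<beta> \<le> \<alpha>}"]) (auto simp: splits_def)

lemma ps_mult_splits: "ps_mult f g \<alpha> = (\<Sum>(\<beta>, \<gamma>)\<in>splits \<alpha>. f \<beta> * g \<gamma>)"
proof -
  have "ps_mult f g \<alpha> = (\<Sum>\<beta> | \<beta> \<le> \<alpha>. f \<beta> * g (\<alpha> - \<beta>))"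
    unfolding ps_mult_def by (intro sum.cong) (auto simp: mi_le_iff fun_diff_def)
  also have "\<dots> = (\<Sum>(\<beta>, \<gamma>)\<in>splits \<alpha>. f \<beta> * g \<gamma>)"
    by (rule sum.reindex_bij_witness[of _ fst "\<lambda>\<beta>. (\<beta>, \<alpha> - \<beta>)"])
       (auto simp: splits_def)
  finally show ?thesis .
qed

subsection \<open>Convergent power series as a ring\<close>

text \<open>The l1 norm of the homogeneous part of degree \<open>m\<close>, that is, a coefficient
  of a majorant in one variable. Products are bounded by Cauchy products, and convergence turns into
  geometric growth.\<close>

definition hnorm :: "nat \<Rightarrow> 'n::finite ps \<Rightarrow> real" where
  "hnorm m f = (\<Sum>\<alpha> | mdeg \<alpha> = m. norm (f \<alpha>))"

lemma hnorm_nonneg [simp]: "0 \<le> hnorm m f"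
  by (simp add: hnorm_def sum_nonneg)

lemma norm_le_hnorm: "norm (f \<alpha>) \<le> hnorm (mdeg \<alpha>) f"
  unfolding hnorm_def by (rule member_le_sum) auto

lemma hnorm_add: "hnorm m (\<lambda>\<alpha>. f \<alpha> + g \<alpha>) \<le> hnorm m f + hnorm m g"
  unfolding hnorm_def sum.distrib[symmetric] by (intro sum_mono norm_triangle_ineq)

lemma hnorm_mult: "hnorm m (ps_mult f g) \<le> (\<Sum>p\<le>m. hnorm p f * hnorm (m - p) g)"
proof -
  have "hnorm m (ps_mult f g)
      \<le> (\<Sum>\<alpha> | mdeg \<alpha> = m. \<Sum>(\<beta>, \<gamma>)\<in>splits \<alpha>. norm (f \<beta>) * norm (g \<gamma>))"
    unfolding hnorm_def ps_mult_splits
    by (intro sum_mono order_trans[OF norm_sum]) (auto simp: norm_mult split_def)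
  also have "\<dots> = (\<Sum>(\<alpha>, \<beta>, \<gamma>)\<in>(SIGMA \<alpha>:{\<alpha>. mdeg \<alpha> = m}. splits \<alpha>). norm (f \<beta>) * norm (g \<gamma>))"
    by (subst sum.Sigma) (auto simp: split_def)
  also have "\<dots> = (\<Sum>(p, \<beta>, \<gamma>)\<in>(SIGMA p:{..m}. {\<beta>. mdeg \<beta> = p} \<times> {\<gamma>. mdeg \<gamma> = m - p}).
                   norm (f \<beta>) * norm (g \<gamma>))"
    by (rule sum.reindex_bij_witness
          [of _ "\<lambda>(p, \<beta>, \<gamma>). (\<beta> + \<gamma>, \<beta>, \<gamma>)" "\<lambda>(\<alpha>, \<beta>, \<gamma>). (mdeg \<beta>, \<beta>, \<gamma>)"])
       (auto simp: splits_def)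
  also have "\<dots> = (\<Sum>p\<le>m. \<Sum>(\<beta>, \<gamma>)\<in>{\<beta>. mdeg \<beta> = p} \<times> {\<gamma>. mdeg \<gamma> = m - p}. norm (f \<beta>) * norm (g \<gamma>))"
    by (subst sum.Sigma) (auto simp: split_def)
  also have "\<dots> = (\<Sum>p\<le>m. hnorm p f * hnorm (m - p) g)"
    by (simp add: hnorm_def sum_product sum.cartesian_product)
  finally show ?thesis .
qed

lemma sum_half_powers_le: "(\<Sum>m\<le>N. (1 / 2 :: real) ^ m) \<le> 2"
proof -
  have "(\<Sum>m\<le>N. (1 / 2 :: real) ^ m) = 2 - (1 / 2) ^ N"
    by (induction N) (auto simp: field_simps)
  then show ?thesis by simp
qed

text \<open>A radius \<open>r\<close> yields the rate \<open>1 / r\<close>. Conversely, at half the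
  radius \<open>1 / B\<close> the homogeneous parts are dominated by
  \<open>H * (1 / 2) ^ m\<close>.\<close>

lemma CS_iff_hnorm: "f \<in> CS \<longleftrightarrow> (\<exists>H B. 0 \<le> H \<and> 1 \<le> B \<and> (\<forall>m. hnorm m f \<le> H * B ^ m))"
proof
  assume "f \<in> CS"
  then obtain r where r: "r > 0" and sm: "(\<lambda>\<alpha>. norm (f \<alpha>) * r ^ mdeg \<alpha>) summable_on UNIV"
    by (auto simp: CS_def convergent_ps_def)
  define H where "H = (\<Sum>\<^sub>\<infinity>\<alpha>. norm (f \<alpha>) * r ^ mdeg \<alpha>)"
  define B where "B = max 1 (1 / r)"
  have H0: "0 \<le> H" unfolding H_def using r by (intro infsum_nonneg) auto
  have "hnorm m f \<le> H * B ^ m" for m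
  proof -
    have "hnorm m f * r ^ m = (\<Sum>\<alpha> | mdeg \<alpha> = m. norm (f \<alpha>) * r ^ mdeg \<alpha>)"
      by (simp add: hnorm_def sum_distrib_right)
    also have "\<dots> \<le> H" unfolding H_def using r
      by (intro finite_sum_le_infsum sm) auto
    finally have "hnorm m f \<le> H * (1 / r) ^ m" using r by (simp add: field_simps)
    also have "\<dots> \<le> H * B ^ m" using r H0
      by (intro mult_left_mono power_mono) (auto simp: B_def)
    finally show ?thesis .
  qed
  then show "\<exists>H B. 0 \<le> H \<and> 1 \<le> B \<and> (\<forall>m. hnorm m f \<le> H * B ^ m)"
    using H0 by (intro exI[of _ H] exI[of _ B]) (auto simp: B_def)
next
  assume "\<exists>H B. 0 \<le> H \<and> 1 \<le> B \<and> (\<forall>m. hnorm m f \<le> H * B ^ m)"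
  then obtain H B where H: "0 \<le> H" and B: "1 \<le> B" and le: "\<And>m. hnorm m f \<le> H * B ^ m" by auto
  define r where "r = 1 / (2 * B)"
  have r: "r > 0" using B by (auto simp: r_def)
  have "(\<lambda>\<alpha>. norm (f \<alpha>) * r ^ mdeg \<alpha>) summable_on UNIV"
  proof (rule nonneg_bdd_above_summable_on)
    show "bdd_above (sum (\<lambda>\<alpha>. norm (f \<alpha>) * r ^ mdeg \<alpha>) ` {F. F \<subseteq> UNIV \<and> finite F})"
    proof (rule bdd_aboveI2)
      fix F :: "('a \<Rightarrow> nat) set" assume "F \<in> {F. F \<subseteq> UNIV \<and> finite F}"
      then have fin: "finite F" by simp
      define N where "N = Max (insert 0 (mdeg ` F))"
      have "sum (\<lambda>\<alpha>. norm (f \<alpha>) * r ^ mdeg \<alpha>) F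
          \<le> (\<Sum>\<alpha> | mdeg \<alpha> \<le> N. norm (f \<alpha>) * r ^ mdeg \<alpha>)"
        using fin r by (intro sum_mono2 finite_mdeg_le) (auto simp: N_def)
      also have "\<dots> = (\<Sum>m\<le>N. \<Sum>\<alpha> | \<alpha> \<in> {\<alpha>. mdeg \<alpha> \<le> N} \<and> mdeg \<alpha> = m. norm (f \<alpha>) * r ^ mdeg \<alpha>)"
        by (rule sum.group[symmetric]) (auto simp: finite_mdeg_le)
      also have "\<dots> = (\<Sum>m\<le>N. hnorm m f * r ^ m)"
        by (intro sum.cong refl) (auto simp: hnorm_def sum_distrib_right intro!: sum.cong)
      also have "\<dots> \<le> (\<Sum>m\<le>N. H * (1 / 2) ^ m)"
      proof (rule sum_mono)
        fix m
        have "hnorm m f * r ^ m \<le> (H * B ^ m) * r ^ m" using r le by (intro mult_right_mono) auto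
        also have "\<dots> = H * (1 / 2) ^ m" using B by (simp add: r_def field_simps)
        finally show "hnorm m f * r ^ m \<le> H * (1 / 2) ^ m" .
      qed
      also have "\<dots> \<le> H * 2"
        unfolding sum_distrib_left[symmetric] using H
        by (intro mult_left_mono sum_half_powers_le)
      finally show "sum (\<lambda>\<alpha>. norm (f \<alpha>) * r ^ mdeg \<alpha>) F \<le> H * 2" .
    qed
  qed (use r in auto)
  then show "f \<in> CS" using r by (auto simp: CS_def convergent_ps_def)
qed

lemma CS_I: "(\<And>m. hnorm m f \<le> H * B ^ m) \<Longrightarrow> 0 \<le> B \<Longrightarrow> f \<in> CS"
proof -
  assume le: "\<And>m. hnorm m f \<le> H * B ^ m" and B: "0 \<le> B"
  have "hnorm m f \<le> \<bar>H\<bar> * (max 1 B) ^ m" for m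
    using B by (intro order_trans[OF le] mult_mono power_mono) auto
  then show ?thesis unfolding CS_iff_hnorm by (intro exI[of _ "\<bar>H\<bar>"] exI[of _ "max 1 B"]) auto
qed

lemma CS_common_bound:
  assumes "f \<in> CS" "g \<in> CS"
  obtains H B where "0 \<le> H" "1 \<le> B" "\<And>m. hnorm m f \<le> H * B ^ m" "\<And>m. hnorm m g \<le> H * B ^ m"
proof -
  obtain H1 B1 where 1: "0 \<le> H1" "1 \<le> B1" "\<And>m. hnorm m f \<le> H1 * B1 ^ m"
    using assms(1) unfolding CS_iff_hnorm by auto
  obtain H2 B2 where 2: "0 \<le> H2" "1 \<le> B2" "\<And>m. hnorm m g \<le> H2 * B2 ^ m"
    using assms(2) unfolding CS_iff_hnorm by auto
  show ?thesis
  proof (rule that[of "max H1 H2" "max B1 B2"])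
    show "hnorm m f \<le> max H1 H2 * max B1 B2 ^ m" for m
      using 1 by (intro order_trans[OF 1(3)] mult_mono power_mono) auto
    show "hnorm m g \<le> max H1 H2 * max B1 B2 ^ m" for m
      using 2 by (intro order_trans[OF 2(3)] mult_mono power_mono) auto
  qed (use 1 2 in auto)
qed

lemma finite_supp_CS:
  assumes "finite {\<alpha>. f \<alpha> \<noteq> 0}"
  shows "f \<in> CS"
proof (rule CS_I[of f "\<Sum>\<alpha> | f \<alpha> \<noteq> 0. norm (f \<alpha>)" 1])
  fix m
  have "hnorm m f = (\<Sum>\<alpha> | mdeg \<alpha> = m \<and> f \<alpha> \<noteq> 0. norm (f \<alpha>))"
    unfolding hnorm_def by (rule sum.mono_neutral_right) auto
  also have "\<dots> \<le> (\<Sum>\<alpha> | f \<alpha> \<noteq> 0. norm (f \<alpha>))"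
    using assms by (intro sum_mono2) auto
  finally show "hnorm m f \<le> (\<Sum>\<alpha> | f \<alpha> \<noteq> 0. norm (f \<alpha>)) * 1 ^ m" by simp
qed simp

lemma Suc_le_power2: "real (m + 1) \<le> 2 ^ m"
  by (induction m) auto

lemma CS_add: "f \<in> CS \<Longrightarrow> g \<in> CS \<Longrightarrow> ps_add f g \<in> CS"
proof -
  assume "f \<in> CS" "g \<in> CS"
  then obtain H B where *: "0 \<le> H" "1 \<le> B" "\<And>m. hnorm m f \<le> H * B ^ m" "\<And>m. hnorm m g \<le> H * B ^ m"
    using CS_common_bound by blast
  show ?thesis
  proof (rule CS_I[of _ "2 * H" B])
    show "hnorm m (ps_add f g) \<le> 2 * H * B ^ m" for m
      using *(3,4)[of m] hnorm_add[of m f g] by (simp add: ps_add_def)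
  qed (use * in auto)
qed

lemma CS_mult: "f \<in> CS \<Longrightarrow> g \<in> CS \<Longrightarrow> ps_mult f g \<in> CS"
proof -
  assume "f \<in> CS" "g \<in> CS"
  then obtain H B where *: "0 \<le> H" "1 \<le> B" "\<And>m. hnorm m f \<le> H * B ^ m" "\<And>m. hnorm m g \<le> H * B ^ m"
    using CS_common_bound by blast
  have "hnorm m (ps_mult f g) \<le> (H * H) * (2 * B) ^ m" for m
  proof -
    have "hnorm m (ps_mult f g) \<le> (\<Sum>p\<le>m. (H * B ^ p) * (H * B ^ (m - p)))"
      using * by (intro order_trans[OF hnorm_mult] sum_mono mult_mono) auto
    also have "\<dots> = (\<Sum>p\<le>m. (H * H) * B ^ m)"
      by (intro sum.cong refl) (auto simp: power_add[symmetric])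
    also have "\<dots> = (H * H) * B ^ m * real (m + 1)" by simp
    \<comment> \<open>The \<open>m + 1\<close> summands are absorbed by doubling the rate.\<close>
    also have "\<dots> \<le> (H * H) * B ^ m * 2 ^ m" using * Suc_le_power2[of m] by (intro mult_left_mono) auto
    finally show ?thesis by (simp add: power_mult_distrib mult_ac)
  qed
  then show ?thesis using * by (intro CS_I[of _ "H * H" "2 * B"]) auto
qed

lemma CS_smult: "f \<in> CS \<Longrightarrow> (\<lambda>\<alpha>. c * f \<alpha>) \<in> CS"
proof -
  assume "f \<in> CS"
  then obtain H B where *: "0 \<le> H" "1 \<le> B" "\<And>m. hnorm m f \<le> H * B ^ m"
    unfolding CS_iff_hnorm by auto
  have "hnorm m (\<lambda>\<alpha>. c * f \<alpha>) = norm c * hnorm m f" for m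
    by (simp add: hnorm_def norm_mult sum_distrib_left)
  then have "hnorm m (\<lambda>\<alpha>. c * f \<alpha>) \<le> norm c * H * B ^ m" for m
    using *(3)[of m] by (simp add: mult_left_mono mult.assoc)
  then show ?thesis using * by (intro CS_I[of _ "norm c * H" B]) auto
qed

lemma ps_mult_commute: "ps_mult f g = ps_mult g f"
  unfolding ps_mult_splits fun_eq_iff
  by (auto intro!: sum.reindex_bij_witness[of _ prod.swap prod.swap] simp: splits_def add.commute)

lemma ps_mult_assoc: "ps_mult (ps_mult f g) h = ps_mult f (ps_mult g h)"
proof
  fix \<alpha> :: "'a \<Rightarrow> nat"
  have "ps_mult (ps_mult f g) h \<alpha> = (\<Sum>(\<mu>, \<gamma>)\<in>splits \<alpha>. \<Sum>(\<beta>, \<delta>)\<in>splits \<mu>. f \<beta> * g \<delta> * h \<gamma>)"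
    by (simp add: ps_mult_splits sum_distrib_right split_def)
  also have "\<dots> = (\<Sum>((\<mu>, \<gamma>), (\<beta>, \<delta>))\<in>(SIGMA x:splits \<alpha>. splits (fst x)). f \<beta> * g \<delta> * h \<gamma>)"
    by (subst sum.Sigma[symmetric]) (auto simp: split_def)
  also have "\<dots> = (\<Sum>((\<beta>, \<nu>), (\<delta>, \<gamma>))\<in>(SIGMA x:splits \<alpha>. splits (snd x)). f \<beta> * (g \<delta> * h \<gamma>))"
    by (rule sum.reindex_bij_witness
         [of _ "\<lambda>((\<beta>, \<nu>), (\<delta>, \<gamma>)). ((\<beta> + \<delta>, \<gamma>), (\<beta>, \<delta>))" "\<lambda>((\<mu>, \<gamma>), (\<beta>, \<delta>)). ((\<beta>, \<delta> + \<gamma>), (\<delta>, \<gamma>))"])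
       (auto simp: splits_def add.assoc mult.assoc)
  also have "\<dots> = (\<Sum>(\<beta>, \<nu>)\<in>splits \<alpha>. \<Sum>(\<delta>, \<gamma>)\<in>splits \<nu>. f \<beta> * (g \<delta> * h \<gamma>))"
    by (subst sum.Sigma[symmetric]) (auto simp: split_def)
  also have "\<dots> = ps_mult f (ps_mult g h) \<alpha>"
    by (simp add: ps_mult_splits sum_distrib_left split_def)
  finally show "ps_mult (ps_mult f g) h \<alpha> = ps_mult f (ps_mult g h) \<alpha>" .
qed

lemma ps_mult_single:
  "ps_mult (\<lambda>\<alpha>. if \<alpha> = \<beta> then c else 0) f \<alpha> = (if \<beta> \<le> \<alpha> then c * f (\<alpha> - \<beta>) else 0)"
proof -
  have "ps_mult (\<lambda>\<alpha>. if \<alpha> = \<beta> then c else 0) f \<alpha>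
      = (\<Sum>\<gamma>\<in>{\<gamma>. \<gamma> \<le> \<alpha>}. if \<gamma> = \<beta> then c * f (\<alpha> - \<beta>) else 0)"
    unfolding ps_mult_def mi_le_iff by (intro sum.cong refl) (auto simp: fun_diff_def)
  also have "\<dots> = (if \<beta> \<le> \<alpha> then c * f (\<alpha> - \<beta>) else 0)"
    by (subst sum.delta) auto
  finally show ?thesis .
qed

lemma ps_mult_add_left: "ps_mult (ps_add f g) h = ps_add (ps_mult f h) (ps_mult g h)"
  by (auto simp: ps_mult_def ps_add_def fun_eq_iff distrib_right sum.distrib)

section \<open>The ring of convergent power series as a type\<close>

typedef 'n cps = "CS :: 'n::finite ps set" morphisms cf Abs_cps
  by (rule exI[of _ "ps_zero"]) (auto intro: finite_supp_CS simp: ps_zero_def)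

setup_lifting type_definition_cps

lemma cps_eqI: "(\<And>\<alpha>. cf f \<alpha> = cf g \<alpha>) \<Longrightarrow> f = g"
  by (simp add: cf_inject[symmetric] fun_eq_iff)

instantiation cps :: (finite) comm_ring_1
begin

lift_definition zero_cps :: "'a cps" is ps_zero
  by (auto intro: finite_supp_CS simp: ps_zero_def)
lift_definition one_cps :: "'a cps" is ps_one
  by (auto intro!: finite_supp_CS simp: ps_one_def)
lift_definition plus_cps :: "'a cps \<Rightarrow> 'a cps \<Rightarrow> 'a cps" is ps_add
  by (rule CS_add)
lift_definition times_cps :: "'a cps \<Rightarrow> 'a cps \<Rightarrow> 'a cps" is ps_mult
  by (rule CS_mult)
lift_definition uminus_cps :: "'a cps \<Rightarrow> 'a cps" is "\<lambda>f \<alpha>. - f \<alpha>"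
  using CS_smult[of _ "-1"] by simp
lift_definition minus_cps :: "'a cps \<Rightarrow> 'a cps \<Rightarrow> 'a cps" is "\<lambda>f g \<alpha>. f \<alpha> - g \<alpha>"
  using CS_add CS_smult[of _ "-1"] by (fastforce simp: ps_add_def)

instance
proof
  fix a b c :: "'a cps"
  show "a * b * c = a * (b * c)" by transfer (rule ps_mult_assoc)
  show "a * b = b * a" by transfer (rule ps_mult_commute)
  have one: "ps_one = (\<lambda>\<alpha> :: 'a \<Rightarrow> nat. if \<alpha> = 0 then 1 else 0)"
    by (simp add: ps_one_def zero_fun_def)
  show "1 * a = a"
    by transfer (rule ext, simp add: one ps_mult_single)
  show "(a + b) * c = a * c + b * c" by transfer (rule ps_mult_add_left)
  show "(0 :: 'a cps) \<noteq> 1" by transfer (auto simp: ps_zero_def ps_one_def fun_eq_iff)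
qed (transfer; auto simp: ps_add_def ps_zero_def fun_eq_iff)+

end

lemma cf_zero [simp]: "cf 0 \<alpha> = 0"
  by transfer (simp add: ps_zero_def)
lemma cf_add [simp]: "cf (f + g) \<alpha> = cf f \<alpha> + cf g \<alpha>"
  by transfer (simp add: ps_add_def)
lemma cf_uminus [simp]: "cf (- f) \<alpha> = - cf f \<alpha>"
  by transfer simp
lemma cf_diff [simp]: "cf (f - g) \<alpha> = cf f \<alpha> - cf g \<alpha>"
  by transfer simp
lemma cf_sum [simp]: "cf (\<Sum>x\<in>S. F x) \<alpha> = (\<Sum>x\<in>S. cf (F x) \<alpha>)"
  by (induction S rule: infinite_finite_induct) auto
lemma cf_mult: "cf (f * g) \<alpha> = (\<Sum>(\<beta>, \<gamma>)\<in>splits \<alpha>. cf f \<beta> * cf g \<gamma>)"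
  by transfer (rule ps_mult_splits)

lemma cf_mult_zero [simp]: "cf (f * g) 0 = cf f 0 * cf g 0"
proof -
  have "splits (0 :: 'a \<Rightarrow> nat) = {(0, 0)}" by (auto simp: splits_def)
  then show ?thesis by (simp add: cf_mult)
qed

lift_definition cterm :: "complex \<Rightarrow> ('n::finite \<Rightarrow> nat) \<Rightarrow> 'n cps" is
  "\<lambda>c \<beta> \<alpha>. if \<alpha> = \<beta> then c else 0"
  by (auto intro!: finite_supp_CS)

abbreviation cst :: "complex \<Rightarrow> 'n::finite cps" where "cst c \<equiv> cterm c 0"
abbreviation mon :: "('n::finite \<Rightarrow> nat) \<Rightarrow> 'n cps" where "mon \<equiv> cterm 1"
abbreviation var :: "'n \<Rightarrow> 'n::finite cps" where "var i \<equiv> cterm 1 (unit_mi i)"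

lemma cf_cterm: "cf (cterm c \<beta>) \<alpha> = (if \<alpha> = \<beta> then c else 0)"
  by transfer simp

lemma cf_cterm_mult: "cf (cterm c \<beta> * f) \<alpha> = (if \<beta> \<le> \<alpha> then c * cf f (\<alpha> - \<beta>) else 0)"
  by transfer (rule ps_mult_single)

lemma cf_cst_mult [simp]: "cf (cst c * f) \<alpha> = c * cf f \<alpha>"
  by (simp add: cf_cterm_mult)

lemma cst_one [simp]: "cst 1 = 1"
  by transfer (auto simp: ps_one_def zero_fun_def)

lemma cst_zero [simp]: "cterm 0 \<beta> = 0"
  by (rule cps_eqI) (simp add: cf_cterm)

lemma cf_one: "cf 1 \<alpha> = (if \<alpha> = 0 then 1 else 0)"
  unfolding cst_one[symmetric] cf_cterm ..

lemma cterm_mult: "cterm c \<alpha> * cterm d \<beta> = cterm (c * d) (\<alpha> + \<beta>)"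
  by (rule cps_eqI) (auto simp: cf_cterm_mult cf_cterm)

lemma cst_add: "cst (c + d) = cst c + cst d"
  by (rule cps_eqI) (simp add: cf_cterm)

lemma cst_minus_one: "cst (- 1) = - 1"
  by (rule cps_eqI) (simp add: cf_cterm cf_one)

section \<open>Partial derivatives\<close>

lemma hnorm_pderiv: "hnorm m (pderiv_ps i f) \<le> real (m + 1) * hnorm (m + 1) f"
proof -
  have "hnorm m (pderiv_ps i f) = (\<Sum>\<alpha> | mdeg \<alpha> = m. real (\<alpha> i + 1) * norm (f (\<alpha> + unit_mi i)))"
    unfolding hnorm_def pderiv_ps_def fun_upd_unit by (simp add: norm_mult del: of_nat_Suc of_nat_add)
  also have "\<dots> \<le> (\<Sum>\<alpha> | mdeg \<alpha> = m. real (m + 1) * norm (f (\<alpha> + unit_mi i)))"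
    using mdeg_ge by (intro sum_mono mult_right_mono) fastforce+
  also have "\<dots> = real (m + 1) * (\<Sum>\<alpha> | mdeg \<alpha> = m. norm (f (\<alpha> + unit_mi i)))"
    by (simp add: sum_distrib_left)
  also have "(\<Sum>\<alpha> | mdeg \<alpha> = m. norm (f (\<alpha> + unit_mi i)))
      = (\<Sum>\<alpha>\<in>(\<lambda>\<alpha>. \<alpha> + unit_mi i) ` {\<alpha>. mdeg \<alpha> = m}. norm (f \<alpha>))"
    by (subst sum.reindex) (auto simp: inj_on_def)
  also have "\<dots> \<le> hnorm (m + 1) f" unfolding hnorm_def by (intro sum_mono2) auto
  finally show ?thesis by (simp add: mult_left_mono)
qed

lift_definition pd :: "'n \<Rightarrow> 'n::finite cps \<Rightarrow> 'n cps" is pderiv_ps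
proof -
  fix i :: 'n and f :: "'n ps" assume "f \<in> CS"
  then obtain H B where *: "0 \<le> H" "1 \<le> B" "\<And>m. hnorm m f \<le> H * B ^ m"
    unfolding CS_iff_hnorm by auto
  have "hnorm m (pderiv_ps i f) \<le> (H * B) * (2 * B) ^ m" for m
  proof -
    have "hnorm m (pderiv_ps i f) \<le> 2 ^ m * (H * B ^ (m + 1))"
      by (intro order_trans[OF hnorm_pderiv] mult_mono Suc_le_power2 *(3)) auto
    then show ?thesis by (simp add: power_mult_distrib mult_ac)
  qed
  then show "pderiv_ps i f \<in> CS" using * by (intro CS_I[of _ "H * B" "2 * B"]) auto
qed

lemma cf_pd: "cf (pd i f) \<alpha> = of_nat (\<alpha> i + 1) * cf f (\<alpha> + unit_mi i)"
  by transfer (simp only: pderiv_ps_def fun_upd_unit)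

lemma pd_add [simp]: "pd i (f + g) = pd i f + pd i g"
  by (rule cps_eqI) (simp add: cf_pd algebra_simps)

lemma pd_cst_mult [simp]: "pd i (cst c * f) = cst c * pd i f"
  by (rule cps_eqI) (simp add: cf_pd)

text \<open>If \<open>(\<beta>, \<gamma>)\<close> splits \<open>\<alpha> + unit_mi i\<close>, the
  factor \<open>\<alpha> i + 1\<close> is \<open>\<beta> i + \<gamma> i\<close>, and each half
  differentiates one factor.\<close>

lemma pd_mult: "pd i (f * g) = pd i f * g + f * pd i g"
proof (rule cps_eqI)
  \<comment> \<open>Pairs with \<open>\<beta> i = 0\<close> carry weight zero; the others are
    shifted by \<open>unit_mi i\<close> to splittings of \<open>\<alpha>\<close>.\<close>
  have *: "(\<Sum>(\<beta>, \<gamma>)\<in>splits (\<alpha> + unit_mi i). of_nat (\<beta> i) * cf f \<beta> * cf g \<gamma>) = cf (pd i f * g) \<alpha>"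
    for f g :: "'a cps" and \<alpha>
  proof -
    have "(\<Sum>(\<beta>, \<gamma>)\<in>splits (\<alpha> + unit_mi i). of_nat (\<beta> i) * cf f \<beta> * cf g \<gamma>)
       = (\<Sum>(\<beta>, \<gamma>)\<in>{x \<in> splits (\<alpha> + unit_mi i). fst x i \<noteq> 0}. of_nat (\<beta> i) * cf f \<beta> * cf g \<gamma>)"
      by (rule sum.mono_neutral_right) auto
    also have "\<dots> = (\<Sum>(\<beta>, \<gamma>)\<in>splits \<alpha>. of_nat (\<beta> i + 1) * cf f (\<beta> + unit_mi i) * cf g \<gamma>)"
      by (rule sum.reindex_bij_witness
           [of _ "\<lambda>(\<beta>, \<gamma>). (\<beta> + unit_mi i, \<gamma>)" "\<lambda>(\<beta>, \<gamma>). (\<beta> - unit_mi i, \<gamma>)"])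
         (auto simp: splits_def mi_shift add.assoc add.commute[of "unit_mi i"])
    also have "\<dots> = cf (pd i f * g) \<alpha>" by (simp add: cf_mult cf_pd)
    finally show ?thesis .
  qed
  fix \<alpha>
  have "cf (pd i (f * g)) \<alpha> = (\<Sum>(\<beta>, \<gamma>)\<in>splits (\<alpha> + unit_mi i). of_nat (\<alpha> i + 1) * (cf f \<beta> * cf g \<gamma>))"
    by (simp add: cf_pd cf_mult sum_distrib_left split_def)
  also have "\<dots> = (\<Sum>(\<beta>, \<gamma>)\<in>splits (\<alpha> + unit_mi i).
      of_nat (\<beta> i) * cf f \<beta> * cf g \<gamma> + of_nat (\<gamma> i) * cf g \<gamma> * cf f \<beta>)"
  proof (intro sum.cong refl, clarify)
    fix \<beta> \<gamma> assume "(\<beta>, \<gamma>) \<in> splits (\<alpha> + unit_mi i)"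
    then have "\<alpha> i + 1 = \<beta> i + \<gamma> i" by (auto simp: splits_def fun_eq_iff dest: spec[of _ i])
    then show "of_nat (\<alpha> i + 1) * (cf f \<beta> * cf g \<gamma>)
      = of_nat (\<beta> i) * cf f \<beta> * cf g \<gamma> + of_nat (\<gamma> i) * cf g \<gamma> * cf f \<beta>"
      by (simp only:) (simp add: algebra_simps)
  qed
  also have "\<dots> = cf (pd i f * g) \<alpha> + (\<Sum>(\<beta>, \<gamma>)\<in>splits (\<alpha> + unit_mi i). of_nat (\<gamma> i) * cf g \<gamma> * cf f \<beta>)"
    by (simp add: split_def sum.distrib *[symmetric])
  also have "(\<Sum>(\<beta>, \<gamma>)\<in>splits (\<alpha> + unit_mi i). of_nat (\<gamma> i) * cf g \<gamma> * cf f \<beta>) = cf (pd i g * f) \<alpha>"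
    unfolding *[symmetric]
    by (rule sum.reindex_bij_witness[of _ prod.swap prod.swap]) (auto simp: splits_def add.commute)
  finally show "cf (pd i (f * g)) \<alpha> = cf (pd i f * g + f * pd i g) \<alpha>" by (simp add: mult.commute)
qed

subsection \<open>Majorants\<close>

definition hn :: "nat \<Rightarrow> 'n::finite cps \<Rightarrow> real" where
  "hn m f = hnorm m (cf f)"

lemma hn_nonneg [simp]: "0 \<le> hn m f"
  by (simp add: hn_def)

lemma hn_zero [simp]: "hn m 0 = 0"
  by (simp add: hn_def hnorm_def)

lemma hn_add: "hn m (f + g) \<le> hn m f + hn m g"
  using hnorm_add[of m "cf f" "cf g"] by (simp add: hn_def plus_cps.rep_eq ps_add_def)

lemma hn_sum: "hn m (\<Sum>x\<in>S. F x) \<le> (\<Sum>x\<in>S. hn m (F x))"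
  by (induction S rule: infinite_finite_induct) (auto intro!: order_trans[OF hn_add])

lemma hn_cst_mult: "hn m (cst c * f) = norm c * hn m f"
  by (simp add: hn_def hnorm_def norm_mult sum_distrib_left)

lemma hn_uminus [simp]: "hn m (- f) = hn m f"
  by (simp add: hn_def hnorm_def)

lemma hn_mult: "hn m (f * g) \<le> (\<Sum>p\<le>m. hn p f * hn (m - p) g)"
  unfolding hn_def times_cps.rep_eq by (rule hnorm_mult)

lemma hn_pd: "hn m (pd i f) \<le> real (m + 1) * hn (m + 1) f"
  unfolding hn_def pd.rep_eq by (rule hnorm_pderiv)

lemma cps_finite_bound:
  assumes "finite S"
  obtains H B where "0 \<le> H" "1 \<le> B" "\<And>x m. x \<in> S \<Longrightarrow> hn m (F x) \<le> H * B ^ m"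
proof -
  have "\<exists>H B. 0 \<le> H \<and> 1 \<le> B \<and> (\<forall>x\<in>S. \<forall>m. hn m (F x) \<le> H * B ^ m)"
    using assms
  proof (induction S)
    case empty
    show ?case by (intro exI[of _ 0] exI[of _ 1]) auto
  next
    case (insert y S)
    then obtain H B where 1: "0 \<le> H" "1 \<le> B" "\<And>x m. x \<in> S \<Longrightarrow> hn m (F x) \<le> H * B ^ m" by blast
    obtain H' B' where 2: "0 \<le> H'" "1 \<le> B'" "\<And>m. hn m (F y) \<le> H' * B' ^ m"
      using cf[of "F y"] unfolding CS_iff_hnorm hn_def by blast
    have "hn m (F x) \<le> max H H' * max B B' ^ m" if "x \<in> insert y S" for x m
      using that
    proof
      assume "x = y"
      then show ?thesis
        using 2 by (simp, intro order_trans[OF 2(3)] mult_mono power_mono) auto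
    next
      assume "x \<in> S"
      then show ?thesis
        using 1 by (intro order_trans[OF 1(3)] mult_mono power_mono) auto
    qed
    then show ?case using 1 2 by (intro exI[of _ "max H H'"] exI[of _ "max B B'"]) auto
  qed
  then show ?thesis using that by blast
qed

text \<open>A factor of two between the rates makes a convolution summable: the summand with index
  \<open>p\<close> gains \<open>(1 / 2) ^ p\<close>, and no factor depending on \<open>m\<close> is
  lost.\<close>

lemma power_split_half_le:
  fixes B B1 :: real
  assumes "0 \<le> B" "2 * B \<le> B1" "p \<le> m"
  shows "B ^ p * B1 ^ (m - p) \<le> B1 ^ m * (1 / 2) ^ p"
proof -
  have "B ^ p * B1 ^ (m - p) \<le> (B1 * (1 / 2)) ^ p * B1 ^ (m - p)"
    using assms by (intro mult_right_mono power_mono) auto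
  also have "\<dots> = (B1 ^ p * B1 ^ (m - p)) * (1 / 2) ^ p"
    by (simp only: power_mult_distrib mult_ac)
  also have "B1 ^ p * B1 ^ (m - p) = B1 ^ m"
    using assms by (simp flip: power_add)
  finally show ?thesis .
qed

text \<open>The weight \<open>w\<close> leaves the convolution by monotonicity. It is kept apart
  from the rate because repeated differentiation makes it grow with \<open>m\<close>.\<close>

lemma hn_mult_le:
  assumes "0 \<le> C" "0 < B" "2 * B \<le> B1" "\<And>m. hn m a \<le> C * B ^ m"
    and "mono_on UNIV w" "\<And>m. 0 \<le> w m" "\<And>m. hn m f \<le> w m * B1 ^ m"
  shows "hn m (a * f) \<le> 2 * C * w m * B1 ^ m"
proof -
  have "hn m (a * f) \<le> (\<Sum>p\<le>m. hn p a * hn (m - p) f)" by (rule hn_mult)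
  also have "\<dots> \<le> (\<Sum>p\<le>m. (C * w m * B1 ^ m) * (1 / 2) ^ p)"
  proof (rule sum_mono)
    fix p assume "p \<in> {..m}"
    then have p: "p \<le> m" by simp
    have "hn p a * hn (m - p) f \<le> (C * B ^ p) * (w (m - p) * B1 ^ (m - p))"
      using assms by (intro mult_mono) auto
    also have "\<dots> \<le> (C * B ^ p) * (w m * B1 ^ (m - p))"
      using assms by (intro mult_left_mono mult_right_mono mono_onD[OF assms(5)]) auto
    also have "\<dots> = (C * w m) * (B ^ p * B1 ^ (m - p))" by (simp add: mult_ac)
    also have "\<dots> \<le> (C * w m) * (B1 ^ m * (1 / 2) ^ p)"
      using assms p by (intro mult_left_mono power_split_half_le) auto
    finally show "hn p a * hn (m - p) f \<le> (C * w m * B1 ^ m) * (1 / 2) ^ p" by (simp add: mult_ac)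
  qed
  also have "\<dots> \<le> (C * w m * B1 ^ m) * 2"
    unfolding sum_distrib_left[symmetric] using assms
    by (intro mult_left_mono sum_half_powers_le) auto
  finally show ?thesis by (simp add: mult_ac)
qed

text \<open>The constant must not depend on \<open>B1\<close>: this is what gives a common lifetime of the flow
  for all power series, whatever their radius of convergence.\<close>

lemma hn_mult_pd_le:
  assumes "0 \<le> C" "0 < B" "2 * B \<le> B1" "\<And>m. hn m a \<le> C * B ^ m" "cf a 0 = 0"
    and "mono_on UNIV w" "\<And>m. 0 \<le> w m" "\<And>m. hn m f \<le> w m * B1 ^ m"
  shows "hn m (a * pd i f) \<le> 4 * C * B * real m * w m * B1 ^ m"
proof -
  \<comment> \<open>The summand \<open>p = 0\<close> would involve degree \<open>m + 1\<close> of
    \<open>f\<close> and bring in a factor \<open>B1\<close>. It vanishes, so only degrees up to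
    \<open>m\<close> of \<open>f\<close> enter, and the extra factor is \<open>B\<close>.\<close>
  have a0: "hn 0 a = 0" using assms(5) by (simp add: hn_def hnorm_def)
  have "hn m (a * pd i f) \<le> (\<Sum>p\<le>m. hn p a * hn (m - p) (pd i f))" by (rule hn_mult)
  also have "\<dots> \<le> (\<Sum>p\<le>m. (2 * C * B * real m * w m * B1 ^ m) * (1 / 2) ^ p)"
  proof (rule sum_mono)
    fix p assume "p \<in> {..m}"
    then have p: "p \<le> m" by simp
    show "hn p a * hn (m - p) (pd i f) \<le> (2 * C * B * real m * w m * B1 ^ m) * (1 / 2) ^ p"
    proof (cases p)
      case 0
      then show ?thesis using a0 assms by auto
    next
      case (Suc q)
      have mq: "m - p + 1 = m - q" using Suc p by simp
      have "hn (m - p) (pd i f) \<le> real (m - q) * hn (m - q) f"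
        using hn_pd[of "m - p" i f] unfolding mq .
      also have "\<dots> \<le> real m * (w (m - q) * B1 ^ (m - q))"
        using assms by (intro mult_mono) auto
      also have "\<dots> \<le> real m * (w m * B1 ^ (m - q))"
        using assms by (intro mult_left_mono mult_right_mono mono_onD[OF assms(6)]) auto
      finally have "hn p a * hn (m - p) (pd i f) \<le> (C * B ^ p) * (real m * (w m * B1 ^ (m - q)))"
        using assms by (intro mult_mono) auto
      also have "\<dots> = (C * B * real m * w m) * (B ^ q * B1 ^ (m - q))" by (simp add: mult_ac Suc)
      also have "\<dots> \<le> (C * B * real m * w m) * (B1 ^ m * (1 / 2) ^ q)"
        using assms p Suc by (intro mult_left_mono power_split_half_le) auto
      finally show ?thesis by (simp add: mult_ac Suc)
    qed
  qed
  also have "\<dots> \<le> (2 * C * B * real m * w m * B1 ^ m) * 2"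
    unfolding sum_distrib_left[symmetric] using assms
    by (intro mult_left_mono sum_half_powers_le) auto
  finally show ?thesis by (simp add: mult_ac)
qed

text \<open>The coefficient of \<open>s ^ k\<close> in \<open>(1 - s) ^ (- m)\<close>, which solves
  \<open>y' = m * y / (1 - s)\<close> with \<open>y = 1\<close> at \<open>s = 0\<close>: the scalar
  model of the flow in degree \<open>m\<close>. Truncated subtraction gives the right values for
  \<open>m = 0\<close>: one for \<open>k = 0\<close>, otherwise zero.\<close>

definition rising_coeff :: "nat \<Rightarrow> nat \<Rightarrow> real" where
  "rising_coeff m k = real ((m + k - 1) choose k)"

lemma rising_coeff_0 [simp]: "rising_coeff m 0 = 1"
  by (simp add: rising_coeff_def)

lemma rising_coeff_nonneg [simp]: "0 \<le> rising_coeff m k"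
  by (simp add: rising_coeff_def)

lemma rising_coeff_mono: "m \<le> n \<Longrightarrow> rising_coeff m k \<le> rising_coeff n k"
  unfolding rising_coeff_def by (intro of_nat_mono binomial_right_mono) auto

text \<open>The exponents separate: \<open>2 ^ m\<close> goes into the rate in the degree and
  \<open>2 ^ k\<close> into the growth in time, so the lifetime does not depend on the
  degree.\<close>

lemma rising_coeff_le: "rising_coeff m k \<le> 2 ^ m * 2 ^ k"
proof -
  have "(m + k - 1) choose k \<le> 2 ^ (m + k - 1)" by (rule binomial_le_pow2)
  also have "\<dots> \<le> 2 ^ (m + k)" by (rule power_increasing) auto
  finally have "real ((m + k - 1) choose k) \<le> real (2 ^ (m + k))" by (simp only: of_nat_le_iff)
  then show ?thesis by (simp add: rising_coeff_def power_add)
qed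

text \<open>Coefficient comparison in the differential equation of \<open>(1 - s) ^ (- m)\<close>;
  the recursions of \<open>flow\<close> and \<open>inv_flow\<close> have this shape. The proof
  combines absorption identities for binomials with the hockey-stick sum.\<close>

lemma rising_coeff_rec:
  "real (Suc k) * rising_coeff m (Suc k) = real m * (\<Sum>i\<le>k. rising_coeff m i)"
proof (cases m)
  case 0
  then show ?thesis by (simp add: rising_coeff_def binomial_eq_0)
next
  case (Suc r)
  have "Suc k * (Suc (r + k) choose Suc k) = Suc (r + k) * ((r + k) choose k)"
    using binomial_absorption[of k "Suc (r + k)"] by simp
  also have "\<dots> = (Suc (r + k) - k) * (Suc (r + k) choose k)"
    using binomial_absorb_comp[of "Suc (r + k)" k] by simp
  also have "\<dots> = m * (\<Sum>i\<le>k. (r + i) choose i)"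
    using Suc sum_choose_lower[of r k] by simp
  finally have "real (Suc k * (Suc (r + k) choose Suc k)) = real (m * (\<Sum>i\<le>k. (r + i) choose i))"
    by (simp only:)
  then have *: "real (Suc k) * real (Suc (r + k) choose Suc k) = real m * (\<Sum>i\<le>k. real ((r + i) choose i))"
    by (simp only: of_nat_mult of_nat_sum)
  have "m + Suc k - 1 = Suc (r + k)" "\<And>i. m + i - 1 = r + i" using Suc by auto
  then show ?thesis unfolding rising_coeff_def by (simp only: *)
qed

subsection \<open>Antidiagonal sums\<close>

definition antidiag :: "nat \<Rightarrow> (nat \<times> nat) set" where
  "antidiag k = {(i, j). i + j = k}"

lemma finite_antidiag [simp]: "finite (antidiag k)"
  by (rule finite_subset[of _ "{..k} \<times> {..k}"]) (auto simp: antidiag_def)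

lemma antidiag_0 [simp]: "antidiag 0 = {(0, 0)}"
  by (auto simp: antidiag_def)

lemma sum_antidiag: "(\<Sum>(i, j)\<in>antidiag k. F i j) = (\<Sum>i\<le>k. F i (k - i))"
  by (rule sum.reindex_bij_witness[of _ "\<lambda>i. (i, k - i)" fst]) (auto simp: antidiag_def)

lemma sum_antidiag_swap: "(\<Sum>(i, j)\<in>antidiag k. F i j) = (\<Sum>(j, i)\<in>antidiag k. F i j)"
  by (rule sum.reindex_bij_witness[of _ prod.swap prod.swap]) (auto simp: antidiag_def)

lemma sum_antidiag_assoc:
  "(\<Sum>(a, b)\<in>antidiag k. \<Sum>(c, d)\<in>antidiag a. F c d b)
   = (\<Sum>(c, e)\<in>antidiag k. \<Sum>(d, b)\<in>antidiag e. F c d b)"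
proof -
  have "(\<Sum>(a, b)\<in>antidiag k. \<Sum>(c, d)\<in>antidiag a. F c d b)
      = (\<Sum>((a, b), (c, d))\<in>(SIGMA x:antidiag k. antidiag (fst x)). F c d b)"
    by (subst sum.Sigma[symmetric]) (auto simp: split_def)
  also have "\<dots> = (\<Sum>((c, e), (d, b))\<in>(SIGMA x:antidiag k. antidiag (snd x)). F c d b)"
    by (rule sum.reindex_bij_witness
         [of _ "\<lambda>((c, e), (d, b)). ((c + d, b), (c, d))" "\<lambda>((a, b), (c, d)). ((c, d + b), (d, b))"])
       (auto simp: antidiag_def)
  also have "\<dots> = (\<Sum>(c, e)\<in>antidiag k. \<Sum>(d, b)\<in>antidiag e. F c d b)"
    by (subst sum.Sigma[symmetric]) (auto simp: split_def)
  finally show ?thesis .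
qed

lemma sum_antidiag_Suc_fst:
  assumes "\<And>b. F 0 b = 0"
  shows "(\<Sum>(a, b)\<in>antidiag (Suc k). F a b) = (\<Sum>(a, b)\<in>antidiag k. F (Suc a) b)"
  unfolding sum_antidiag by (subst sum.atMost_Suc_shift) (simp add: assms)

lemma sum_antidiag_Suc_snd:
  assumes "\<And>a. F a 0 = 0"
  shows "(\<Sum>(a, b)\<in>antidiag (Suc k). F a b) = (\<Sum>(a, b)\<in>antidiag k. F a (Suc b))"
  by (subst (1 2) sum_antidiag_swap) (rule sum_antidiag_Suc_fst, rule assms)

text \<open>The product rule for the derivative in \<open>t\<close>, read on coefficients, since
  \<open>Suc k = a + b\<close> on the antidiagonal. The identities between flow coefficients below
  are proved by comparing such derivatives.\<close>

lemma cst_Suc_mult_sum_antidiag: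
  fixes F :: "nat \<Rightarrow> nat \<Rightarrow> 'n::finite cps"
  shows "cst (of_nat (Suc k)) * (\<Sum>(a, b)\<in>antidiag (Suc k). F a b)
    = (\<Sum>(a, b)\<in>antidiag k. cst (of_nat (Suc a)) * F (Suc a) b)
    + (\<Sum>(a, b)\<in>antidiag k. cst (of_nat (Suc b)) * F a (Suc b))"
proof -
  have "cst (of_nat (Suc k)) * (\<Sum>(a, b)\<in>antidiag (Suc k). F a b)
     = (\<Sum>(a, b)\<in>antidiag (Suc k). cst (of_nat a) * F a b + cst (of_nat b) * F a b)"
    unfolding sum_distrib_left
  proof (intro sum.cong refl, clarify)
    fix a b assume "(a, b) \<in> antidiag (Suc k)"
    then have "Suc k = a + b" by (simp add: antidiag_def)
    then show "cst (of_nat (Suc k)) * F a b = cst (of_nat a) * F a b + cst (of_nat b) * F a b"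
      by (simp only: of_nat_add cst_add distrib_right)
  qed
  also have "\<dots> = (\<Sum>(a, b)\<in>antidiag (Suc k). cst (of_nat a) * F a b)
               + (\<Sum>(a, b)\<in>antidiag (Suc k). cst (of_nat b) * F a b)"
    by (simp add: split_def sum.distrib)
  also have "(\<Sum>(a, b)\<in>antidiag (Suc k). cst (of_nat a) * F a b)
    = (\<Sum>(a, b)\<in>antidiag k. cst (of_nat (Suc a)) * F (Suc a) b)"
    by (rule sum_antidiag_Suc_fst) simp
  also have "(\<Sum>(a, b)\<in>antidiag (Suc k). cst (of_nat b) * F a b)
    = (\<Sum>(a, b)\<in>antidiag k. cst (of_nat (Suc b)) * F a (Suc b))"
    by (rule sum_antidiag_Suc_snd) simp
  finally show ?thesis .
qed

lemma cst_mult_cancel: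
  assumes "c \<noteq> 0" "cst c * x = cst c * y"
  shows "x = y"
proof (rule cps_eqI)
  fix \<alpha>
  have "cf (cst c * x) \<alpha> = cf (cst c * y) \<alpha>" using assms(2) by simp
  then show "cf x \<alpha> = cf y \<alpha>" using assms(1) by simp
qed

lemma cst_Suc_inverse: "cst (of_nat (Suc k)) * (cst (1 / of_nat (Suc k)) * x) = x"
  by (rule cps_eqI) (simp del: of_nat_Suc)

subsection \<open>Flow of a time-dependent vector field\<close>

definition vf :: "('n::finite \<Rightarrow> 'n cps) \<Rightarrow> 'n cps \<Rightarrow> 'n cps" where
  "vf \<xi> f = (\<Sum>i\<in>UNIV. \<xi> i * pd i f)"

definition cps_linear :: "('n::finite cps \<Rightarrow> 'm::finite cps) \<Rightarrow> bool" where
  "cps_linear T \<longleftrightarrow> (\<forall>f g. T (f + g) = T f + T g) \<and> (\<forall>c f. T (cst c * f) = cst c * T f)"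

lemma cps_linear_add: "cps_linear T \<Longrightarrow> T (f + g) = T f + T g"
  and cps_linear_cst: "cps_linear T \<Longrightarrow> T (cst c * f) = cst c * T f"
  by (auto simp: cps_linear_def)

lemma cps_linear_0: "cps_linear T \<Longrightarrow> T 0 = 0"
  using cps_linear_cst[of T 0 0] by simp

lemma cps_linear_uminus: "cps_linear T \<Longrightarrow> T (- f) = - T f"
  using cps_linear_cst[of T "-1" f] by (simp add: cst_minus_one)

lemma cps_linear_sum: "cps_linear T \<Longrightarrow> T (\<Sum>x\<in>S. F x) = (\<Sum>x\<in>S. T (F x))"
  by (induction S rule: infinite_finite_induct) (auto simp: cps_linear_0 cps_linear_add)

lemma cps_linear_mult_left: "cps_linear T \<Longrightarrow> cps_linear (\<lambda>f. a * T f)"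
  by (auto simp: cps_linear_def algebra_simps)

lemma cps_linear_setsum: "(\<And>x. x \<in> S \<Longrightarrow> cps_linear (T x)) \<Longrightarrow> cps_linear (\<lambda>f. \<Sum>x\<in>S. T x f)"
  by (auto simp: cps_linear_def sum.distrib sum_distrib_left)

lemma cps_linear_comp: "cps_linear T \<Longrightarrow> cps_linear U \<Longrightarrow> cps_linear (\<lambda>f. T (U f))"
  by (auto simp: cps_linear_def)

lemma cps_linear_pd: "cps_linear (pd i)"
  by (auto simp: cps_linear_def)

lemma cps_linear_vf: "cps_linear (vf \<xi>)"
  unfolding vf_def by (intro cps_linear_setsum cps_linear_mult_left cps_linear_pd)

lemma vf_mult: "vf \<xi> (f * g) = vf \<xi> f * g + f * vf \<xi> g"
  by (simp add: vf_def pd_mult sum_distrib_left sum_distrib_right sum.distrib algebra_simps)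

text \<open>\<open>flow X k\<close> and \<open>inv_flow X k\<close> are the coefficients of \<open>t^k\<close> of the solutions of
  \<open>\<Phi>' = - \<Phi> \<circ> D\<close> and \<open>\<Psi>' = D \<circ> \<Psi>\<close> with initial value the identity, where \<open>D\<close> is the vector field
  \<open>\<Sum>k. t^k * vf (X k)\<close>.\<close>

fun flow :: "(nat \<Rightarrow> 'n::finite \<Rightarrow> 'n cps) \<Rightarrow> nat \<Rightarrow> 'n cps \<Rightarrow> 'n cps" where
  "flow X 0 h = h"
| "flow X (Suc k) h = - (cst (1 / of_nat (Suc k)) * (\<Sum>i\<le>k. flow X i (vf (X (k - i)) h)))"

fun inv_flow :: "(nat \<Rightarrow> 'n::finite \<Rightarrow> 'n cps) \<Rightarrow> nat \<Rightarrow> 'n cps \<Rightarrow> 'n cps" where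
  "inv_flow X 0 h = h"
| "inv_flow X (Suc k) h = cst (1 / of_nat (Suc k)) * (\<Sum>i\<le>k. vf (X (k - i)) (inv_flow X i h))"

declare flow.simps(2) [simp del] inv_flow.simps(2) [simp del]

lemma flow_Suc:
  "cst (of_nat (Suc k)) * flow X (Suc k) h = - (\<Sum>(i, j)\<in>antidiag k. flow X i (vf (X j) h))"
  by (simp only: flow.simps(2) sum_antidiag mult_minus_right cst_Suc_inverse)

lemma sum_vf_flow:
  "(\<Sum>(i, j)\<in>antidiag k. flow X i (vf (X j) h)) = - (cst (of_nat (Suc k)) * flow X (Suc k) h)"
  by (simp only: flow_Suc minus_minus)

lemma inv_flow_Suc:
  "cst (of_nat (Suc k)) * inv_flow X (Suc k) h = (\<Sum>(j, i)\<in>antidiag k. vf (X j) (inv_flow X i h))"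
  by (subst sum_antidiag_swap) (simp only: inv_flow.simps(2) sum_antidiag cst_Suc_inverse)

lemma cps_linear_flow: "cps_linear (flow X k)"
proof (induction k rule: less_induct)
  case (less k)
  show ?case
  proof (cases k)
    case 0
    then show ?thesis by (simp add: cps_linear_def)
  next
    case (Suc l)
    have "cps_linear (\<lambda>h. (- cst (1 / of_nat (Suc l))) * (\<Sum>i\<le>l. flow X i (vf (X (l - i)) h)))"
      using less Suc
      by (intro cps_linear_mult_left cps_linear_setsum cps_linear_comp[OF _ cps_linear_vf]) auto
    moreover have "(\<lambda>h. (- cst (1 / of_nat (Suc l))) * (\<Sum>i\<le>l. flow X i (vf (X (l - i)) h))) = flow X k"
      by (rule ext) (simp add: Suc flow.simps(2))
    ultimately show ?thesis by simp
  qed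
qed

lemma cps_linear_inv_flow: "cps_linear (inv_flow X k)"
proof (induction k rule: less_induct)
  case (less k)
  show ?case
  proof (cases k)
    case 0
    then show ?thesis by (simp add: cps_linear_def)
  next
    case (Suc l)
    have "cps_linear (\<lambda>h. cst (1 / of_nat (Suc l)) * (\<Sum>i\<le>l. vf (X (l - i)) (inv_flow X i h)))"
      using less Suc
      by (intro cps_linear_mult_left cps_linear_setsum cps_linear_comp[OF cps_linear_vf]) auto
    moreover have "(\<lambda>h. cst (1 / of_nat (Suc l)) * (\<Sum>i\<le>l. vf (X (l - i)) (inv_flow X i h))) = inv_flow X k"
      by (rule ext) (simp add: Suc inv_flow.simps(2))
    ultimately show ?thesis by simp
  qed
qed

text \<open>Both sides solve the same initial value problem, because each \<open>vf (X j)\<close> is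
  a derivation. In coefficients: multiply by \<open>Suc l\<close> and apply the induction hypothesis
  to \<open>vf (X j) f * g\<close> and \<open>f * vf (X j) g\<close>.\<close>

lemma flow_mult: "flow X k (f * g) = (\<Sum>(a, b)\<in>antidiag k. flow X a f * flow X b g)"
proof (induction k arbitrary: f g rule: less_induct)
  case (less k)
  show ?case
  proof (cases k)
    case 0
    then show ?thesis by simp
  next
    case (Suc l)
    have IH: "flow X i (f * g) = (\<Sum>(a, b)\<in>antidiag i. flow X a f * flow X b g)"
      if "i \<le> l" for i f g using less Suc that by simp
    have "cst (of_nat (Suc l)) * flow X (Suc l) (f * g)
       = - (\<Sum>(i, j)\<in>antidiag l. \<Sum>(a, b)\<in>antidiag i. flow X a (vf (X j) f) * flow X b g)
         - (\<Sum>(i, j)\<in>antidiag l. \<Sum>(a, b)\<in>antidiag i. flow X a f * flow X b (vf (X j) g))"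
    proof -
      have "(\<Sum>(i, j)\<in>antidiag l. flow X i (vf (X j) (f * g)))
        = (\<Sum>(i, j)\<in>antidiag l. (\<Sum>(a, b)\<in>antidiag i. flow X a (vf (X j) f) * flow X b g)
            + (\<Sum>(a, b)\<in>antidiag i. flow X a f * flow X b (vf (X j) g)))"
        by (intro sum.cong refl)
           (auto simp: antidiag_def vf_mult cps_linear_add[OF cps_linear_flow] IH)
      then show ?thesis by (simp add: flow_Suc split_def sum.distrib del: of_nat_Suc)
    qed
    \<comment> \<open>Regrouping the triples collects the right-hand side of a flow equation in
      front of one factor, so that \<open>sum_vf_flow\<close> turns it into the derivative of that
      factor.\<close>
    also have "(\<Sum>(i, j)\<in>antidiag l. \<Sum>(a, b)\<in>antidiag i. flow X a (vf (X j) f) * flow X b g)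
      = (\<Sum>(a, b)\<in>antidiag l. (\<Sum>(c, d)\<in>antidiag a. flow X c (vf (X d) f)) * flow X b g)"
    proof -
      have "(\<Sum>(i, j)\<in>antidiag l. \<Sum>(a, b)\<in>antidiag i. flow X a (vf (X j) f) * flow X b g)
        = (\<Sum>(c, e)\<in>antidiag l. \<Sum>(d, b)\<in>antidiag e. flow X c (vf (X b) f) * flow X d g)"
        by (rule sum_antidiag_assoc)
      also have "\<dots> = (\<Sum>(c, e)\<in>antidiag l. \<Sum>(b, d)\<in>antidiag e. flow X c (vf (X b) f) * flow X d g)"
        by (subst (2) sum_antidiag_swap) simp
      also have "\<dots> = (\<Sum>(a, b)\<in>antidiag l. \<Sum>(c, d)\<in>antidiag a. flow X c (vf (X d) f) * flow X b g)"
        by (rule sum_antidiag_assoc[symmetric])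
      finally show ?thesis by (simp add: split_def sum_distrib_right)
    qed
    also have "\<dots> = - (\<Sum>(a, b)\<in>antidiag l. cst (of_nat (Suc a)) * (flow X (Suc a) f * flow X b g))"
      by (simp only: sum_vf_flow) (simp add: split_def sum_negf mult.assoc del: of_nat_Suc)
    also have "(\<Sum>(i, j)\<in>antidiag l. \<Sum>(a, b)\<in>antidiag i. flow X a f * flow X b (vf (X j) g))
      = (\<Sum>(a, b)\<in>antidiag l. flow X a f * (\<Sum>(c, d)\<in>antidiag b. flow X c (vf (X d) g)))"
      by (subst sum_antidiag_assoc) (simp add: split_def sum_distrib_left)
    also have "\<dots> = - (\<Sum>(a, b)\<in>antidiag l. cst (of_nat (Suc b)) * (flow X a f * flow X (Suc b) g))"
      by (simp only: sum_vf_flow)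
         (simp add: split_def sum_negf mult.left_commute[of "cst _"] del: of_nat_Suc)
    finally have "cst (of_nat (Suc l)) * flow X (Suc l) (f * g)
       = cst (of_nat (Suc l)) * (\<Sum>(a, b)\<in>antidiag (Suc l). flow X a f * flow X b g)"
      by (simp only: cst_Suc_mult_sum_antidiag minus_minus diff_minus_eq_add)
    then show ?thesis unfolding Suc
      by (rule cst_mult_cancel[rotated]) (simp del: of_nat_Suc)
  qed
qed

text \<open>The derivative of \<open>\<Phi> \<Psi>\<close> is
  \<open>- \<Phi> D \<Psi> + \<Phi> D \<Psi> = 0\<close>, so all coefficients of positive order
  vanish.\<close>

lemma flow_inv_flow:
  "(\<Sum>(a, b)\<in>antidiag k. flow X a (inv_flow X b h)) = (if k = 0 then h else 0)"
proof (cases k)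
  case (Suc l)
  have "cst (of_nat (Suc l)) * (\<Sum>(a, b)\<in>antidiag (Suc l). flow X a (inv_flow X b h))
     = (\<Sum>(a, b)\<in>antidiag l. - (\<Sum>(c, d)\<in>antidiag a. flow X c (vf (X d) (inv_flow X b h))))
       + (\<Sum>(a, b)\<in>antidiag l. \<Sum>(c, d)\<in>antidiag b. flow X a (vf (X c) (inv_flow X d h)))"
    unfolding cst_Suc_mult_sum_antidiag
  proof (rule arg_cong2[where f = "(+)"])
    show "(\<Sum>(a, b)\<in>antidiag l. cst (of_nat (Suc a)) * flow X (Suc a) (inv_flow X b h))
      = (\<Sum>(a, b)\<in>antidiag l. - (\<Sum>(c, d)\<in>antidiag a. flow X c (vf (X d) (inv_flow X b h))))"
      by (simp only: flow_Suc)
    show "(\<Sum>(a, b)\<in>antidiag l. cst (of_nat (Suc b)) * flow X a (inv_flow X (Suc b) h))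
      = (\<Sum>(a, b)\<in>antidiag l. \<Sum>(c, d)\<in>antidiag b. flow X a (vf (X c) (inv_flow X d h)))"
      by (simp only: cps_linear_cst[OF cps_linear_flow, symmetric] inv_flow_Suc
          cps_linear_sum[OF cps_linear_flow] split_def)
  qed
  also have "(\<Sum>(a, b)\<in>antidiag l. \<Sum>(c, d)\<in>antidiag b. flow X a (vf (X c) (inv_flow X d h)))
    = (\<Sum>(a, b)\<in>antidiag l. \<Sum>(c, d)\<in>antidiag a. flow X c (vf (X d) (inv_flow X b h)))"
    by (rule sum_antidiag_assoc[symmetric])
  also have "(\<Sum>(a, b)\<in>antidiag l. - (\<Sum>(c, d)\<in>antidiag a. flow X c (vf (X d) (inv_flow X b h)))) + \<dots> = 0"
    by (simp add: split_def sum_negf)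
  finally have "cst (of_nat (Suc l)) * (\<Sum>(a, b)\<in>antidiag (Suc l). flow X a (inv_flow X b h))
     = cst (of_nat (Suc l)) * 0" by (simp only: mult_zero_right add.right_inverse)
  then have "(\<Sum>(a, b)\<in>antidiag (Suc l). flow X a (inv_flow X b h)) = 0"
    by (rule cst_mult_cancel[rotated]) (simp del: of_nat_Suc)
  then show ?thesis using Suc by simp
qed simp

text \<open>Here the derivative is the commutator \<open>D \<Psi> \<Phi> - \<Psi> \<Phi> D\<close>,
  which vanishes once \<open>\<Psi> \<Phi>\<close> is known to be the identity in lower orders;
  hence the strong induction.\<close>

lemma inv_flow_flow:
  "(\<Sum>(a, b)\<in>antidiag k. inv_flow X a (flow X b h)) = (if k = 0 then h else 0)"
proof (induction k arbitrary: h rule: less_induct)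
  case (less k)
  show ?case
  proof (cases k)
    case (Suc l)
    have IH: "(\<Sum>(a, b)\<in>antidiag i. inv_flow X a (flow X b h)) = (if i = 0 then h else 0)"
      if "i \<le> l" for i h using less Suc that by simp
    have "cst (of_nat (Suc l)) * (\<Sum>(a, b)\<in>antidiag (Suc l). inv_flow X a (flow X b h))
       = (\<Sum>(a, b)\<in>antidiag l. \<Sum>(c, d)\<in>antidiag a. vf (X c) (inv_flow X d (flow X b h)))
         + (\<Sum>(a, b)\<in>antidiag l. - (\<Sum>(c, d)\<in>antidiag b. inv_flow X a (flow X c (vf (X d) h))))"
      unfolding cst_Suc_mult_sum_antidiag
    proof (rule arg_cong2[where f = "(+)"])
      show "(\<Sum>(a, b)\<in>antidiag l. cst (of_nat (Suc a)) * inv_flow X (Suc a) (flow X b h))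
        = (\<Sum>(a, b)\<in>antidiag l. \<Sum>(c, d)\<in>antidiag a. vf (X c) (inv_flow X d (flow X b h)))"
        by (simp only: inv_flow_Suc)
      show "(\<Sum>(a, b)\<in>antidiag l. cst (of_nat (Suc b)) * inv_flow X a (flow X (Suc b) h))
        = (\<Sum>(a, b)\<in>antidiag l. - (\<Sum>(c, d)\<in>antidiag b. inv_flow X a (flow X c (vf (X d) h))))"
        by (simp only: cps_linear_cst[OF cps_linear_inv_flow, symmetric] flow_Suc
            cps_linear_uminus[OF cps_linear_inv_flow] cps_linear_sum[OF cps_linear_inv_flow] split_def)
    qed
    also have "(\<Sum>(a, b)\<in>antidiag l. \<Sum>(c, d)\<in>antidiag a. vf (X c) (inv_flow X d (flow X b h)))
      = (\<Sum>(c, e)\<in>antidiag l. vf (X c) (\<Sum>(d, b)\<in>antidiag e. inv_flow X d (flow X b h)))"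
      by (subst sum_antidiag_assoc) (simp add: cps_linear_sum[OF cps_linear_vf] split_def)
    \<comment> \<open>By the induction hypothesis only \<open>e = 0\<close> survives. The other
      double sum also reduces to \<open>vf (X l) h\<close>, and the two cancel.\<close>
    also have "\<dots> = (\<Sum>(c, e)\<in>antidiag l. if e = 0 then vf (X l) h else 0)"
    proof (intro sum.cong refl, clarify)
      fix c e assume "(c, e) \<in> antidiag l"
      then have "e \<le> l" "e = 0 \<Longrightarrow> c = l" by (auto simp: antidiag_def)
      then show "vf (X c) (\<Sum>(d, b)\<in>antidiag e. inv_flow X d (flow X b h)) = (if e = 0 then vf (X l) h else 0)"
        by (cases "e = 0") (simp_all add: IH cps_linear_0[OF cps_linear_vf])
    qed
    also have "(\<Sum>(a, b)\<in>antidiag l. - (\<Sum>(c, d)\<in>antidiag b. inv_flow X a (flow X c (vf (X d) h))))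
      = - (\<Sum>(e, d)\<in>antidiag l. \<Sum>(a, c)\<in>antidiag e. inv_flow X a (flow X c (vf (X d) h)))"
      by (subst sum_antidiag_assoc) (simp add: split_def sum_negf)
    also have "(\<Sum>(e, d)\<in>antidiag l. \<Sum>(a, c)\<in>antidiag e. inv_flow X a (flow X c (vf (X d) h)))
      = (\<Sum>(e, d)\<in>antidiag l. if e = 0 then vf (X l) h else 0)"
    proof (intro sum.cong refl, clarify)
      fix e d assume "(e, d) \<in> antidiag l"
      then have "e \<le> l" "e = 0 \<Longrightarrow> d = l" by (auto simp: antidiag_def)
      then show "(\<Sum>(a, c)\<in>antidiag e. inv_flow X a (flow X c (vf (X d) h))) = (if e = 0 then vf (X l) h else 0)"
        by (cases "e = 0") (simp_all add: IH)
    qed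
    also have "(\<Sum>(e, d)\<in>antidiag l. if e = 0 then vf (X l) h else 0)
      = (\<Sum>(c, e)\<in>antidiag l. if e = 0 then vf (X l) h else 0)"
      by (rule sum_antidiag_swap)
    finally have "cst (of_nat (Suc l)) * (\<Sum>(a, b)\<in>antidiag (Suc l). inv_flow X a (flow X b h))
       = cst (of_nat (Suc l)) * 0" by (simp only: mult_zero_right add.right_inverse)
    then have "(\<Sum>(a, b)\<in>antidiag (Suc l). inv_flow X a (flow X b h)) = 0"
      by (rule cst_mult_cancel[rotated]) (simp del: of_nat_Suc)
    then show ?thesis using Suc by simp
  qed simp
qed

text \<open>Continuity for coefficientwise convergent series, used to apply a flow coefficient to a
  sum over powers of \<open>t\<close>. Multiplication and differentiation have it because each
  coefficient of the result is a finite combination of coefficients of the argument.\<close>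

definition cps_continuous :: "('n::finite cps \<Rightarrow> 'm::finite cps) \<Rightarrow> bool" where
  "cps_continuous T \<longleftrightarrow> (\<forall>s v. (\<forall>\<alpha>. (\<lambda>k :: nat. cf (s k) \<alpha>) sums cf v \<alpha>)
      \<longrightarrow> (\<forall>\<alpha>. (\<lambda>k. cf (T (s k)) \<alpha>) sums cf (T v) \<alpha>))"

lemma cps_continuousD:
  "cps_continuous T \<Longrightarrow> (\<And>\<alpha>. (\<lambda>k. cf (s k) \<alpha>) sums cf v \<alpha>) \<Longrightarrow> (\<lambda>k. cf (T (s k)) \<alpha>) sums cf (T v) \<alpha>"
  by (auto simp: cps_continuous_def)

lemma cps_continuous_mult_left: "cps_continuous T \<Longrightarrow> cps_continuous (\<lambda>f. a * T f)"
  unfolding cps_continuous_def cf_mult split_def by (auto intro!: sums_sum sums_mult)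

lemma cps_continuous_setsum:
  "(\<And>x. x \<in> S \<Longrightarrow> cps_continuous (T x)) \<Longrightarrow> cps_continuous (\<lambda>f. \<Sum>x\<in>S. T x f)"
  unfolding cps_continuous_def cf_sum by (auto intro!: sums_sum)

lemma cps_continuous_comp: "cps_continuous T \<Longrightarrow> cps_continuous U \<Longrightarrow> cps_continuous (\<lambda>f. T (U f))"
  by (auto simp: cps_continuous_def[of "\<lambda>f. T (U f)"] intro!: cps_continuousD[of T] cps_continuousD[of U])

lemma cps_continuous_pd: "cps_continuous (pd i)"
  unfolding cps_continuous_def cf_pd by (auto intro!: sums_mult)

lemma cps_continuous_vf: "cps_continuous (vf \<xi>)"
  unfolding vf_def by (intro cps_continuous_setsum cps_continuous_mult_left cps_continuous_pd)

lemma cps_continuous_flow: "cps_continuous (flow X k)"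
proof (induction k rule: less_induct)
  case (less k)
  show ?case
  proof (cases k)
    case 0
    then show ?thesis by (simp add: cps_continuous_def)
  next
    case (Suc l)
    have "cps_continuous (\<lambda>h. (- cst (1 / of_nat (Suc l))) * (\<Sum>i\<le>l. flow X i (vf (X (l - i)) h)))"
      using less Suc
      by (intro cps_continuous_mult_left cps_continuous_setsum cps_continuous_comp[OF _ cps_continuous_vf]) auto
    moreover have "(\<lambda>h. (- cst (1 / of_nat (Suc l))) * (\<Sum>i\<le>l. flow X i (vf (X (l - i)) h))) = flow X k"
      by (rule ext) (simp add: Suc flow.simps(2))
    ultimately show ?thesis by simp
  qed
qed

lemma cps_continuous_inv_flow: "cps_continuous (inv_flow X k)"
proof (induction k rule: less_induct)
  case (less k)
  show ?case
  proof (cases k)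
    case 0
    then show ?thesis by (simp add: cps_continuous_def)
  next
    case (Suc l)
    have "cps_continuous (\<lambda>h. cst (1 / of_nat (Suc l)) * (\<Sum>i\<le>l. vf (X (l - i)) (inv_flow X i h)))"
      using less Suc
      by (intro cps_continuous_mult_left cps_continuous_setsum cps_continuous_comp[OF cps_continuous_vf]) auto
    moreover have "(\<lambda>h. cst (1 / of_nat (Suc l)) * (\<Sum>i\<le>l. vf (X (l - i)) (inv_flow X i h))) = inv_flow X k"
      by (rule ext) (simp add: Suc inv_flow.simps(2))
    ultimately show ?thesis by simp
  qed
qed

section \<open>Majorant estimates for the flow\<close>

lemma hn_vf_le:
  fixes \<xi> :: "'n::finite \<Rightarrow> 'n cps"
  assumes "0 \<le> C" "0 < B" "2 * B \<le> B1" "\<And>i m. hn m (\<xi> i) \<le> C * B ^ m" "\<And>i. cf (\<xi> i) 0 = 0"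
    and "mono_on UNIV w" "\<And>m. 0 \<le> w m" "\<And>m. hn m f \<le> w m * B1 ^ m"
  shows "hn m (vf \<xi> f) \<le> (4 * real CARD('n) * C * B) * (real m * w m) * B1 ^ m"
proof -
  have "hn m (vf \<xi> f) \<le> (\<Sum>i\<in>(UNIV :: 'n set). 4 * C * B * real m * w m * B1 ^ m)"
    unfolding vf_def using assms
    by (intro order_trans[OF hn_sum] sum_mono hn_mult_pd_le) auto
  then show ?thesis by (simp add: mult_ac)
qed

text \<open>\<open>R\<close> bounds the growth of the fields in \<open>k\<close> and serves all
  weights and all rates \<open>B1\<close> at once; it alone determines the lifetime
  \<open>1 / (2 * R)\<close>. The factor \<open>m\<close> is the price of one
  differentiation.\<close>

locale bounded_flow =
  fixes X :: "nat \<Rightarrow> 'n::finite \<Rightarrow> 'n cps" and B R :: real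
  assumes R: "1 \<le> R" and B: "1 \<le> B"
    and vanish: "\<And>k i. cf (X k i) 0 = 0"
    and vf_bound: "\<And>k f w B1 m. 2 * B \<le> B1 \<Longrightarrow> mono_on UNIV w \<Longrightarrow> (\<And>m. 0 \<le> w m) \<Longrightarrow>
      (\<And>m. hn m f \<le> w m * B1 ^ m) \<Longrightarrow> hn m (vf (X k) f) \<le> (R ^ Suc k * real m * w m) * B1 ^ m"
begin

text \<open>The scalar recursion \<open>rising_coeff_rec\<close>, scaled by \<open>R\<close>. In
  \<open>flow\<close> the field acts first, so the induction hypothesis is applied to
  \<open>vf (X (l - i)) h\<close> with the new weight \<open>R ^ Suc (l - i) * real m * w m\<close>;
  hence \<open>h\<close> and \<open>w\<close> vary.\<close>

lemma hn_flow_le: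
  assumes "2 * B \<le> B1" "mono_on UNIV w" "\<And>m. 0 \<le> w m" "\<And>m. hn m h \<le> w m * B1 ^ m"
  shows "hn m (flow X k h) \<le> (R ^ k * rising_coeff m k * w m) * B1 ^ m"
  using assms
proof (induction k arbitrary: h w m rule: less_induct)
  case (less k)
  show ?case
  proof (cases k)
    case 0
    then show ?thesis using less.prems by simp
  next
    case (Suc l)
    have "hn m (flow X i (vf (X (l - i)) h))
        \<le> (R ^ i * rising_coeff m i * (R ^ Suc (l - i) * real m * w m)) * B1 ^ m" if "i \<le> l" for i
    proof (rule less.IH)
      show "mono_on UNIV (\<lambda>m. R ^ Suc (l - i) * real m * w m)"
        using less.prems R by (intro mono_onI mult_mono mono_onD[OF less.prems(2)]) auto
    qed (use that Suc less.prems R vf_bound in auto)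
    then have "hn m (flow X k h)
      \<le> (1 / real (Suc l)) * (\<Sum>i\<le>l. (R ^ i * rising_coeff m i * (R ^ Suc (l - i) * real m * w m)) * B1 ^ m)"
      unfolding Suc flow.simps(2) hn_uminus hn_cst_mult
      by (intro mult_mono order_trans[OF hn_sum] sum_mono)
         (auto simp: norm_divide simp del: of_nat_Suc intro!: divide_left_mono)
    also have "(\<Sum>i\<le>l. (R ^ i * rising_coeff m i * (R ^ Suc (l - i) * real m * w m)) * B1 ^ m)
      = (\<Sum>i\<le>l. R ^ k * w m * B1 ^ m * real m * rising_coeff m i)"
    proof (rule sum.cong[OF refl])
      fix i assume "i \<in> {..l}"
      then have "R ^ k = R ^ i * R ^ Suc (l - i)" using Suc by (simp flip: power_add power_Suc)
      then show "(R ^ i * rising_coeff m i * (R ^ Suc (l - i) * real m * w m)) * B1 ^ m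
        = R ^ k * w m * B1 ^ m * real m * rising_coeff m i"
        by (simp only:) (simp only: mult_ac)
    qed
    also have "\<dots> = R ^ k * w m * B1 ^ m * (real m * (\<Sum>i\<le>l. rising_coeff m i))"
      by (simp add: sum_distrib_left mult_ac)
    also have "\<dots> = R ^ k * w m * B1 ^ m * (real (Suc l) * rising_coeff m (Suc l))"
      by (simp only: rising_coeff_rec)
    finally show ?thesis by (simp add: Suc field_simps del: of_nat_Suc)
  qed
qed

text \<open>Now the field acts last and \<open>w\<close> stays fixed; instead the weight passed to
  \<open>vf_bound\<close> contains \<open>rising_coeff m i\<close>, whose monotonicity in
  \<open>m\<close> is used.\<close>

lemma hn_inv_flow_le:
  assumes "2 * B \<le> B1" "mono_on UNIV w" "\<And>m. 0 \<le> w m" "\<And>m. hn m h \<le> w m * B1 ^ m"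
  shows "hn m (inv_flow X k h) \<le> (R ^ k * rising_coeff m k * w m) * B1 ^ m"
  using assms
proof (induction k arbitrary: m rule: less_induct)
  case (less k)
  show ?case
  proof (cases k)
    case 0
    then show ?thesis using less.prems by simp
  next
    case (Suc l)
    have "hn m (vf (X (l - i)) (inv_flow X i h))
        \<le> (R ^ Suc (l - i) * real m * (R ^ i * rising_coeff m i * w m)) * B1 ^ m" if "i \<le> l" for i
    proof (rule vf_bound)
      show "mono_on UNIV (\<lambda>m. R ^ i * rising_coeff m i * w m)"
        using less.prems R by (intro mono_onI mult_mono mono_onD[OF less.prems(2)] rising_coeff_mono) auto
    qed (use that Suc less R in auto)
    then have "hn m (inv_flow X k h)
      \<le> (1 / real (Suc l)) * (\<Sum>i\<le>l. (R ^ Suc (l - i) * real m * (R ^ i * rising_coeff m i * w m)) * B1 ^ m)"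
      unfolding Suc inv_flow.simps(2) hn_cst_mult
      by (intro mult_mono order_trans[OF hn_sum] sum_mono)
         (auto simp: norm_divide simp del: of_nat_Suc intro!: divide_left_mono)
    also have "(\<Sum>i\<le>l. (R ^ Suc (l - i) * real m * (R ^ i * rising_coeff m i * w m)) * B1 ^ m)
      = (\<Sum>i\<le>l. R ^ k * w m * B1 ^ m * real m * rising_coeff m i)"
    proof (rule sum.cong[OF refl])
      fix i assume "i \<in> {..l}"
      then have "R ^ k = R ^ i * R ^ Suc (l - i)" using Suc by (simp flip: power_add power_Suc)
      then show "(R ^ Suc (l - i) * real m * (R ^ i * rising_coeff m i * w m)) * B1 ^ m
        = R ^ k * w m * B1 ^ m * real m * rising_coeff m i"
        by (simp only:) (simp only: mult_ac)
    qed
    also have "\<dots> = R ^ k * w m * B1 ^ m * (real m * (\<Sum>i\<le>l. rising_coeff m i))"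
      by (simp add: sum_distrib_left mult_ac)
    also have "\<dots> = R ^ k * w m * B1 ^ m * (real (Suc l) * rising_coeff m (Suc l))"
      by (simp only: rising_coeff_rec)
    finally show ?thesis by (simp add: Suc field_simps del: of_nat_Suc)
  qed
qed

lemma ex_bound:
  obtains H B1 where "0 \<le> H" "2 * B \<le> B1" "\<And>m. hn m h \<le> H * B1 ^ m"
proof -
  obtain H B0 where *: "0 \<le> H" "1 \<le> B0" "\<And>m. hn m h \<le> H * B0 ^ m"
    using cf[of h] unfolding CS_iff_hnorm hn_def by blast
  have "hn m h \<le> H * max (2 * B) B0 ^ m" for m
    using * by (intro order_trans[OF *(3)] mult_left_mono power_mono) auto
  then show ?thesis using * by (intro that[of H "max (2 * B) B0"]) auto
qed

lemma double_bound_aux: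
  assumes "0 \<le> H" "2 * B \<le> B1" "hn m f \<le> (R ^ i * rising_coeff m i * (R ^ j * rising_coeff m j * H)) * B1 ^ m"
  shows "hn m f \<le> (2 * R) ^ (i + j) * H * (4 * B1) ^ m"
proof -
  note assms(3)
  also have "(R ^ i * rising_coeff m i * (R ^ j * rising_coeff m j * H)) * B1 ^ m
     = R ^ (i + j) * H * B1 ^ m * (rising_coeff m i * rising_coeff m j)"
    by (simp add: power_add mult_ac)
  also have "\<dots> \<le> R ^ (i + j) * H * B1 ^ m * ((2 ^ m * 2 ^ i) * (2 ^ m * 2 ^ j))"
    using assms R B by (intro mult_left_mono mult_mono rising_coeff_le) auto
  also have "\<dots> = (2 * R) ^ (i + j) * H * (2 * (2 * B1)) ^ m"
    by (simp only: power_add power_mult_distrib mult_ac)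
  finally show ?thesis by simp
qed

text \<open>Composites are estimated jointly because their double series has to converge absolutely
  in \<open>psum_inverse\<close>. Each of the two binomial factors costs \<open>2 ^ m\<close>, hence
  the rate \<open>4 * B1\<close> in the proof. Taking one index zero bounds a single flow.\<close>

lemma flow_inv_flow_bound:
  obtains H B1 where "0 \<le> H" "1 \<le> B1"
    "\<And>m i j. hn m (flow X i (inv_flow X j h)) \<le> (2 * R) ^ (i + j) * H * B1 ^ m"
    "\<And>m i j. hn m (inv_flow X i (flow X j h)) \<le> (2 * R) ^ (i + j) * H * B1 ^ m"
proof -
  obtain H B1 where *: "0 \<le> H" "2 * B \<le> B1" "\<And>m. hn m h \<le> H * B1 ^ m"
    using ex_bound by blast
  have mono: "mono_on UNIV (\<lambda>m. R ^ j * rising_coeff m j * H)" for j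
    using * R by (intro mono_onI mult_mono rising_coeff_mono) auto
  have c: "mono_on UNIV (\<lambda>m :: nat. H)" by (auto intro: mono_onI)
  show ?thesis
  proof (rule that[of H "4 * B1"])
    show "hn m (flow X i (inv_flow X j h)) \<le> (2 * R) ^ (i + j) * H * (4 * B1) ^ m" for m i j
      using * R by (intro double_bound_aux hn_flow_le hn_inv_flow_le mono c) auto
    show "hn m (inv_flow X i (flow X j h)) \<le> (2 * R) ^ (i + j) * H * (4 * B1) ^ m" for m i j
      using * R by (intro double_bound_aux hn_flow_le hn_inv_flow_le mono c) auto
  qed (use * B in auto)
qed

end

subsection \<open>Summation of power series in the time variable\<close>

text \<open>Growth in \<open>k\<close> that is geometric with ratio below one after scaling by
  \<open>t\<close>, and one rate \<open>B\<close> in the degree for all \<open>k\<close>. The first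
  makes the sum converge; the second keeps it in \<open>CS\<close>, so that \<open>Abs_cps\<close>
  in \<open>psum\<close> is meaningful.\<close>

definition psum_ok :: "complex \<Rightarrow> (nat \<Rightarrow> 'n::finite cps) \<Rightarrow> bool" where
  "psum_ok t s \<longleftrightarrow> (\<exists>H B L. 0 \<le> H \<and> 0 \<le> B \<and> 0 \<le> L \<and> norm t * L < 1 \<and> (\<forall>k m. hn m (s k) \<le> L ^ k * H * B ^ m))"

definition psum :: "complex \<Rightarrow> (nat \<Rightarrow> 'n::finite cps) \<Rightarrow> 'n cps" where
  "psum t s = Abs_cps (\<lambda>\<alpha>. \<Sum>k. t ^ k * cf (s k) \<alpha>)"

lemma norm_cf_le_hn: "norm (cf f \<alpha>) \<le> hn (mdeg \<alpha>) f"
  unfolding hn_def by (rule norm_le_hnorm)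

lemma psum_summable:
  assumes "psum_ok t s"
  shows "summable (\<lambda>k. norm (t ^ k * cf (s k) \<alpha>))"
proof -
  obtain H B L where *: "0 \<le> H" "0 \<le> B" "0 \<le> L" "norm t * L < 1" "\<And>k m. hn m (s k) \<le> L ^ k * H * B ^ m"
    using assms unfolding psum_ok_def by blast
  show ?thesis
  proof (rule summable_comparison_test')
    show "summable (\<lambda>k. (H * B ^ mdeg \<alpha>) * (norm t * L) ^ k)"
      using * by (intro summable_mult summable_geometric) auto
    fix k
    have "norm (t ^ k * cf (s k) \<alpha>) \<le> norm t ^ k * (L ^ k * H * B ^ mdeg \<alpha>)"
      using * order_trans[OF norm_cf_le_hn *(5)] by (auto simp: norm_mult norm_power intro!: mult_left_mono)
    then show "norm (norm (t ^ k * cf (s k) \<alpha>)) \<le> (H * B ^ mdeg \<alpha>) * (norm t * L) ^ k"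
      by (simp add: power_mult_distrib mult_ac)
  qed
qed

lemma psum_sums:
  assumes "psum_ok t s"
  shows "(\<lambda>k. t ^ k * cf (s k) \<alpha>) sums cf (psum t s) \<alpha>"
proof -
  obtain H B L where *: "0 \<le> H" "0 \<le> B" "0 \<le> L" "norm t * L < 1" "\<And>k m. hn m (s k) \<le> L ^ k * H * B ^ m"
    using assms unfolding psum_ok_def by blast
  define g where "g = (\<lambda>\<alpha>. \<Sum>k. t ^ k * cf (s k) \<alpha>)"
  \<comment> \<open>Exchanging the finite sum over one degree with the sum over \<open>k\<close>
    bounds the limit by a geometric series.\<close>
  have "hnorm m g \<le> (1 / (1 - norm t * L) * H) * B ^ m" for m
  proof -
    have sm: "summable (\<lambda>k. \<Sum>\<alpha> | mdeg \<alpha> = m. norm (t ^ k * cf (s k) \<alpha>))"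
      using psum_summable[OF assms] by (intro summable_sum) auto
    have "hnorm m g \<le> (\<Sum>\<alpha> | mdeg \<alpha> = m. \<Sum>k. norm (t ^ k * cf (s k) \<alpha>))"
      unfolding hnorm_def g_def by (intro sum_mono summable_norm psum_summable assms)
    also have "\<dots> = (\<Sum>k. \<Sum>\<alpha> | mdeg \<alpha> = m. norm (t ^ k * cf (s k) \<alpha>))"
      using psum_summable[OF assms] by (intro suminf_sum[symmetric]) auto
    also have "\<dots> \<le> (\<Sum>k. (norm t * L) ^ k * (H * B ^ m))"
    proof (intro suminf_le sm)
      show "summable (\<lambda>k. (norm t * L) ^ k * (H * B ^ m))"
        using * by (intro summable_mult2 summable_geometric) auto
      fix k
      have "(\<Sum>\<alpha> | mdeg \<alpha> = m. norm (t ^ k * cf (s k) \<alpha>)) = norm t ^ k * hn m (s k)"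
        by (simp add: hn_def hnorm_def norm_mult norm_power sum_distrib_left)
      also have "\<dots> \<le> norm t ^ k * (L ^ k * H * B ^ m)" using * by (intro mult_left_mono) auto
      finally show "(\<Sum>\<alpha> | mdeg \<alpha> = m. norm (t ^ k * cf (s k) \<alpha>)) \<le> (norm t * L) ^ k * (H * B ^ m)"
        by (simp add: power_mult_distrib mult_ac)
    qed
    also have "\<dots> = (\<Sum>k. (norm t * L) ^ k) * (H * B ^ m)"
      using * by (intro suminf_mult2[symmetric] summable_geometric) auto
    also have "(\<Sum>k. (norm t * L) ^ k) = 1 / (1 - norm t * L)"
      using * by (intro suminf_geometric) auto
    finally show ?thesis by (simp add: mult_ac)
  qed
  then have "g \<in> CS" using * by (intro CS_I)
  then have "cf (psum t s) = g" unfolding psum_def g_def by (rule Abs_cps_inverse)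
  then show ?thesis
    using summable_sums[OF summable_norm_cancel[OF psum_summable[OF assms]], of \<alpha>] by (simp add: g_def)
qed

text \<open>A product of two geometric series dominates, so the double series is absolutely summable
  and may be summed by rows or by antidiagonals.\<close>

lemma double_series_sums_diagonal:
  fixes a :: "nat \<Rightarrow> nat \<Rightarrow> complex"
  assumes "\<And>i j. norm (a i j) \<le> M * x ^ i * x ^ j" "0 \<le> x" "x < 1"
    and "\<And>i. (\<lambda>j. a i j) sums b i" "b sums c"
  shows "(\<lambda>k. \<Sum>(i, j)\<in>antidiag k. a i j) sums c"
proof -
  have M: "0 \<le> M" using order_trans[OF norm_ge_zero assms(1)[of 0 0]] by simp
  have geo: "((\<lambda>i. x ^ i) has_sum (\<Sum>\<^sub>\<infinity>i. x ^ i)) UNIV"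
    using assms by (intro has_sum_infsum, subst summable_on_UNIV_nonneg_real_iff) (auto intro: summable_geometric)
  have "(\<lambda>p. M * x ^ fst p * x ^ snd p) summable_on (UNIV \<times> UNIV)"
  proof (rule summable_on_SigmaI)
    show "((\<lambda>j. M * x ^ fst (i, j) * x ^ snd (i, j)) has_sum M * x ^ i * (\<Sum>\<^sub>\<infinity>i. x ^ i)) UNIV" for i
      using has_sum_cmult_right[OF geo, of "M * x ^ i"] by simp
    show "(\<lambda>i. M * x ^ i * (\<Sum>\<^sub>\<infinity>i. x ^ i)) summable_on UNIV"
      using geo by (intro summable_on_cmult_left summable_on_cmult_right) (auto simp: summable_on_def)
  qed (use M assms in auto)
  then have "(\<lambda>p. norm (case p of (i, j) \<Rightarrow> a i j)) summable_on (UNIV \<times> UNIV)"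
    by (rule summable_on_comparison_test) (use assms(1) in auto)
  then have S: "(\<lambda>p. case p of (i, j) \<Rightarrow> a i j) summable_on (UNIV \<times> UNIV)"
    by (rule abs_summable_summable)
  then obtain d where d: "((\<lambda>(i, j). a i j) has_sum d) (UNIV \<times> UNIV)"
    by (auto simp: summable_on_def)
  have row: "((\<lambda>j. a i j) has_sum b i) UNIV" for i
  proof -
    have "(\<lambda>j. a i j) summable_on UNIV"
      using summable_on_SigmaD1[of a UNIV "\<lambda>_. UNIV" i] S by simp
    then show ?thesis
      using assms(4)[of i] by (metis has_sum_imp_sums has_sum_infsum sums_unique2)
  qed
  have "(b has_sum d) UNIV"
    by (rule has_sum_SigmaD[OF d]) (simp add: row)
  then have dc: "d = c" using assms(5) has_sum_imp_sums sums_unique2 by blast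
  have "((\<lambda>(i, j). a i j) has_sum d) (UNIV \<times> UNIV)
     = ((\<lambda>(k, i, j). a i j) has_sum d) (SIGMA k:UNIV. antidiag k)"
    by (rule has_sum_reindex_bij_witness[of _ "\<lambda>(k, i, j). (i, j)" "\<lambda>(i, j). (i + j, i, j)"])
       (auto simp: antidiag_def)
  with d have "((\<lambda>(k, i, j). a i j) has_sum d) (SIGMA k:UNIV. antidiag k)" by simp
  then have "((\<lambda>k. \<Sum>(i, j)\<in>antidiag k. a i j) has_sum d) UNIV"
    by (rule has_sum_SigmaD) (auto intro!: has_sum_finiteI)
  then show ?thesis using dc has_sum_imp_sums by blast
qed

text \<open>Continuity expands \<open>T i\<close> on the inner sum, and the resulting double series
  is summed along antidiagonals, where the last hypothesis leaves only \<open>h\<close>.\<close>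

lemma psum_inverse:
  assumes "\<And>i. cps_linear (T i)" "\<And>i. cps_continuous (T i)"
    and "psum_ok t (\<lambda>j. U j h)" "psum_ok t (\<lambda>i. T i (psum t (\<lambda>j. U j h)))"
    and "\<And>m i j. hn m (T i (U j h)) \<le> L ^ (i + j) * H * B ^ m" "0 \<le> H" "0 \<le> L" "0 \<le> B" "norm t * L < 1"
    and "\<And>k. (\<Sum>(i, j)\<in>antidiag k. T i (U j h)) = (if k = 0 then h else 0)"
  shows "psum t (\<lambda>i. T i (psum t (\<lambda>j. U j h))) = h"
proof (rule cps_eqI)
  fix \<alpha>
  define v where "v = psum t (\<lambda>j. U j h)"
  \<comment> \<open>The power \<open>t ^ j\<close> sits inside \<open>T i\<close>, so that
    continuity applies to the series defining \<open>v\<close>.\<close>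
  define a where "a = (\<lambda>i j. t ^ i * cf (T i (cst (t ^ j) * U j h)) \<alpha>)"
  have a_eq: "a i j = t ^ (i + j) * cf (T i (U j h)) \<alpha>" for i j
    by (simp add: a_def cps_linear_cst[OF assms(1)] power_add mult.assoc)
  have "(\<lambda>k. \<Sum>(i, j)\<in>antidiag k. a i j) sums cf (psum t (\<lambda>i. T i v)) \<alpha>"
  proof (rule double_series_sums_diagonal)
    show "norm (a i j) \<le> (H * B ^ mdeg \<alpha>) * (norm t * L) ^ i * (norm t * L) ^ j" for i j
    proof -
      have "norm (a i j) \<le> norm t ^ (i + j) * (L ^ (i + j) * H * B ^ mdeg \<alpha>)"
        unfolding a_eq norm_mult norm_power
        by (intro mult_left_mono order_trans[OF norm_cf_le_hn assms(5)]) auto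
      then show ?thesis by (simp add: power_mult_distrib power_add mult_ac)
    qed
    show "(\<lambda>j. a i j) sums (t ^ i * cf (T i v) \<alpha>)" for i
      unfolding a_def
    proof (rule sums_mult, rule cps_continuousD[OF assms(2)])
      show "(\<lambda>j. cf (cst (t ^ j) * U j h) \<beta>) sums cf v \<beta>" for \<beta>
        using psum_sums[OF assms(3)] by (simp add: v_def)
    qed
    show "(\<lambda>i. t ^ i * cf (T i v) \<alpha>) sums cf (psum t (\<lambda>i. T i v)) \<alpha>"
      using assms(4) by (intro psum_sums) (simp add: v_def)
  qed (use assms in auto)
  moreover have "(\<Sum>(i, j)\<in>antidiag k. a i j) = (if k = 0 then cf h \<alpha> else 0)" for k
  proof -
    have "(\<Sum>(i, j)\<in>antidiag k. a i j) = (\<Sum>(i, j)\<in>antidiag k. t ^ k * cf (T i (U j h)) \<alpha>)"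
      by (intro sum.cong refl) (auto simp: antidiag_def a_eq)
    also have "\<dots> = t ^ k * cf (\<Sum>(i, j)\<in>antidiag k. T i (U j h)) \<alpha>"
      by (simp add: sum_distrib_left split_def)
    finally show ?thesis unfolding assms(10) by simp
  qed
  ultimately have "(\<lambda>k. if k = 0 then cf h \<alpha> else 0) sums cf (psum t (\<lambda>i. T i v)) \<alpha>" by simp
  then show "cf (psum t (\<lambda>i. T i (psum t (\<lambda>j. U j h)))) \<alpha> = cf h \<alpha>"
    using sums_single[of 0 "\<lambda>_. cf h \<alpha>"] sums_unique2 unfolding v_def by blast
qed

definition cps_aut :: "('n::finite cps \<Rightarrow> 'n cps) \<Rightarrow> bool" where
  "cps_aut \<Phi> \<longleftrightarrow> bij \<Phi> \<and> (\<forall>f g. \<Phi> (f + g) = \<Phi> f + \<Phi> g) \<and> (\<forall>f g. \<Phi> (f * g) = \<Phi> f * \<Phi> g) \<and>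
     (\<forall>c f. \<Phi> (cst c * f) = cst c * \<Phi> f)"

lemma cps_aut_bij: "cps_aut \<Phi> \<Longrightarrow> bij \<Phi>"
  and cps_aut_add: "cps_aut \<Phi> \<Longrightarrow> \<Phi> (f + g) = \<Phi> f + \<Phi> g"
  and cps_aut_mult: "cps_aut \<Phi> \<Longrightarrow> \<Phi> (f * g) = \<Phi> f * \<Phi> g"
  and cps_aut_cst_mult: "cps_aut \<Phi> \<Longrightarrow> \<Phi> (cst c * f) = cst c * \<Phi> f"
  by (auto simp: cps_aut_def)

section \<open>The automorphism given by the flow at a small time\<close>

context bounded_flow
begin

context
  fixes t :: complex
  assumes t: "norm t * (2 * R) < 1"
begin

lemma flow_ok: "psum_ok t (\<lambda>k. flow X k h)"
proof -
  obtain H B1 where *: "0 \<le> H" "1 \<le> B1"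
    "\<And>m i j. hn m (flow X i (inv_flow X j h)) \<le> (2 * R) ^ (i + j) * H * B1 ^ m"
    "\<And>m i j. hn m (inv_flow X i (flow X j h)) \<le> (2 * R) ^ (i + j) * H * B1 ^ m"
    by (rule flow_inv_flow_bound[where h = h]) (rule that)
  show ?thesis
    unfolding psum_ok_def
  proof (rule exI[of _ H], rule exI[of _ B1], rule exI[of _ "2 * R"], intro conjI allI)
    show "hn m (flow X k h) \<le> (2 * R) ^ k * H * B1 ^ m" for k m
      using *(3)[of m k 0] by simp
  qed (use *(1,2) t R in auto)
qed

lemma inv_flow_ok: "psum_ok t (\<lambda>k. inv_flow X k h)"
proof -
  obtain H B1 where *: "0 \<le> H" "1 \<le> B1"
    "\<And>m i j. hn m (flow X i (inv_flow X j h)) \<le> (2 * R) ^ (i + j) * H * B1 ^ m"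
    "\<And>m i j. hn m (inv_flow X i (flow X j h)) \<le> (2 * R) ^ (i + j) * H * B1 ^ m"
    by (rule flow_inv_flow_bound[where h = h]) (rule that)
  show ?thesis
    unfolding psum_ok_def
  proof (rule exI[of _ H], rule exI[of _ B1], rule exI[of _ "2 * R"], intro conjI allI)
    show "hn m (inv_flow X k h) \<le> (2 * R) ^ k * H * B1 ^ m" for k m
      using *(4)[of m k 0] by simp
  qed (use *(1,2) t R in auto)
qed

lemma flow_inverse:
  "psum t (\<lambda>i. flow X i (psum t (\<lambda>j. inv_flow X j h))) = h"
  "psum t (\<lambda>i. inv_flow X i (psum t (\<lambda>j. flow X j h))) = h"
proof -
  obtain H B1 where *: "0 \<le> H" "1 \<le> B1"
    "\<And>m i j. hn m (flow X i (inv_flow X j h)) \<le> (2 * R) ^ (i + j) * H * B1 ^ m"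
    "\<And>m i j. hn m (inv_flow X i (flow X j h)) \<le> (2 * R) ^ (i + j) * H * B1 ^ m"
    by (rule flow_inv_flow_bound[where h = h]) (rule that)
  show "psum t (\<lambda>i. flow X i (psum t (\<lambda>j. inv_flow X j h))) = h"
  proof (rule psum_inverse[where L = "2 * R" and H = H and B = B1])
    show "hn m (flow X i (inv_flow X j h)) \<le> (2 * R) ^ (i + j) * H * B1 ^ m" for m i j
      by (rule *(3))
    show "(\<Sum>(i, j)\<in>antidiag k. flow X i (inv_flow X j h)) = (if k = 0 then h else 0)" for k
      by (rule flow_inv_flow)
  qed (use *(1,2) R t in \<open>simp_all add: cps_linear_flow cps_continuous_flow flow_ok inv_flow_ok\<close>)
  show "psum t (\<lambda>i. inv_flow X i (psum t (\<lambda>j. flow X j h))) = h"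
  proof (rule psum_inverse[where L = "2 * R" and H = H and B = B1])
    show "hn m (inv_flow X i (flow X j h)) \<le> (2 * R) ^ (i + j) * H * B1 ^ m" for m i j
      by (rule *(4))
    show "(\<Sum>(i, j)\<in>antidiag k. inv_flow X i (flow X j h)) = (if k = 0 then h else 0)" for k
      by (rule inv_flow_flow)
  qed (use *(1,2) R t in \<open>simp_all add: cps_linear_inv_flow cps_continuous_inv_flow flow_ok inv_flow_ok\<close>)
qed

text \<open>The summed inverse flow provides the inverse. Multiplicativity is the Cauchy product of
  absolutely convergent series in \<open>t\<close>, regrouped by \<open>flow_mult\<close>.\<close>

lemma cps_aut_flow: "cps_aut (\<lambda>h. psum t (\<lambda>k. flow X k h))"
  unfolding cps_aut_def
proof (intro conjI allI)
  let ?\<Phi> = "\<lambda>h. psum t (\<lambda>k. flow X k h)"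
  show "bij ?\<Phi>"
    by (rule o_bij[of "\<lambda>h. psum t (\<lambda>k. inv_flow X k h)"]) (simp_all add: fun_eq_iff flow_inverse)
  show "?\<Phi> (f + g) = ?\<Phi> f + ?\<Phi> g" for f g
  proof (rule cps_eqI)
    fix \<alpha>
    have "(\<lambda>k. t ^ k * cf (flow X k (f + g)) \<alpha>) sums (cf (?\<Phi> f) \<alpha> + cf (?\<Phi> g) \<alpha>)"
      using sums_add[OF psum_sums[OF flow_ok[of f], of \<alpha>] psum_sums[OF flow_ok[of g], of \<alpha>]]
      by (simp add: cps_linear_add[OF cps_linear_flow] distrib_left)
    then show "cf (?\<Phi> (f + g)) \<alpha> = cf (?\<Phi> f + ?\<Phi> g) \<alpha>"
      using sums_unique2[OF psum_sums[OF flow_ok]] by simp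
  qed
  show "?\<Phi> (cst c * f) = cst c * ?\<Phi> f" for c f
  proof (rule cps_eqI)
    fix \<alpha>
    have "(\<lambda>k. t ^ k * cf (flow X k (cst c * f)) \<alpha>) sums (c * cf (?\<Phi> f) \<alpha>)"
      using sums_mult[OF psum_sums[OF flow_ok[of f], of \<alpha>], of c]
      by (simp add: cps_linear_cst[OF cps_linear_flow] mult.left_commute)
    then show "cf (?\<Phi> (cst c * f)) \<alpha> = cf (cst c * ?\<Phi> f) \<alpha>"
      using sums_unique2[OF psum_sums[OF flow_ok]] by simp
  qed
  show "?\<Phi> (f * g) = ?\<Phi> f * ?\<Phi> g" for f g
  proof (rule cps_eqI)
    fix \<alpha>
    have prod: "(\<lambda>k. \<Sum>(i, j)\<in>antidiag k. (t ^ i * cf (flow X i f) \<beta>) * (t ^ j * cf (flow X j g) \<gamma>))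
        sums (cf (?\<Phi> f) \<beta> * cf (?\<Phi> g) \<gamma>)" for \<beta> \<gamma>
      unfolding sum_antidiag
      using Cauchy_product_sums[OF psum_summable[OF flow_ok[of f], of \<beta>] psum_summable[OF flow_ok[of g], of \<gamma>]]
      by (simp add: sums_unique[OF psum_sums[OF flow_ok], symmetric])
    have "(\<lambda>k. \<Sum>(\<beta>, \<gamma>)\<in>splits \<alpha>. \<Sum>(i, j)\<in>antidiag k. (t ^ i * cf (flow X i f) \<beta>) * (t ^ j * cf (flow X j g) \<gamma>))
        sums (\<Sum>(\<beta>, \<gamma>)\<in>splits \<alpha>. cf (?\<Phi> f) \<beta> * cf (?\<Phi> g) \<gamma>)"
      unfolding split_def[where 'a = "'n \<Rightarrow> nat"] by (intro sums_sum prod)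
    moreover have "(\<Sum>(\<beta>, \<gamma>)\<in>splits \<alpha>. \<Sum>(i, j)\<in>antidiag k. (t ^ i * cf (flow X i f) \<beta>) * (t ^ j * cf (flow X j g) \<gamma>))
        = t ^ k * cf (flow X k (f * g)) \<alpha>" for k
    proof -
      have "(\<Sum>(\<beta>, \<gamma>)\<in>splits \<alpha>. \<Sum>(i, j)\<in>antidiag k. (t ^ i * cf (flow X i f) \<beta>) * (t ^ j * cf (flow X j g) \<gamma>))
        = (\<Sum>x\<in>splits \<alpha>. \<Sum>y\<in>antidiag k. t ^ k * (cf (flow X (fst y) f) (fst x) * cf (flow X (snd y) g) (snd x)))"
        by (intro sum.cong refl) (auto simp: antidiag_def power_add split_def intro!: sum.cong)
      also have "\<dots> = (\<Sum>y\<in>antidiag k. \<Sum>x\<in>splits \<alpha>. t ^ k * (cf (flow X (fst y) f) (fst x) * cf (flow X (snd y) g) (snd x)))"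
        by (rule sum.swap)
      also have "\<dots> = t ^ k * cf (flow X k (f * g)) \<alpha>"
        by (simp add: flow_mult cf_mult split_def sum_distrib_left)
      finally show ?thesis .
    qed
    ultimately have "(\<lambda>k. t ^ k * cf (flow X k (f * g)) \<alpha>) sums cf (?\<Phi> f * ?\<Phi> g) \<alpha>"
      by (simp add: cf_mult)
    then show "cf (?\<Phi> (f * g)) \<alpha> = cf (?\<Phi> f * ?\<Phi> g) \<alpha>"
      using sums_unique2[OF psum_sums[OF flow_ok]] by blast
  qed
qed

text \<open>The hypotheses are the coefficients of \<open>D (f + t h) = h\<close>. Hence the
  derivative of \<open>\<Phi> (f + t h)\<close> is
  \<open>- \<Phi> (D (f + t h)) + \<Phi> h = 0\<close>.\<close>

lemma flow_trivializes:
  assumes "vf (X 0) f = h" "\<And>k. vf (X (Suc k)) f = - vf (X k) h"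
  shows "psum t (\<lambda>k. flow X k (f + cst t * h)) = f"
proof -
  \<comment> \<open>That is, the coefficient of \<open>t ^ Suc k\<close> in
    \<open>\<Phi> (f + t h)\<close> vanishes.\<close>
  have step: "flow X (Suc k) f = - flow X k h" for k
  proof (cases k)
    case 0
    then show ?thesis using assms(1) by (simp add: flow.simps(2))
  next
    case (Suc l)
    have "cst (of_nat (Suc k)) * flow X (Suc k) f = - (\<Sum>(i, j)\<in>antidiag (Suc l). flow X i (vf (X j) f))"
      by (simp only: flow_Suc Suc)
    also have "(\<Sum>(i, j)\<in>antidiag (Suc l). flow X i (vf (X j) f))
       = (\<Sum>(j, i)\<in>antidiag (Suc l). flow X i (vf (X j) f))"
      by (rule sum_antidiag_swap)
    also have "\<dots> = flow X (Suc l) h + (\<Sum>(j, i)\<in>antidiag l. flow X i (vf (X (Suc j)) f))"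
      unfolding sum_antidiag by (subst sum.atMost_Suc_shift) (simp add: assms(1))
    also have "(\<Sum>(j, i)\<in>antidiag l. flow X i (vf (X (Suc j)) f)) = - (\<Sum>(j, i)\<in>antidiag l. flow X i (vf (X j) h))"
      by (simp add: assms(2) cps_linear_uminus[OF cps_linear_flow] split_def sum_negf)
    also have "(\<Sum>(j, i)\<in>antidiag l. flow X i (vf (X j) h)) = - (cst (of_nat (Suc l)) * flow X (Suc l) h)"
      by (subst sum_antidiag_swap) (rule sum_vf_flow)
    also have "- (flow X (Suc l) h + - (- (cst (of_nat (Suc l)) * flow X (Suc l) h)))
      = cst (of_nat (Suc k)) * (- flow X k h)"
      by (rule cps_eqI) (simp only: cf_add cf_uminus cf_cst_mult Suc, simp add: algebra_simps)
    finally show ?thesis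
      by (rule cst_mult_cancel[rotated]) (simp del: of_nat_Suc)
  qed
  have cf_f: "cf (psum t (\<lambda>k. flow X k f)) \<alpha> = cf f \<alpha> - t * cf (psum t (\<lambda>k. flow X k h)) \<alpha>" for \<alpha>
  proof -
    have "(\<lambda>k. t ^ Suc k * cf (flow X (Suc k) f) \<alpha>) sums (- t * cf (psum t (\<lambda>k. flow X k h)) \<alpha>)"
      using sums_mult[OF psum_sums[OF flow_ok[of h], of \<alpha>], of "- t"] by (simp add: step mult.assoc)
    then have "(\<lambda>k. t ^ k * cf (flow X k f) \<alpha>) sums (- t * cf (psum t (\<lambda>k. flow X k h)) \<alpha> + t ^ 0 * cf (flow X 0 f) \<alpha>)"
      by (subst sums_Suc_iff[symmetric]) simp
    then show ?thesis using sums_unique2[OF psum_sums[OF flow_ok[of f], of \<alpha>]] by force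
  qed
  have "psum t (\<lambda>k. flow X k (f + cst t * h))
      = psum t (\<lambda>k. flow X k f) + cst t * psum t (\<lambda>k. flow X k h)"
    by (simp only: cps_aut_add[OF cps_aut_flow] cps_aut_cst_mult[OF cps_aut_flow])
  then show ?thesis by (intro cps_eqI) (simp add: cf_f)
qed

end

end

text \<open>The vector field \<open>\<xi>\<^sub>t = a (1 + t M)\<inverse>\<close> satisfies \<open>\<xi>\<^sub>t (f + t h) = h\<close>, so its flow trivializes the
  family \<open>f + t h\<close>.\<close>

fun homotopy_field ::
  "('n::finite \<Rightarrow> 'n cps) \<Rightarrow> ('n \<Rightarrow> 'n \<Rightarrow> 'n cps) \<Rightarrow> nat \<Rightarrow> 'n \<Rightarrow> 'n cps" where
  "homotopy_field a M 0 j = a j"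
| "homotopy_field a M (Suc k) j = - (\<Sum>i\<in>UNIV. M i j * homotopy_field a M k i)"

text \<open>Each further term of the geometric series in \<open>M\<close> costs a constant factor
  while the rate stays \<open>B\<close>, and the vanishing of \<open>a\<close> at the origin is
  inherited. So \<open>homotopy_field\<close> is a \<open>bounded_flow\<close>.\<close>

theorem local_triviality:
  fixes f h :: "'n::finite cps"
  assumes h: "h = (\<Sum>i\<in>UNIV. a i * pd i f)" and a0: "\<And>i. cf (a i) 0 = 0"
    and M: "\<And>i. pd i h = (\<Sum>j\<in>UNIV. M i j * pd j f)"
  obtains \<epsilon> where "0 < \<epsilon>" "\<And>t. norm t < \<epsilon> \<Longrightarrow> \<exists>\<Phi>. cps_aut \<Phi> \<and> \<Phi> (f + cst t * h) = f"
proof -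
  let ?N = "real CARD('n)"
  let ?X = "homotopy_field a M"
  obtain H1 B1 where 1: "0 \<le> H1" "1 \<le> B1" "\<And>i m. hn m (a i) \<le> H1 * B1 ^ m"
    by (rule cps_finite_bound[of UNIV a]) auto
  obtain H2 B2 where 2: "0 \<le> H2" "1 \<le> B2" "\<And>p m. hn m (M (fst p) (snd p)) \<le> H2 * B2 ^ m"
    by (rule cps_finite_bound[of UNIV "\<lambda>p. M (fst p) (snd p)"]) auto
  have 3: "hn m (M i j) \<le> H2 * B2 ^ m" for i j m
    using 2(3)[where p = "(i, j)"] by simp
  \<comment> \<open>At least \<open>2 * B2\<close>, so that \<open>hn_mult_le\<close> multiplies by
    \<open>M\<close> without changing the rate \<open>B\<close>.\<close>
  define B where "B = 2 * max B1 B2"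
  have B: "1 \<le> B" "B1 \<le> B" "2 * B2 \<le> B" using 1 2 by (auto simp: B_def)
  \<comment> \<open>Each step has \<open>?N\<close> products, each with the factor
    \<open>2 * H2\<close> from \<open>hn_mult_le\<close>. The last entry of \<open>R\<close> below
    is the constant of \<open>hn_vf_le\<close>.\<close>
  define L where "L = ?N * (2 * H2)"
  define R where "R = max 1 (max L (4 * ?N * H1 * B))"
  have L: "0 \<le> L" "L \<le> R" and R: "1 \<le> R" "4 * ?N * H1 * B \<le> R" using 2 by (auto simp: L_def R_def)
  have X: "hn m (?X k i) \<le> (H1 * L ^ k) * B ^ m" for k i m
  proof (induction k arbitrary: i m)
    case 0
    have "H1 * B1 ^ m \<le> H1 * B ^ m" using 1(1,2) B by (intro mult_left_mono power_mono) auto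
    then show ?case using order_trans[OF 1(3)] by simp
  next
    case (Suc k)
    have "hn m (?X (Suc k) i) \<le> (\<Sum>j\<in>(UNIV :: 'n set). 2 * H2 * (H1 * L ^ k) * B ^ m)"
      unfolding homotopy_field.simps hn_uminus
    proof (intro order_trans[OF hn_sum] sum_mono)
      fix j
      show "hn m (M j i * ?X k j) \<le> 2 * H2 * (H1 * L ^ k) * B ^ m"
        by (rule hn_mult_le[where B = B2]) (use 1(1) 2(1,2) 3 B L(1) Suc in \<open>auto intro: mono_onI\<close>)
    qed
    then show ?case by (simp add: L_def mult_ac)
  qed
  have X0: "cf (?X k i) 0 = 0" for k i
    by (induction k arbitrary: i) (auto simp: a0)
  interpret bounded_flow ?X B R
  proof
    fix k and f :: "'n cps" and w B' m
    assume *: "2 * B \<le> B'" "mono_on UNIV w" "\<And>m :: nat. 0 \<le> w m" "\<And>m. hn m f \<le> w m * B' ^ m"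
    have "hn m (vf (?X k) f) \<le> (4 * ?N * (H1 * L ^ k) * B) * (real m * w m) * B' ^ m"
    proof (rule hn_vf_le)
      show "hn m (?X k i) \<le> (H1 * L ^ k) * B ^ m" for i m by (rule X)
      show "hn m f \<le> w m * B' ^ m" for m by (rule *(4))
    qed (use *(1-3) X0 B(1) 1(1) L(1) in auto)
    also have "4 * ?N * (H1 * L ^ k) * B = (4 * ?N * H1 * B) * L ^ k" by simp
    also have "(4 * ?N * H1 * B) * L ^ k * (real m * w m) * B' ^ m \<le> (R * R ^ k) * (real m * w m) * B' ^ m"
      using *(1,3) B R L 1(1) by (intro mult_right_mono mult_mono power_mono) auto
    finally show "hn m (vf (?X k) f) \<le> (R ^ Suc k * real m * w m) * B' ^ m" by (simp add: mult_ac)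
  qed (use R B X0 in auto)
  have vf0: "vf (?X 0) f = h" by (simp add: vf_def h)
  have vfS: "vf (?X (Suc k)) f = - vf (?X k) h" for k
  proof -
    have "vf (?X (Suc k)) f = - (\<Sum>j\<in>UNIV. \<Sum>i\<in>UNIV. ?X k i * (M i j * pd j f))"
      by (simp add: vf_def sum_negf sum_distrib_right sum_distrib_left mult_ac)
    also have "\<dots> = - vf (?X k) h"
      by (subst sum.swap) (simp add: vf_def M sum_distrib_left)
    finally show ?thesis .
  qed
  show ?thesis
  proof (rule that[of "1 / (2 * R)"])
    show "0 < 1 / (2 * R)" using R by simp
    fix t :: complex assume "norm t < 1 / (2 * R)"
    then have t: "norm t * (2 * R) < 1" using R by (simp add: field_simps)
    show "\<exists>\<Phi>. cps_aut \<Phi> \<and> \<Phi> (f + cst t * h) = f"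
      using cps_aut_flow[OF t] flow_trivializes[OF t vf0 vfS] by blast
  qed
qed

subsection \<open>The exchange property of the minimal generators\<close>

text \<open>In the application \<open>\<beta> + unit_mi (\<iota> \<beta>)\<close> is a monomial of
  \<open>f\<close>. Lowering it at an index of its support gives a monomial of a partial derivative,
  hence one in the ideal; \<open>exchange\<close> records a generator below it.\<close>

locale exchange_system =
  fixes G :: "('n::finite \<Rightarrow> nat) set" and \<iota> :: "('n \<Rightarrow> nat) \<Rightarrow> 'n"
  assumes finite_G: "finite G"
    and antichain: "\<And>\<beta> \<gamma>. \<beta> \<in> G \<Longrightarrow> \<gamma> \<in> G \<Longrightarrow> \<gamma> \<le> \<beta> \<Longrightarrow> \<gamma> = \<beta>"
    and inj: "inj_on \<iota> G"
    and exchange: "\<And>\<beta> j. \<beta> \<in> G \<Longrightarrow> \<beta> j \<noteq> 0 \<Longrightarrow> j \<noteq> \<iota> \<beta> \<Longrightarrow>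
      \<exists>\<gamma>\<in>G. \<gamma> \<le> \<beta> + unit_mi (\<iota> \<beta>) - unit_mi j"
begin

text \<open>With \<open>q = \<beta> - e\<^sub>j\<close>, every \<open>\<gamma> \<in> G\<close> below some \<open>q + e\<^sub>k\<close> determines this \<open>k =: \<kappa> \<gamma>\<close>. Exchanging
  \<open>e\<^sub>\<kappa>\<close> for \<open>e\<^sub>\<iota>\<close> yields an injective, hence bijective, self-map of the finite set of all such \<open>\<gamma>\<close>
  which does not increase degrees; so it preserves them, and the exchange inequality is an equality.\<close>

lemma exchange_bijection:
  assumes \<beta>: "\<beta> \<in> G" and j: "\<beta> j \<noteq> 0"
  shows "\<beta> + unit_mi (\<iota> \<beta>) - unit_mi j \<in> G"
    and "\<exists>k. \<beta> - unit_mi j + unit_mi k \<in> G \<and> \<iota> (\<beta> - unit_mi j + unit_mi k) = j"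
proof -
  define q where "q = \<beta> - unit_mi j"
  have q: "q + unit_mi j = \<beta>" unfolding q_def using j by simp
  have deg\<beta>: "mdeg \<beta> = mdeg q + 1" using arg_cong[OF q, of mdeg] by simp
  have q_le: "q \<le> \<beta>" using mi_le_add(2)[of q "unit_mi j"] unfolding q .
  have not_le: "\<not> \<gamma> \<le> q" if "\<gamma> \<in> G" for \<gamma>
  proof
    assume le: "\<gamma> \<le> q"
    have "\<gamma> = \<beta>" by (rule antichain[OF \<beta> that order_trans[OF le q_le]])
    then show False using mdeg_mono[OF le] deg\<beta> by simp
  qed
  \<comment> \<open>As \<open>\<gamma>\<close> is not below \<open>q\<close>, it exceeds
    \<open>q\<close> exactly at \<open>k\<close>; this makes \<open>k\<close> unique.\<close>
  have apply_q: "\<gamma> k = q k + 1" if "\<gamma> \<in> G" "\<gamma> \<le> q + unit_mi k" for \<gamma> k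
  proof (rule ccontr)
    assume "\<gamma> k \<noteq> q k + 1"
    moreover have le: "\<gamma> x \<le> q x + unit_mi k x" for x using that(2) by (simp add: mi_le_iff)
    ultimately have "\<gamma> x \<le> q x" for x
      using le[of x] le[of k] by (cases "x = k") (simp_all add: unit_mi_apply)
    then show False using not_le[OF that(1)] by (simp add: mi_le_iff)
  qed
  have unique: "k = l" if "\<gamma> \<in> G" "\<gamma> \<le> q + unit_mi k" "\<gamma> \<le> q + unit_mi l" for \<gamma> k l
  proof (rule ccontr)
    assume "k \<noteq> l"
    moreover have "\<gamma> k \<le> q k + unit_mi l k" using that(3) by (simp add: mi_le_iff)
    ultimately show False using apply_q[OF that(1,2)] by (simp add: unit_mi_apply)
  qed
  define S where "S = {\<gamma> \<in> G. \<exists>k. \<gamma> \<le> q + unit_mi k}"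
  have finS: "finite S" using finite_G by (simp add: S_def)
  obtain \<kappa> where \<kappa>: "\<And>\<gamma>. \<gamma> \<in> S \<Longrightarrow> \<gamma> \<le> q + unit_mi (\<kappa> \<gamma>)"
  proof -
    have "\<forall>\<gamma>\<in>S. \<exists>k. \<gamma> \<le> q + unit_mi k" by (auto simp: S_def)
    then show ?thesis using that by metis
  qed
  have \<kappa>_eq: "\<kappa> \<gamma> = k" if "\<gamma> \<in> S" "\<gamma> \<le> q + unit_mi k" for \<gamma> k
    using unique[OF _ \<kappa>[OF that(1)] that(2)] that(1) by (simp add: S_def)
  have \<kappa>_nz: "\<gamma> (\<kappa> \<gamma>) \<noteq> 0" if "\<gamma> \<in> S" for \<gamma>
    using that apply_q[OF _ \<kappa>[OF that]] by (simp add: S_def)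
  have "\<exists>\<delta>. \<delta> \<in> S \<and> \<kappa> \<delta> = \<iota> \<gamma> \<and> \<delta> \<le> \<gamma> + unit_mi (\<iota> \<gamma>) - unit_mi (\<kappa> \<gamma>)" if \<gamma>: "\<gamma> \<in> S" for \<gamma>
  proof (cases "\<kappa> \<gamma> = \<iota> \<gamma>")
    case True
    then show ?thesis using \<gamma> by auto
  next
    case False
    have "\<gamma> \<in> G" using \<gamma> by (simp add: S_def)
    from exchange[OF this \<kappa>_nz[OF \<gamma>] False] obtain \<delta>
      where \<delta>: "\<delta> \<in> G" "\<delta> \<le> \<gamma> + unit_mi (\<iota> \<gamma>) - unit_mi (\<kappa> \<gamma>)" by blast
    have "\<gamma> + unit_mi (\<iota> \<gamma>) - unit_mi (\<kappa> \<gamma>) \<le> q + unit_mi (\<iota> \<gamma>)"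
      unfolding mi_le_iff
    proof
      fix k
      have "\<gamma> k \<le> q k + unit_mi (\<kappa> \<gamma>) k" using \<kappa>[OF \<gamma>] by (simp add: mi_le_iff)
      then show "(\<gamma> + unit_mi (\<iota> \<gamma>) - unit_mi (\<kappa> \<gamma>)) k \<le> (q + unit_mi (\<iota> \<gamma>)) k" by simp
    qed
    then have le: "\<delta> \<le> q + unit_mi (\<iota> \<gamma>)" using \<delta> by order
    then have "\<delta> \<in> S" using \<delta> by (auto simp: S_def)
    then show ?thesis using \<delta> le \<kappa>_eq by blast
  qed
  then have "\<forall>\<gamma>\<in>S. \<exists>\<delta>. \<delta> \<in> S \<and> \<kappa> \<delta> = \<iota> \<gamma> \<and> \<delta> \<le> \<gamma> + unit_mi (\<iota> \<gamma>) - unit_mi (\<kappa> \<gamma>)" by blast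
  from bchoice[OF this] obtain T where
    T': "\<forall>\<gamma>\<in>S. T \<gamma> \<in> S \<and> \<kappa> (T \<gamma>) = \<iota> \<gamma> \<and> T \<gamma> \<le> \<gamma> + unit_mi (\<iota> \<gamma>) - unit_mi (\<kappa> \<gamma>)" ..
  have T: "T \<gamma> \<in> S" "\<kappa> (T \<gamma>) = \<iota> \<gamma>" "T \<gamma> \<le> \<gamma> + unit_mi (\<iota> \<gamma>) - unit_mi (\<kappa> \<gamma>)"
    if "\<gamma> \<in> S" for \<gamma> using T' that by blast+
  have injT: "inj_on T S"
  proof (rule inj_onI)
    fix \<gamma> \<delta> assume *: "\<gamma> \<in> S" "\<delta> \<in> S" "T \<gamma> = T \<delta>"
    then have "\<iota> \<gamma> = \<iota> \<delta>" using T(2)[of \<gamma>] T(2)[of \<delta>] by simp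
    then show "\<gamma> = \<delta>" using inj_onD[OF inj] *(1,2) by (simp add: S_def)
  qed
  then have surjT: "T ` S = S" using T(1) finS by (intro endo_inj_surj) auto
  have deg: "mdeg (\<gamma> + unit_mi (\<iota> \<gamma>) - unit_mi (\<kappa> \<gamma>)) = mdeg \<gamma>" if "\<gamma> \<in> S" for \<gamma>
  proof -
    have "(\<gamma> + unit_mi (\<iota> \<gamma>) - unit_mi (\<kappa> \<gamma>)) + unit_mi (\<kappa> \<gamma>) = \<gamma> + unit_mi (\<iota> \<gamma>)"
      using \<kappa>_nz[OF that] by (intro mi_diff_add) simp
    then have "mdeg (\<gamma> + unit_mi (\<iota> \<gamma>) - unit_mi (\<kappa> \<gamma>)) + mdeg (unit_mi (\<kappa> \<gamma>)) = mdeg \<gamma> + mdeg (unit_mi (\<iota> \<gamma>))"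
      unfolding mdeg_add[symmetric] by simp
    then show ?thesis by simp
  qed
  have "(\<Sum>\<gamma>\<in>S. mdeg (T \<gamma>)) = (\<Sum>\<gamma>\<in>S. mdeg \<gamma>)"
    using sum.reindex[OF injT, of mdeg] surjT by simp
  then have degT: "mdeg (T \<gamma>) = mdeg \<gamma>" if "\<gamma> \<in> S" for \<gamma>
  proof (rule sum_mono_inv[of _ S])
    show "mdeg (T \<delta>) \<le> mdeg \<delta>" if "\<delta> \<in> S" for \<delta> using mdeg_mono[OF T(3)[OF that]] deg[OF that] by simp
  qed (use that finS in simp_all)
  have T_eq: "T \<gamma> = \<gamma> + unit_mi (\<iota> \<gamma>) - unit_mi (\<kappa> \<gamma>)" if "\<gamma> \<in> S" for \<gamma>
    using mdeg_le_imp_eq[OF T(3)[OF that]] deg[OF that] degT[OF that] by simp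
  have \<beta>S: "\<beta> \<in> S" unfolding S_def using \<beta> by (intro CollectI conjI exI[of _ j]) (simp_all add: q)
  have \<kappa>\<beta>: "\<kappa> \<beta> = j" by (rule \<kappa>_eq[OF \<beta>S]) (simp add: q)
  show "\<beta> + unit_mi (\<iota> \<beta>) - unit_mi j \<in> G"
    using T_eq[OF \<beta>S] T(1)[OF \<beta>S] \<kappa>\<beta> by (simp add: S_def)
  \<comment> \<open>Surjectivity yields the second claim: a preimage of \<open>\<beta>\<close> has
    \<open>\<iota>\<close>-value \<open>\<kappa> \<beta> = j\<close> and degree
    \<open>mdeg q + 1\<close>, so it is \<open>q\<close> plus a unit vector.\<close>
  have "\<beta> \<in> T ` S" using surjT \<beta>S by simp
  then obtain \<gamma> where \<gamma>: "\<gamma> \<in> S" "T \<gamma> = \<beta>" by blast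
  have "\<iota> \<gamma> = j" using T(2)[OF \<gamma>(1)] \<gamma>(2) \<kappa>\<beta> by simp
  moreover have "\<gamma> = q + unit_mi (\<kappa> \<gamma>)"
    using mdeg_le_imp_eq[OF \<kappa>[OF \<gamma>(1)]] degT[OF \<gamma>(1)] \<gamma>(2) deg\<beta> by simp
  moreover have "\<gamma> \<in> G" using \<gamma>(1) by (simp add: S_def)
  ultimately show "\<exists>k. \<beta> - unit_mi j + unit_mi k \<in> G \<and> \<iota> (\<beta> - unit_mi j + unit_mi k) = j"
    unfolding q_def[symmetric] by (intro exI[of _ "\<kappa> \<gamma>"]) simp
qed

text \<open>If \<open>q \<noteq> 0\<close> then at most two of the \<open>q + e\<^sub>c\<close> lie in \<open>G\<close>: subtract from \<open>q\<close> a unit vector \<open>e\<^sub>l\<close> of its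
  support to obtain \<open>p\<close>. By the preceding lemma each \<open>p + e\<^sub>c\<close> is below the unique \<open>\<rho> \<in> G\<close> with \<open>\<iota> \<rho> = l\<close>, whose
  degree exceeds that of \<open>p\<close> by two.\<close>

lemma exchange_involutive:
  assumes \<beta>: "\<beta> \<in> G" and j: "\<beta> j \<noteq> 0" "\<beta> \<noteq> unit_mi j"
  shows "\<iota> (\<beta> + unit_mi (\<iota> \<beta>) - unit_mi j) = j"
proof (cases "\<iota> \<beta> = j")
  case True
  then show ?thesis by simp
next
  case False
  define q where "q = \<beta> - unit_mi j"
  have q: "q + unit_mi j = \<beta>" unfolding q_def using j by simp
  have swap: "\<beta> + unit_mi (\<iota> \<beta>) - unit_mi j = q + unit_mi (\<iota> \<beta>)"
    by (simp add: add.assoc add.commute[of "unit_mi j"] flip: q) (simp flip: add.assoc)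
  have i: "q + unit_mi (\<iota> \<beta>) \<in> G" using exchange_bijection(1)[OF \<beta> j(1)] swap by simp
  obtain k where k: "q + unit_mi k \<in> G" "\<iota> (q + unit_mi k) = j"
    using exchange_bijection(2)[OF \<beta> j(1)] unfolding q_def[symmetric] by blast
  have kj: "k \<noteq> j" using False k q by auto
  have "k = \<iota> \<beta>"
  proof (rule ccontr)
    assume ki: "k \<noteq> \<iota> \<beta>"
    have "q \<noteq> 0" using j(2) q by auto
    then obtain j' where j': "q j' \<noteq> 0" using mi_nonzero_ex by blast
    define p where "p = q - unit_mi j'"
    have p: "p + unit_mi j' = q" unfolding p_def using j' by simp
    have ex: "\<exists>\<rho>\<in>G. \<iota> \<rho> = j' \<and> (\<exists>s. \<rho> = p + unit_mi c + unit_mi s)" if c: "q + unit_mi c \<in> G" for c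
    proof -
      have "(q + unit_mi c) - unit_mi j' = p + unit_mi c"
        unfolding p[symmetric] by (simp add: add.assoc add.commute[of "unit_mi j'"]) (simp flip: add.assoc)
      then show ?thesis
        using exchange_bijection(2)[OF c, of j'] j' by auto
    qed
    obtain \<rho> where \<rho>: "\<rho> \<in> G" "\<iota> \<rho> = j'" "\<exists>s. \<rho> = p + unit_mi j + unit_mi s"
      using ex[of j] \<beta> q by auto
    have \<rho>2: "\<exists>s. \<rho> = p + unit_mi c + unit_mi s" if "q + unit_mi c \<in> G" for c
      using ex[OF that] \<rho> inj by (metis inj_onD)
    obtain s1 s2 s3 where s: "\<rho> = p + unit_mi j + unit_mi s1" "\<rho> = p + unit_mi (\<iota> \<beta>) + unit_mi s2"
      "\<rho> = p + unit_mi k + unit_mi s3"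
      using \<rho>(3) \<rho>2[OF i] \<rho>2[OF k(1)] by blast
    \<comment> \<open>A sum of two unit vectors would contain all of \<open>j\<close>,
      \<open>\<iota> \<beta>\<close> and \<open>k\<close>, which are pairwise distinct.\<close>
    have e: "unit_mi j + unit_mi s1 = unit_mi (\<iota> \<beta>) + unit_mi s2"
      "unit_mi j + unit_mi s1 = unit_mi k + unit_mi s3"
      using s by (metis add.assoc add_left_imp_eq)+
    have "(unit_mi j + unit_mi s1) (\<iota> \<beta>) \<noteq> 0" unfolding e(1) by simp
    then have "s1 = \<iota> \<beta>" using False by (auto simp: unit_mi_def split: if_splits)
    moreover have "(unit_mi j + unit_mi s1) k \<noteq> 0" unfolding e(2) by simp
    then have "s1 = k" using kj by (auto simp: unit_mi_def split: if_splits)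
    ultimately show False using ki by simp
  qed
  then show ?thesis using k(2) swap by simp
qed

text \<open>Only on the generators of degree one \<open>\<iota>\<close> may permute cyclically; there it is replaced by the identity.\<close>

lemma exchange_disjoint:
  obtains \<iota>' where "inj_on \<iota>' G" "\<iota>' ` G = \<iota> ` G"
    "\<And>\<beta> j. \<beta> \<in> G \<Longrightarrow> (\<beta> + unit_mi (\<iota>' \<beta>)) j \<noteq> 0 \<Longrightarrow>
      \<beta> + unit_mi (\<iota>' \<beta>) - unit_mi j \<in> G \<and> \<iota>' (\<beta> + unit_mi (\<iota>' \<beta>) - unit_mi j) = j"
proof -
  define U where "U = {\<beta> \<in> G. \<exists>l. \<beta> = unit_mi l}"
  define \<iota>' where "\<iota>' = (\<lambda>\<beta>. if \<beta> \<in> U then (THE l. \<beta> = unit_mi l) else \<iota> \<beta>)"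
  have unit_inj: "unit_mi l = unit_mi l' \<longleftrightarrow> l = l'" for l l' :: 'n
    by (metis unit_mi_self unit_mi_apply zero_neq_one)
  have \<iota>'_unit: "\<iota>' (unit_mi l) = l" if "unit_mi l \<in> G" for l
    using that by (auto simp: \<iota>'_def U_def unit_inj)
  have \<iota>'_other: "\<iota>' \<beta> = \<iota> \<beta>" if "\<beta> \<in> G - U" for \<beta>
    using that by (auto simp: \<iota>'_def)
  have finU: "finite U" using finite_G by (simp add: U_def)
  define L where "L = {l. unit_mi l \<in> G}"
  have UL: "U = unit_mi ` L" by (auto simp: U_def L_def)
  have cardUL: "card U = card L" unfolding UL by (rule card_image) (auto intro!: inj_onI simp: unit_inj)
  \<comment> \<open>Exchanging \<open>unit_mi l\<close> at \<open>l\<close> itself leaves the unit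
    vector of \<open>\<iota> (unit_mi l)\<close>, which is therefore in \<open>G\<close>. By
    counting, \<open>\<iota>\<close> maps \<open>U\<close> onto \<open>L\<close>, as does
    \<open>\<iota>'\<close>.\<close>
  have \<iota>U: "\<iota> ` U \<subseteq> L"
  proof
    fix i assume "i \<in> \<iota> ` U"
    then obtain l where l: "unit_mi l \<in> G" "i = \<iota> (unit_mi l)" by (auto simp: U_def)
    have "unit_mi l + unit_mi (\<iota> (unit_mi l)) - unit_mi l = unit_mi i" using l by simp
    then show "i \<in> L" using exchange_bijection(1)[OF l(1), of l] by (simp add: L_def)
  qed
  have "card (\<iota> ` U) = card L"
    using inj cardUL by (subst card_image) (auto simp: U_def inj_on_def)
  then have \<iota>UL: "\<iota> ` U = L" using \<iota>U by (intro card_subset_eq) auto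
  have \<iota>'UL: "\<iota>' ` U = L" unfolding UL using \<iota>'_unit by (force simp: L_def)
  have GU: "G = U \<union> (G - U)" by (auto simp: U_def)
  \<comment> \<open>The image is kept because the nonzero minor of \<open>f\<close> sits in these
    rows.\<close>
  have img: "\<iota>' ` G = \<iota> ` G"
  proof -
    have "\<iota>' ` G = \<iota>' ` U \<union> \<iota>' ` (G - U)" by (subst GU) (rule image_Un)
    also have "\<dots> = \<iota> ` U \<union> \<iota> ` (G - U)" using \<iota>'UL \<iota>UL \<iota>'_other by auto
    also have "\<dots> = \<iota> ` G" by (simp only: image_Un[symmetric] GU[symmetric])
    finally show ?thesis .
  qed
  show ?thesis
  proof (rule that[OF _ img])
    show "inj_on \<iota>' G"
      using img inj finite_G by (intro eq_card_imp_inj_on) (simp_all add: card_image)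
    fix \<beta> j assume \<beta>: "\<beta> \<in> G" and j: "(\<beta> + unit_mi (\<iota>' \<beta>)) j \<noteq> 0"
    show "\<beta> + unit_mi (\<iota>' \<beta>) - unit_mi j \<in> G \<and> \<iota>' (\<beta> + unit_mi (\<iota>' \<beta>) - unit_mi j) = j"
    proof (cases "j = \<iota>' \<beta>")
      case True
      then show ?thesis using \<beta> by simp
    next
      case False
      then have bj: "\<beta> j \<noteq> 0" using j by (simp add: unit_mi_def)
      have nU: "\<beta> \<notin> U"
        using False bj \<beta> \<iota>'_unit by (auto simp: U_def unit_mi_def split: if_splits)
      then have i': "\<iota>' \<beta> = \<iota> \<beta>" using \<iota>'_other \<beta> by blast
      have nj: "\<beta> \<noteq> unit_mi j" using nU \<beta> by (auto simp: U_def)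
      define \<gamma> where "\<gamma> = \<beta> + unit_mi (\<iota> \<beta>) - unit_mi j"
      have \<gamma>: "\<gamma> \<in> G" "\<iota> \<gamma> = j"
        using exchange_bijection(1)[OF \<beta> bj] exchange_involutive[OF \<beta> bj nj] by (auto simp: \<gamma>_def)
      \<comment> \<open>A unit vector \<open>\<gamma>\<close> would force
        \<open>\<beta> = unit_mi j\<close>; so the exchange keeps generators of higher degree among
        themselves.\<close>
      have "\<gamma> \<notin> U"
      proof
        assume "\<gamma> \<in> U"
        then obtain l where l: "\<gamma> = unit_mi l" by (auto simp: U_def)
        have "\<gamma> + unit_mi j = \<beta> + unit_mi (\<iota> \<beta>)" unfolding \<gamma>_def using bj by (intro mi_diff_add) simp
        then have "unit_mi l + unit_mi j = \<beta> + unit_mi (\<iota> \<beta>)" using l by simp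
        moreover have "j \<noteq> \<iota> \<beta>" using False i' by simp
        ultimately have "l = \<iota> \<beta>"
          by (metis (full_types) add_is_0 plus_fun_apply unit_mi_apply zero_neq_one)
        then have "\<beta> = unit_mi j"
          using \<open>unit_mi l + unit_mi j = \<beta> + unit_mi (\<iota> \<beta>)\<close> by (metis add.commute add_right_imp_eq)
        then show False using nj by simp
      qed
      then show ?thesis using \<gamma> \<iota>'_other i' by (auto simp: \<gamma>_def)
    qed
  qed
qed

end

subsection \<open>Systems of distinct representatives from a nonzero minor\<close>

text \<open>The columns indexed by \<open>G\<close> stay linearly independent when restricted to the
  rows in \<open>K\<close>. For \<open>card K = card G\<close> this says that the corresponding
  minor is nonzero.\<close>

definition rows_indep :: "'n::finite set \<Rightarrow> 'b set \<Rightarrow> ('n \<Rightarrow> 'b \<Rightarrow> complex) \<Rightarrow> bool" where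
  "rows_indep K G A \<longleftrightarrow> (\<forall>c. (\<forall>j\<in>K. (\<Sum>\<beta>\<in>G. A j \<beta> * c \<beta>) = 0) \<longrightarrow> (\<forall>\<beta>\<in>G. c \<beta> = 0))"

definition left_inv :: "'b set \<Rightarrow> ('n::finite \<Rightarrow> 'b \<Rightarrow> complex) \<Rightarrow> bool" where
  "left_inv G A \<longleftrightarrow> (\<exists>C. \<forall>\<beta>\<in>G. \<forall>\<gamma>\<in>G. (\<Sum>j\<in>UNIV. C \<beta> j * A j \<gamma>) = (if \<beta> = \<gamma> then 1 else 0))"

text \<open>The columns of \<open>A\<close> stand at the positions given by \<open>b\<close>, and
  the remaining columns are unit vectors. Expanding along the latter, the determinant is the minor
  with columns \<open>G\<close> and rows the image of \<open>b\<close>; all minors thus live in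
  square matrices over \<open>'n\<close>.\<close>

definition padded :: "('n::finite \<Rightarrow> 'b \<Rightarrow> complex) \<Rightarrow> 'b set \<Rightarrow> ('b \<Rightarrow> 'n) \<Rightarrow> complex ^ 'n ^ 'n" where
  "padded A G b = (\<chi> j k. if k \<in> b ` G then A j (inv_into G b k) else if j = k then 1 else 0)"

lemma padded_mult_vec:
  assumes "finite G" "inj_on b G"
  shows "(padded A G b *v v) $ j = (\<Sum>\<beta>\<in>G. A j \<beta> * v $ b \<beta>) + (if j \<in> b ` G then 0 else v $ j)"
proof -
  have "(padded A G b *v v) $ j = (\<Sum>k\<in>UNIV. padded A G b $ j $ k * v $ k)"
    by (simp add: matrix_vector_mult_def)
  also have "\<dots> = (\<Sum>k\<in>b ` G. padded A G b $ j $ k * v $ k) + (\<Sum>k\<in>- (b ` G). padded A G b $ j $ k * v $ k)"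
    using sum.union_disjoint[of "b ` G" "- (b ` G)" "\<lambda>k. padded A G b $ j $ k * v $ k"] by simp
  also have "(\<Sum>k\<in>b ` G. padded A G b $ j $ k * v $ k) = (\<Sum>\<beta>\<in>G. A j \<beta> * v $ b \<beta>)"
    using assms by (subst sum.reindex) (auto simp: padded_def inv_into_f_f intro!: sum.cong)
  also have "(\<Sum>k\<in>- (b ` G). padded A G b $ j $ k * v $ k) = (\<Sum>k\<in>- (b ` G). if k = j then v $ j else 0)"
    by (intro sum.cong refl) (auto simp: padded_def)
  also have "\<dots> = (if j \<in> b ` G then 0 else v $ j)" by simp
  finally show ?thesis .
qed

lemma det_padded_nz_iff:
  assumes "finite G" "inj_on b G"
  shows "det (padded A G b) \<noteq> 0 \<longleftrightarrow> rows_indep (b ` G) G A"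
proof -
  have "det (padded A G b) \<noteq> 0 \<longleftrightarrow> (\<forall>v. padded A G b *v v = 0 \<longrightarrow> v = 0)"
    by (simp only: invertible_det_nz[symmetric] invertible_left_inverse matrix_left_invertible_ker)
  also have "\<dots> \<longleftrightarrow> rows_indep (b ` G) G A"
  proof
    assume *: "\<forall>v. padded A G b *v v = 0 \<longrightarrow> v = 0"
    show "rows_indep (b ` G) G A"
      unfolding rows_indep_def
    proof (intro allI impI)
      fix c assume c: "\<forall>j\<in>b ` G. (\<Sum>\<beta>\<in>G. A j \<beta> * c \<beta>) = 0"
      \<comment> \<open>Outside the image of \<open>b\<close> the unit columns let the rows be
        solved for the remaining coordinates.\<close>
      define v where "v = (\<chi> k. if k \<in> b ` G then c (inv_into G b k) else - (\<Sum>\<beta>\<in>G. A k \<beta> * c \<beta>))"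
      have vb: "v $ b \<beta> = c \<beta>" if "\<beta> \<in> G" for \<beta>
        using that assms by (simp add: v_def inv_into_f_f)
      have s: "(\<Sum>\<beta>\<in>G. A j \<beta> * v $ b \<beta>) = (\<Sum>\<beta>\<in>G. A j \<beta> * c \<beta>)" for j
        by (intro sum.cong refl) (simp add: vb)
      have "padded A G b *v v = 0"
        unfolding vec_eq_iff padded_mult_vec[OF assms] s using c by (auto simp: v_def)
      then have "v = 0" using * by blast
      then show "\<forall>\<beta>\<in>G. c \<beta> = 0" by (simp flip: vb)
    qed
  next
    assume *: "rows_indep (b ` G) G A"
    show "\<forall>v. padded A G b *v v = 0 \<longrightarrow> v = 0"
    proof (intro allI impI)
      fix v assume "padded A G b *v v = 0"
      then have v: "(\<Sum>\<beta>\<in>G. A j \<beta> * v $ b \<beta>) + (if j \<in> b ` G then 0 else v $ j) = 0" for j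
        unfolding padded_mult_vec[OF assms, symmetric] by simp
      have z: "\<forall>j\<in>b ` G. (\<Sum>\<beta>\<in>G. A j \<beta> * v $ b \<beta>) = 0"
      proof
        fix j assume "j \<in> b ` G"
        then show "(\<Sum>\<beta>\<in>G. A j \<beta> * v $ b \<beta>) = 0" using v[of j] by simp
      qed
      have "\<forall>\<beta>\<in>G. v $ b \<beta> = 0"
        by (rule mp[OF spec[OF *[unfolded rows_indep_def], of "\<lambda>\<beta>. v $ b \<beta>"] z])
      then have 0: "v $ b \<beta> = 0" if "\<beta> \<in> G" for \<beta> using that by simp
      then have "v $ j = 0" for j using v[of j] by (cases "j \<in> b ` G") auto
      then show "v = 0" by (simp add: vec_eq_iff)
    qed
  qed
  finally show ?thesis .
qed

lemma det_padded_nz_imp_left_inv: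
  assumes "finite G" "inj_on b G" "det (padded A G b) \<noteq> 0"
  shows "left_inv G A"
proof -
  obtain L where L: "L ** padded A G b = mat 1"
    using assms(3) invertible_det_nz[of "padded A G b"] unfolding invertible_def by blast
  have "(\<Sum>j\<in>UNIV. L $ b \<beta> $ j * A j \<gamma>) = (if \<beta> = \<gamma> then 1 else 0)" if "\<beta> \<in> G" "\<gamma> \<in> G" for \<beta> \<gamma>
  proof -
    have "(L ** padded A G b) $ b \<beta> $ b \<gamma> = (\<Sum>j\<in>UNIV. L $ b \<beta> $ j * A j \<gamma>)"
      using that assms by (simp add: matrix_matrix_mult_def padded_def inv_into_f_f)
    then show ?thesis using L assms(2) that by (auto simp: mat_def inj_on_eq_iff)
  qed
  then show ?thesis unfolding left_inv_def by (intro exI[of _ "\<lambda>\<beta> j. L $ b \<beta> $ j"]) auto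
qed

text \<open>The determinant is a polynomial in \<open>t\<close> whose value at zero is the given
  nonzero minor.\<close>

lemma finite_det_padded_zero:
  assumes "det (padded A G b) \<noteq> 0"
  shows "finite {t. det (padded (\<lambda>j \<beta>. A j \<beta> + t * D j \<beta>) G b) = 0}"
proof -
  define P where "P = (\<lambda>j k. if k \<in> b ` G then [:A j (inv_into G b k), D j (inv_into G b k):]
      else if j = k then 1 else 0)"
  define p where "p = (\<Sum>\<pi> | \<pi> permutes UNIV. of_int (sign \<pi>) * (\<Prod>j\<in>UNIV. P j (\<pi> j)))"
  have "poly (P j k) t = padded (\<lambda>j \<beta>. A j \<beta> + t * D j \<beta>) G b $ j $ k" for j k t
    by (auto simp: P_def padded_def)
  then have p: "poly p t = det (padded (\<lambda>j \<beta>. A j \<beta> + t * D j \<beta>) G b)" for t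
    by (simp add: p_def det_def poly_sum poly_prod)
  have "poly p 0 \<noteq> 0" using assms by (simp add: p)
  then have "p \<noteq> 0" by auto
  then show ?thesis using poly_roots_finite[of p] by (simp add: p)
qed

text \<open>The rows of the left inverse are functionals dual to the columns of
  \<open>A\<close>.\<close>

lemma left_inv_vec_independent:
  assumes "left_inv G A"
  shows "inj_on (\<lambda>\<beta>. \<chi> j. A j \<beta>) G" "vec.independent ((\<lambda>\<beta>. (\<chi> j. A j \<beta>) :: complex ^ 'n::finite) ` G)"
proof -
  let ?a = "\<lambda>\<beta>. (\<chi> j. A j \<beta>) :: complex ^ 'n"
  obtain C where C: "\<And>\<beta> \<gamma>. \<beta> \<in> G \<Longrightarrow> \<gamma> \<in> G \<Longrightarrow> (\<Sum>j\<in>UNIV. C \<beta> j * A j \<gamma>) = (if \<beta> = \<gamma> then 1 else 0)"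
    using assms unfolding left_inv_def by blast
  define l where "l = (\<lambda>\<beta> (v :: complex ^ 'n). \<Sum>j\<in>UNIV. C \<beta> j * v $ j)"
  have l: "l \<beta> (?a \<gamma>) = (if \<beta> = \<gamma> then 1 else 0)" if "\<beta> \<in> G" "\<gamma> \<in> G" for \<beta> \<gamma>
    using C[OF that] by (simp add: l_def)
  show "inj_on ?a G" by (rule inj_onI) (metis l zero_neq_one)
  show "vec.independent (?a ` G)"
    unfolding vec.dependent_def
  proof clarify
    fix \<beta> assume \<beta>: "\<beta> \<in> G" "?a \<beta> \<in> vec.span (?a ` G - {?a \<beta>})"
    from \<beta>(2) have "l \<beta> (?a \<beta>) = 0"
    proof (induction rule: vec.span_induct_alt)
      case base
      show ?case by (simp add: l_def)
    next
      case (step c x y)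
      then obtain \<gamma> where "\<gamma> \<in> G" "x = ?a \<gamma>" "\<gamma> \<noteq> \<beta>" by auto
      then have "l \<beta> x = 0" using l[OF \<beta>(1)] by simp
      moreover have "l \<beta> (c *s x + y) = c * l \<beta> x + l \<beta> y"
        by (simp add: l_def sum.distrib sum_distrib_left algebra_simps)
      ultimately show ?case using step by simp
    qed
    then show False using l[OF \<beta>(1) \<beta>(1)] by simp
  qed
qed

lemma left_inv_finite: "left_inv G (A :: 'n::finite \<Rightarrow> 'b \<Rightarrow> complex) \<Longrightarrow> finite G"
  using left_inv_vec_independent[of G A] vec.finiteI_independent finite_image_iff by blast

text \<open>A nonzero maximal minor has a nonzero term in its Leibniz expansion, and the permutation
  of that term selects a nonzero entry in each column. The minor is found by extending the columns
  to a basis by unit vectors: its rows are those whose unit vector is not added.\<close>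

lemma left_inv_representatives:
  assumes "left_inv G (A :: 'n::finite \<Rightarrow> 'b \<Rightarrow> complex)"
  obtains \<iota> where "inj_on \<iota> G" "\<And>\<beta>. \<beta> \<in> G \<Longrightarrow> A (\<iota> \<beta>) \<beta> \<noteq> 0" "rows_indep (\<iota> ` G) G A"
proof -
  define a where "a = (\<lambda>\<beta>. (\<chi> j. A j \<beta>) :: complex ^ 'n)"
  have finG: "finite G" by (rule left_inv_finite[OF assms])
  note ind = left_inv_vec_independent[OF assms, folded a_def]
  let ?E = "range (\<lambda>k. axis k 1 :: complex ^ 'n)"
  obtain B where B: "a ` G \<subseteq> B" "B \<subseteq> a ` G \<union> ?E" "vec.independent B" "a ` G \<union> ?E \<subseteq> vec.span B"
    using vec.maximal_independent_subset_extend[of "a ` G" "a ` G \<union> ?E"] ind(2) by auto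
  have "vec.span B = UNIV"
  proof -
    have "vec.span ?E \<subseteq> vec.span B" using B(4) by (metis le_sup_iff vec.span_minimal vec.subspace_span)
    moreover have "vec.span ?E = UNIV"
      using vec.span_Basis by (simp add: cart_basis_def full_SetCompr_eq)
    ultimately show ?thesis by auto
  qed
  then have dimB: "vec.dim (UNIV :: (complex ^ 'n) set) = card B"
    using B(3) vec.dim_eq_card[of B UNIV] by simp
  have cardB: "card B = CARD('n)" by (rule trans[OF dimB[symmetric] vec_dim_card])
  have finB: "finite B" by (rule vec.finiteI_independent[OF B(3)])
  define V where "V = a ` G"
  \<comment> \<open>Unit vectors that are themselves columns of \<open>A\<close> are not
    counted.\<close>
  define K where "K = {k. axis k 1 \<in> B - V}"
  have "B = V \<union> (\<lambda>k. axis k 1) ` K" "V \<inter> (\<lambda>k. axis k 1) ` K = {}"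
    using B(1,2) unfolding V_def[symmetric] by (auto simp: K_def)
  then have Beq: "B = a ` G \<union> (\<lambda>k. axis k 1) ` K" and disj: "a ` G \<inter> (\<lambda>k. axis k 1) ` K = {}"
    by (simp_all only: V_def)
  have injax: "inj_on (\<lambda>k. axis k 1 :: complex ^ 'n) K"
    by (rule inj_onI) (simp add: axis_eq_axis)

  have "card B = card G + card K"
    unfolding Beq using finG card_image[OF ind(1)] card_image[OF injax] disj
    by (subst card_Un_disjoint) simp_all
  then have "card (- K) = card G" using cardB by (simp add: Compl_eq_Diff_UNIV card_Diff_subset)
  then obtain b where b: "bij_betw b G (- K)"
    using finite_same_card_bij[OF finG, of "- K"] by auto
  have injb: "inj_on b G" and imgb: "b ` G = - K" using b by (auto simp: bij_betw_def)
  have rows: "rows_indep (b ` G) G A"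
    unfolding rows_indep_def
  proof (intro allI impI)
    fix c assume c: "\<forall>j\<in>b ` G. (\<Sum>\<beta>\<in>G. A j \<beta> * c \<beta>) = 0"
    \<comment> \<open>If \<open>c\<close> kills the rows outside \<open>K\<close>, the combination
      of columns lies in the span of the unit vectors from \<open>K\<close>. With \<open>d\<close>
      as their coefficients this becomes a relation in the basis \<open>B\<close>.\<close>
    define d where "d = (\<lambda>k. - (\<Sum>\<beta>\<in>G. A k \<beta> * c \<beta>))"
    define u where "u = (\<lambda>x. if x \<in> a ` G then c (inv_into G a x) else d (THE k. x = axis k 1))"
    have "(\<Sum>x\<in>B. u x *s x) = (\<Sum>x\<in>a ` G. u x *s x) + (\<Sum>x\<in>(\<lambda>k. axis k 1) ` K. u x *s x)"
      unfolding Beq using finG disj by (intro sum.union_disjoint) simp_all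
    also have "(\<Sum>x\<in>a ` G. u x *s x) = (\<Sum>\<beta>\<in>G. c \<beta> *s a \<beta>)"
      using ind(1) by (subst sum.reindex) (auto simp: u_def intro!: sum.cong)
    also have "(\<Sum>x\<in>(\<lambda>k. axis k 1) ` K. u x *s x) = (\<Sum>k\<in>K. d k *s axis k 1)"
      using injax by (subst sum.reindex) (auto simp: u_def K_def V_def axis_eq_axis intro!: sum.cong)
    also have "(\<Sum>\<beta>\<in>G. c \<beta> *s a \<beta>) + (\<Sum>k\<in>K. d k *s axis k 1) = 0"
    proof -
      have "(\<Sum>\<beta>\<in>G. c \<beta> * A j \<beta>) + (\<Sum>k\<in>K. if k = j then d k else 0) = 0" for j
        using c imgb by (auto simp: d_def mult.commute)
      moreover have "(\<Sum>k\<in>K. if k = j then d k else 0) = (\<Sum>k\<in>K. d k * (axis k 1 :: complex ^ 'n) $ j)" for j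
        by (intro sum.cong refl) (auto simp: axis_def)
      ultimately show ?thesis by (simp add: vec_eq_iff a_def)
    qed
    finally have "u x = 0" if "x \<in> B" for x
      using vec.independentD[OF B(3) finB subset_refl _ that] by blast
    then show "\<forall>\<beta>\<in>G. c \<beta> = 0"
      using B(1) ind(1) by (metis (no_types, lifting) image_eqI inv_into_f_f subsetD u_def)
  qed
  then have "det (padded A G b) \<noteq> 0" using det_padded_nz_iff[OF finG injb] by blast
  then obtain \<pi> where \<pi>: "\<pi> permutes UNIV" "(\<Prod>j\<in>UNIV. padded A G b $ j $ \<pi> j) \<noteq> 0"
    unfolding det_def by (metis (mono_tags, lifting) mem_Collect_eq mult_zero_right sum.neutral)
  then have nz: "padded A G b $ j $ \<pi> j \<noteq> 0" for j by auto
  define \<sigma> where "\<sigma> = inv \<pi>"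
  have \<sigma>: "bij \<sigma>" "\<pi> (\<sigma> k) = k" for k
    using \<pi>(1) permutes_inv permutes_bij permutes_inverses(1) by (auto simp: \<sigma>_def)
  have nz': "padded A G b $ \<sigma> k $ k \<noteq> 0" for k using nz[of "\<sigma> k"] \<sigma> by simp
  \<comment> \<open>For \<open>k\<close> in \<open>K\<close> the column is a unit vector with its
    nonzero entry on the diagonal. So \<open>\<sigma>\<close> permutes the complement of
    \<open>K\<close>, and the row set remains the image of \<open>b\<close>.\<close>
  have fixK: "\<sigma> k = k" if "k \<in> K" for k
    using nz'[of k] that imgb by (auto simp: padded_def split: if_splits)
  have \<sigma>K: "\<sigma> ` (- K) = - K"
    using \<sigma>(1) fixK by (metis (no_types, lifting) bij_image_Compl_eq image_cong image_ident)
  show ?thesis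
  proof (rule that[of "\<sigma> \<circ> b"])
    show "inj_on (\<sigma> \<circ> b) G" using injb \<sigma>(1) by (intro comp_inj_on) (auto simp: bij_def intro: inj_on_subset)
    show "A ((\<sigma> \<circ> b) \<beta>) \<beta> \<noteq> 0" if "\<beta> \<in> G" for \<beta>
      using nz'[of "b \<beta>"] that injb by (simp add: padded_def inv_into_f_f)
    show "rows_indep ((\<sigma> \<circ> b) ` G) G A" using rows \<sigma>K imgb by (simp only: image_comp[symmetric])
  qed
qed

subsection \<open>Units and division by monomials\<close>

text \<open>The geometric series of \<open>\<mu>\<close>, summed by \<open>psum\<close> at
  \<open>t = 1\<close>.\<close>

lemma cps_geometric_inverse:
  assumes "cf \<mu> 0 = 0"
  shows "\<exists>v. (1 - \<mu>) * v = 1"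
proof -
  obtain C B where CB: "0 \<le> C" "1 \<le> B" "\<And>m. hn m \<mu> \<le> C * B ^ m"
    using cf[of \<mu>] unfolding CS_iff_hnorm hn_def by blast
  \<comment> \<open>Since \<open>\<mu>\<close> has no constant term, raising the rate by the factor
    \<open>l\<close> lowers the constant from \<open>C\<close> to \<open>1 / 4\<close>. Multiplying
    by \<open>\<mu>\<close> then costs \<open>2 * (1 / 4) = 1 / 2\<close>.\<close>
  define l where "l = max 1 (4 * C)"
  define B' where "B' = l * B"
  have l: "1 \<le> l" "4 * C \<le> l" by (auto simp: l_def)
  have B': "1 \<le> B'" using l CB(2) by (simp add: B'_def mult_ge1_I)
  have small: "hn m \<mu> \<le> (1 / 4) * B' ^ m" for m
  proof (cases m)
    case 0
    then show ?thesis using assms by (simp add: hn_def hnorm_def)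
  next
    case (Suc k)
    have "C * B ^ m \<le> (1 / 4) * (l * l ^ k) * B ^ m"
    proof (rule mult_right_mono)
      have "l * 1 \<le> l * l ^ k" using l by (intro mult_left_mono one_le_power) auto
      then have "4 * C \<le> l * l ^ k" using l(2) by linarith
      then show "C \<le> (1 / 4) * (l * l ^ k)" by simp
    qed (use CB in auto)
    also have "\<dots> = (1 / 4) * B' ^ m" by (simp add: B'_def power_mult_distrib Suc)
    finally show ?thesis by (rule order_trans[OF CB(3)])
  qed
  have pow: "hn m (\<mu> ^ k) \<le> (1 / 2) ^ k * (2 * B') ^ m" for k m
  proof (induction k arbitrary: m)
    case 0
    have "(\<Sum>\<alpha> | mdeg \<alpha> = m. norm (cf (1 :: 'a cps) \<alpha>)) = (if m = 0 then 1 else 0)"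
      by (auto simp: cf_one intro!: sum.neutral)
    moreover have "1 \<le> (2 * B') ^ m" using B' by (intro one_le_power) auto
    ultimately show ?case using B' by (auto simp: hn_def hnorm_def)
  next
    case (Suc k)
    have "hn m (\<mu> * \<mu> ^ k) \<le> 2 * (1 / 4) * (1 / 2) ^ k * (2 * B') ^ m"
      by (rule hn_mult_le[where B = B']) (use small Suc B' in \<open>auto intro: mono_onI\<close>)
    then show ?case by simp
  qed
  have ok: "psum_ok 1 (\<lambda>k. \<mu> ^ k)"
    unfolding psum_ok_def
    by (rule exI[of _ 1], rule exI[of _ "2 * B'"], rule exI[of _ "1 / 2"]) (use B' pow in auto)
  define v where "v = psum 1 (\<lambda>k. \<mu> ^ k)"
  have v: "(\<lambda>k. cf (\<mu> ^ k) \<alpha>) sums cf v \<alpha>" for \<alpha>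
    using psum_sums[OF ok] by (simp add: v_def)
  have cont: "cps_continuous (\<lambda>x. \<mu> * x)"
    by (rule cps_continuous_mult_left) (simp add: cps_continuous_def)
  have "(1 - \<mu>) * v = 1"
  proof (rule cps_eqI)
    fix \<alpha>
    have "(\<lambda>k. cf (\<mu> ^ Suc k) \<alpha>) sums cf (\<mu> * v) \<alpha>"
      using cps_continuousD[OF cont, of "\<lambda>k. \<mu> ^ k" v \<alpha>] v by simp
    then have "(\<lambda>k. cf (\<mu> ^ k) \<alpha>) sums (cf (\<mu> * v) \<alpha> + cf (\<mu> ^ 0) \<alpha>)"
      by (subst sums_Suc_iff[symmetric]) simp
    then have "cf v \<alpha> = cf (\<mu> * v) \<alpha> + cf 1 \<alpha>" using sums_unique2[OF v] by force
    then show "cf ((1 - \<mu>) * v) \<alpha> = cf 1 \<alpha>" by (simp add: left_diff_distrib)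
  qed
  then show ?thesis ..
qed

lemma cps_unit:
  assumes "cf u 0 \<noteq> 0"
  shows "\<exists>v. u * v = 1"
proof -
  define c where "c = cf u 0"
  define \<mu> where "\<mu> = 1 - cst (1 / c) * u"
  have "cf \<mu> 0 = 0" using assms by (simp add: \<mu>_def cf_one c_def cf_cterm)
  from cps_geometric_inverse[OF this] obtain v where v: "(1 - \<mu>) * v = 1" by blast
  have "u * (cst (1 / c) * v) = (1 - \<mu>) * v" by (simp add: \<mu>_def mult_ac)
  then show ?thesis using v by metis
qed

text \<open>Division by a monomial with remainder: terms that are not multiples of
  \<open>mon \<beta>\<close> are dropped.\<close>

lift_definition mono_quot :: "('n \<Rightarrow> nat) \<Rightarrow> 'n::finite cps \<Rightarrow> 'n cps" is "\<lambda>\<beta> f \<alpha>. f (\<alpha> + \<beta>)"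
proof -
  fix \<beta> and f :: "'n ps" assume "f \<in> CS"
  then obtain H B where *: "0 \<le> H" "1 \<le> B" "\<And>m. hnorm m f \<le> H * B ^ m"
    unfolding CS_iff_hnorm by auto
  show "(\<lambda>\<alpha>. f (\<alpha> + \<beta>)) \<in> CS"
  proof (rule CS_I)
    fix m
    have "hnorm m (\<lambda>\<alpha>. f (\<alpha> + \<beta>)) = (\<Sum>\<alpha>\<in>(\<lambda>\<alpha>. \<alpha> + \<beta>) ` {\<alpha>. mdeg \<alpha> = m}. norm (f \<alpha>))"
      unfolding hnorm_def by (subst sum.reindex) (auto simp: inj_on_def)
    also have "\<dots> \<le> hnorm (m + mdeg \<beta>) f"
      unfolding hnorm_def by (intro sum_mono2) auto
    also have "\<dots> \<le> H * B ^ (m + mdeg \<beta>)" by (rule *)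
    finally show "hnorm m (\<lambda>\<alpha>. f (\<alpha> + \<beta>)) \<le> (H * B ^ mdeg \<beta>) * B ^ m" by (simp add: power_add mult_ac)
  qed (use * in auto)
qed

lemma cf_mono_quot: "cf (mono_quot \<beta> f) \<alpha> = cf f (\<alpha> + \<beta>)"
  by transfer simp

text \<open>The exponents of the monomials in the ideal generated by \<open>M\<close>. Being
  \<open>supported\<close> on this set is the membership test for the ideal.\<close>

definition upset :: "('n \<Rightarrow> nat) set \<Rightarrow> ('n \<Rightarrow> nat) set" where
  "upset M = {\<alpha>. \<exists>\<beta>\<in>M. \<beta> \<le> \<alpha>}"

definition supported :: "('n \<Rightarrow> nat) set \<Rightarrow> 'n::finite cps \<Rightarrow> bool" where
  "supported E f \<longleftrightarrow> (\<forall>\<alpha>. cf f \<alpha> \<noteq> 0 \<longrightarrow> \<alpha> \<in> E)"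

lemma supportedD: "supported E f \<Longrightarrow> cf f \<alpha> \<noteq> 0 \<Longrightarrow> \<alpha> \<in> E"
  by (auto simp: supported_def)

lemma supported_add:
  assumes "supported E f" "supported E g"
  shows "supported E (f + g)"
  unfolding supported_def
proof (intro allI impI)
  fix \<alpha> assume "cf (f + g) \<alpha> \<noteq> 0"
  then have "cf f \<alpha> \<noteq> 0 \<or> cf g \<alpha> \<noteq> 0" by auto
  then show "\<alpha> \<in> E" using supportedD assms by blast
qed

lemma supported_diff:
  assumes "supported E f" "supported E g"
  shows "supported E (f - g)"
  unfolding supported_def
proof (intro allI impI)
  fix \<alpha> assume "cf (f - g) \<alpha> \<noteq> 0"
  then have "cf f \<alpha> \<noteq> 0 \<or> cf g \<alpha> \<noteq> 0" by auto
  then show "\<alpha> \<in> E" using supportedD assms by blast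
qed

lemma supported_0: "supported E 0"
  by (simp add: supported_def)

lemma supported_sum: "(\<And>x. x \<in> S \<Longrightarrow> supported E (F x)) \<Longrightarrow> supported E (\<Sum>x\<in>S. F x)"
  by (induction S rule: infinite_finite_induct) (auto intro: supported_0 supported_add)

lemma upset_mono: "\<alpha> \<in> upset M \<Longrightarrow> \<alpha> \<le> \<beta> \<Longrightarrow> \<beta> \<in> upset M"
  unfolding upset_def by (auto intro: order_trans)

lemma supported_mult:
  assumes "supported (upset M) f"
  shows "supported (upset M) (a * f)"
  unfolding supported_def
proof (intro allI impI, rule ccontr)
  fix \<alpha> assume nz: "cf (a * f) \<alpha> \<noteq> 0" and "\<alpha> \<notin> upset M"
  have "cf f \<gamma> = 0" if "(\<beta>, \<gamma>) \<in> splits \<alpha>" for \<beta> \<gamma>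
  proof (rule ccontr)
    assume "cf f \<gamma> \<noteq> 0"
    moreover have "\<gamma> \<le> \<alpha>" using that by (auto simp: splits_def)
    ultimately have "\<alpha> \<in> upset M" using supportedD[OF assms] upset_mono by blast
    then show False using \<open>\<alpha> \<notin> upset M\<close> by blast
  qed
  then have "cf (a * f) \<alpha> = 0"
    unfolding cf_mult by (intro sum.neutral) auto
  with nz show False by simp
qed

text \<open>Divide by the generators one after another; each remainder only loses terms of
  \<open>f\<close>. So the constant term of \<open>h \<beta>\<close> is \<open>cf f \<beta>\<close>
  or zero. If no generator occurs in \<open>f\<close>, then \<open>f\<close> lies in the maximal
  ideal times the monomial ideal.\<close>

lemma supported_imp_mono_combination:
  assumes "finite G" "supported (upset G) f"
  shows "\<exists>h. f = (\<Sum>\<beta>\<in>G. h \<beta> * mon \<beta>) \<and> (\<forall>\<beta>\<in>G. cf f \<beta> = 0 \<longrightarrow> cf (h \<beta>) 0 = 0)"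
  using assms
proof (induction G arbitrary: f)
  case empty
  then have "f = 0" by (intro cps_eqI) (auto simp: supported_def upset_def)
  then show ?case by simp
next
  case (insert \<beta> G)
  define r where "r = f - mon \<beta> * mono_quot \<beta> f"
  have r: "cf r \<alpha> = (if \<beta> \<le> \<alpha> then 0 else cf f \<alpha>)" for \<alpha>
    by (simp add: r_def cf_cterm_mult cf_mono_quot)
  have "supported (upset G) r"
    using insert.prems by (auto simp: supported_def upset_def r)
  from insert.IH[OF this] obtain h where h: "r = (\<Sum>\<gamma>\<in>G. h \<gamma> * mon \<gamma>)"
    "\<forall>\<gamma>\<in>G. cf r \<gamma> = 0 \<longrightarrow> cf (h \<gamma>) 0 = 0" by blast
  define h' where "h' = h(\<beta> := mono_quot \<beta> f)"
  have "(\<Sum>\<gamma>\<in>G. h' \<gamma> * mon \<gamma>) = (\<Sum>\<gamma>\<in>G. h \<gamma> * mon \<gamma>)"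
    using insert.hyps by (intro sum.cong refl) (auto simp: h'_def)
  then have "(\<Sum>\<gamma>\<in>insert \<beta> G. h' \<gamma> * mon \<gamma>) = mono_quot \<beta> f * mon \<beta> + (\<Sum>\<gamma>\<in>G. h \<gamma> * mon \<gamma>)"
    using insert.hyps by (simp add: h'_def)
  also have "\<dots> = f" by (simp only: h(1)[symmetric]) (simp add: r_def mult.commute)
  finally have "f = (\<Sum>\<gamma>\<in>insert \<beta> G. h' \<gamma> * mon \<gamma>)" ..
  moreover have "\<forall>\<gamma>\<in>insert \<beta> G. cf f \<gamma> = 0 \<longrightarrow> cf (h' \<gamma>) 0 = 0"
    using h(2) by (auto simp: h'_def r cf_mono_quot)
  ultimately show ?case by blast
qed

subsection \<open>Automorphisms and the chain rule\<close>

lemma cps_aut_one: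
  assumes "cps_aut \<Phi>"
  shows "\<Phi> 1 = 1"
proof -
  obtain x where "\<Phi> x = 1"
    using bij_is_surj[OF cps_aut_bij[OF assms]] unfolding surj_def by metis
  then show ?thesis using cps_aut_mult[OF assms, of 1 x] by simp
qed

lemma cps_aut_linear: "cps_aut \<Phi> \<Longrightarrow> cps_linear \<Phi>"
  by (simp add: cps_linear_def cps_aut_add cps_aut_cst_mult)

lemma cps_aut_inv_apply:
  assumes "cps_aut \<Phi>"
  shows "inv \<Phi> (\<Phi> x) = x" "\<Phi> (inv \<Phi> x) = x"
  using cps_aut_bij[OF assms] by (auto simp: bij_def inv_f_f surj_f_inv_f)

lemma cps_aut_inv:
  assumes "cps_aut \<Phi>"
  shows "cps_aut (inv \<Phi>)"
proof -
  note i = cps_aut_inv_apply[OF assms]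
  have inj: "x = y" if "\<Phi> x = \<Phi> y" for x y using that i(1) by metis
  show ?thesis
    unfolding cps_aut_def
  proof (intro conjI allI)
    show "bij (inv \<Phi>)" by (rule bij_imp_bij_inv[OF cps_aut_bij[OF assms]])
    show "inv \<Phi> (f + g) = inv \<Phi> f + inv \<Phi> g" for f g
      by (rule inj) (simp add: i(2) cps_aut_add[OF assms])
    show "inv \<Phi> (f * g) = inv \<Phi> f * inv \<Phi> g" for f g
      by (rule inj) (simp add: i(2) cps_aut_mult[OF assms])
    show "inv \<Phi> (cst c * f) = cst c * inv \<Phi> f" for c f
      by (rule inj) (simp add: i(2) cps_aut_cst_mult[OF assms])
  qed
qed

lemma cps_aut_comp:
  assumes "cps_aut \<Phi>" "cps_aut \<Psi>"
  shows "cps_aut (\<lambda>f. \<Phi> (\<Psi> f))"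
  unfolding cps_aut_def
proof (intro conjI allI)
  show "bij (\<lambda>f. \<Phi> (\<Psi> f))"
    using bij_comp[OF cps_aut_bij[OF assms(2)] cps_aut_bij[OF assms(1)]] by (simp add: comp_def)
  show "\<Phi> (\<Psi> (f + g)) = \<Phi> (\<Psi> f) + \<Phi> (\<Psi> g)" for f g
    by (simp only: assms[THEN cps_aut_add])
  show "\<Phi> (\<Psi> (f * g)) = \<Phi> (\<Psi> f) * \<Phi> (\<Psi> g)" for f g
    by (simp only: assms[THEN cps_aut_mult])
  show "\<Phi> (\<Psi> (cst c * f)) = cst c * \<Phi> (\<Psi> f)" for c f
    by (simp only: assms[THEN cps_aut_cst_mult])
qed

text \<open>Automorphisms and their inverses preserve units, and a series with nonzero constant term
  is a unit.\<close>

lemma cps_aut_const_zero: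
  assumes "cps_aut \<Phi>" "cf f 0 = 0"
  shows "cf (\<Phi> f) 0 = 0"
proof (rule ccontr)
  assume "cf (\<Phi> f) 0 \<noteq> 0"
  from cps_unit[OF this] obtain v where "\<Phi> f * v = 1" ..
  then have "\<Phi> (f * inv \<Phi> v) = \<Phi> 1"
    by (simp add: cps_aut_mult[OF assms(1)] cps_aut_one[OF assms(1)] cps_aut_inv_apply(2)[OF assms(1)])
  then have "f * inv \<Phi> v = 1" using cps_aut_inv_apply(1)[OF assms(1)] by metis
  then have "cf (f * inv \<Phi> v) 0 = cf (1 :: 'a cps) 0" by simp
  then show False using assms(2) by (simp add: cf_one)
qed

lemma cps_split_vars: "\<exists>h. f = cst (cf f 0) + (\<Sum>i\<in>UNIV. h i * var i)"
proof -
  have "supported (upset (range unit_mi)) (f - cst (cf f 0))"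
    unfolding supported_def upset_def
  proof (intro allI impI CollectI)
    fix \<alpha> assume "cf (f - cst (cf f 0)) \<alpha> \<noteq> 0"
    then have "\<alpha> \<noteq> 0" by (auto simp: cf_cterm)
    then show "\<exists>\<beta>\<in>range unit_mi. \<beta> \<le> \<alpha>" using mi_nonzero_ex by auto
  qed
  from supported_imp_mono_combination[OF _ this]
  obtain h where "f - cst (cf f 0) = (\<Sum>\<beta>\<in>range unit_mi. h \<beta> * mon \<beta>)" by auto
  also have "\<dots> = (\<Sum>i\<in>UNIV. h (unit_mi i) * var i)"
    by (rule sum.reindex_cong[of unit_mi])
       (auto intro!: inj_onI, metis unit_mi_apply zero_neq_one)
  finally show ?thesis by (intro exI[of _ "\<lambda>i. h (unit_mi i)"]) (simp add: algebra_simps)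
qed

definition cps_derivation :: "('n::finite cps \<Rightarrow> 'n cps) \<Rightarrow> bool" where
  "cps_derivation D \<longleftrightarrow> cps_linear D \<and> (\<forall>f g. D (f * g) = D f * g + f * D g)"

lemma cps_derivation_cst:
  assumes "cps_derivation D"
  shows "D (cst c) = 0"
proof -
  have "D (1 * 1) = D 1 * 1 + 1 * D 1" using assms unfolding cps_derivation_def by blast
  then have "D 1 = 0" by simp
  moreover have "D (cst c * 1) = cst c * D 1"
    using assms unfolding cps_derivation_def by (intro cps_linear_cst) simp
  ultimately show ?thesis by simp
qed

text \<open>Writing \<open>f\<close> as a constant plus multiples \<open>h i * var i\<close> gives
  \<open>D f\<close> as the sum of the \<open>var i * D (h i)\<close>. Repeating this places
  \<open>D f\<close> in every power of the maximal ideal. No continuity of \<open>D\<close> is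
  assumed, so the result applies to conjugates by abstract automorphisms.\<close>

lemma cps_derivation_zero:
  assumes D: "cps_derivation D" and var: "\<And>i. D (var i) = 0"
  shows "D f = 0"
proof -
  have lin: "cps_linear D" and leib: "\<And>f g. D (f * g) = D f * g + f * D g"
    using D by (auto simp: cps_derivation_def)
  have "\<forall>\<alpha>. mdeg \<alpha> < N \<longrightarrow> cf (D f) \<alpha> = 0" for N f
  proof (induction N arbitrary: f)
    case (Suc N)
    obtain h where h: "f = cst (cf f 0) + (\<Sum>i\<in>UNIV. h i * var i)" using cps_split_vars by blast
    have "D f = (\<Sum>i\<in>UNIV. var i * D (h i))"
      by (subst h) (simp add: cps_linear_add[OF lin] cps_linear_sum[OF lin] cps_derivation_cst[OF D]
          leib var mult.commute)
    moreover have "cf (var i * D (h i)) \<alpha> = 0" if "mdeg \<alpha> < Suc N" for i \<alpha>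
    proof (cases "\<alpha> i = 0")
      case True
      then show ?thesis by (simp add: cf_cterm_mult)
    next
      case False
      then have "\<alpha> = (\<alpha> - unit_mi i) + unit_mi i" by simp
      then have "mdeg \<alpha> = mdeg (\<alpha> - unit_mi i) + 1" by (metis mdeg_add mdeg_unit)
      then have "mdeg (\<alpha> - unit_mi i) < N" using that by simp
      then have "cf (D (h i)) (\<alpha> - unit_mi i) = 0" using Suc[of "h i"] by blast
      then show ?thesis by (simp add: cf_cterm_mult )
    qed
    ultimately show ?case by simp
  qed simp
  then show ?thesis by (intro cps_eqI) (metis cf_zero lessI)
qed

lemma pd_var: "pd i (var j) = (if i = j then 1 else 0)"
proof (rule cps_eqI)
  fix \<alpha>
  have "\<alpha> + unit_mi i = unit_mi j \<longleftrightarrow> i = j \<and> \<alpha> = 0"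
  proof
    assume *: "\<alpha> + unit_mi i = unit_mi j"
    then have "(\<alpha> + unit_mi i) i = unit_mi j i" by simp
    then have "i = j" by (simp add: unit_mi_apply split: if_splits)
    then show "i = j \<and> \<alpha> = 0" using * by simp
  qed auto
  then show "cf (pd i (var j)) \<alpha> = cf (if i = j then 1 else 0) \<alpha>"
    by (auto simp: cf_pd cf_cterm cf_one)
qed

lemma cps_derivation_eq_vf:
  assumes "cps_derivation D"
  shows "D f = (\<Sum>i\<in>UNIV. D (var i) * pd i f)"
proof -
  define \<xi> where "\<xi> = (\<lambda>i. D (var i))"
  have der: "cps_derivation (\<lambda>f. D f - vf \<xi> f)"
    unfolding cps_derivation_def
  proof (intro conjI allI)
    have lin: "cps_linear D" using assms by (simp add: cps_derivation_def)
    show "cps_linear (\<lambda>f. D f - vf \<xi> f)"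
      unfolding cps_linear_def cps_linear_add[OF lin] cps_linear_cst[OF lin] cps_linear_add[OF cps_linear_vf]
          cps_linear_cst[OF cps_linear_vf]
      by (simp add: right_diff_distrib)
    have leib: "D (f * g) = D f * g + f * D g" for f g using assms by (simp add: cps_derivation_def)
    show "D (f * g) - vf \<xi> (f * g) = (D f - vf \<xi> f) * g + f * (D g - vf \<xi> g)" for f g
      unfolding leib vf_mult by (simp add: algebra_simps)
  qed
  have v: "vf \<xi> (var j) = \<xi> j" for j
  proof -
    have "vf \<xi> (var j) = (\<Sum>i\<in>UNIV. if i = j then \<xi> j else 0)"
      unfolding vf_def by (intro sum.cong refl) (simp add: pd_var)
    then show ?thesis by simp
  qed
  have "D (var j) - vf \<xi> (var j) = 0" for j unfolding v by (simp add: \<xi>_def)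
  from cps_derivation_zero[OF der this] have "D f - vf \<xi> f = 0" .
  then have "D f = vf \<xi> f" by simp
  then show ?thesis by (simp only: vf_def \<xi>_def)
qed

interpretation cps_module: module "(*) :: 'n::finite cps \<Rightarrow> 'n cps \<Rightarrow> 'n cps"
  by unfold_locales (simp_all add: algebra_simps)

text \<open>As a simplification rule this would undo \<open>mult.assoc\<close>.\<close>

declare cps_module.scale_scale [simp del]

abbreviation ideal_span :: "'n::finite cps set \<Rightarrow> 'n cps set" where
  "ideal_span \<equiv> cps_module.span"

definition Jac :: "'n::finite cps \<Rightarrow> 'n cps set" where
  "Jac f = ideal_span (insert f (range (\<lambda>i. pd i f)))"

lemma cps_aut_image_span_subset:
  assumes "cps_aut \<Phi>"
  shows "\<Phi> ` ideal_span S \<subseteq> ideal_span (\<Phi> ` S)"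
proof clarify
  fix x assume "x \<in> ideal_span S"
  then show "\<Phi> x \<in> ideal_span (\<Phi> ` S)"
  proof (induction rule: cps_module.span_induct_alt)
    case base
    show ?case using cps_linear_0[OF cps_aut_linear[OF assms]] by (simp add: cps_module.span_zero)
  next
    case (step c x y)
    then show ?case
      by (simp add: cps_aut_add[OF assms] cps_aut_mult[OF assms] cps_module.span_add
          cps_module.span_scale cps_module.span_base)
  qed
qed

lemma cps_aut_image_span:
  assumes "cps_aut \<Phi>"
  shows "\<Phi> ` ideal_span S = ideal_span (\<Phi> ` S)"
proof
  show "\<Phi> ` ideal_span S \<subseteq> ideal_span (\<Phi> ` S)" by (rule cps_aut_image_span_subset[OF assms])
  have "inv \<Phi> ` ideal_span (\<Phi> ` S) \<subseteq> ideal_span (inv \<Phi> ` \<Phi> ` S)"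
    by (rule cps_aut_image_span_subset[OF cps_aut_inv[OF assms]])
  also have "inv \<Phi> ` \<Phi> ` S = S" by (simp add: image_image cps_aut_inv_apply[OF assms])
  finally have "\<Phi> ` inv \<Phi> ` ideal_span (\<Phi> ` S) \<subseteq> \<Phi> ` ideal_span S" by (rule image_mono)
  then show "ideal_span (\<Phi> ` S) \<subseteq> \<Phi> ` ideal_span S"
    by (simp add: image_image cps_aut_inv_apply[OF assms])
qed

text \<open>The chain rule without substitution: conjugating \<open>pd i\<close> by
  \<open>\<Phi>\<close> gives a derivation, hence a combination of the partial derivatives with its
  values on the variables as coefficients.\<close>

lemma Jac_aut_subset:
  assumes "cps_aut \<Phi>"
  shows "Jac (\<Phi> f) \<subseteq> \<Phi> ` Jac f"
proof -
  have "pd i (\<Phi> f) \<in> \<Phi> ` Jac f" for i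
  proof -
    define D where "D = (\<lambda>g. inv \<Phi> (pd i (\<Phi> g)))"
    have aut': "cps_aut (inv \<Phi>)" by (rule cps_aut_inv[OF assms])
    have "cps_derivation D"
      unfolding cps_derivation_def
    proof (intro conjI allI)
      show "cps_linear D"
        unfolding D_def
        by (rule cps_linear_comp[OF cps_aut_linear[OF aut']
              cps_linear_comp[OF cps_linear_pd cps_aut_linear[OF assms]]])
      show "D (g * h) = D g * h + g * D h" for g h
        by (simp add: D_def cps_aut_mult[OF assms] pd_mult cps_aut_add[OF aut'] cps_aut_mult[OF aut']
            cps_aut_inv_apply[OF assms])
    qed
    from cps_derivation_eq_vf[OF this, of f] have eq: "D f = (\<Sum>i\<in>UNIV. D (var i) * pd i f)" .
    have "D f \<in> Jac f"
      unfolding Jac_def eq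
      by (rule cps_module.span_sum, rule cps_module.span_scale, rule cps_module.span_base) simp
    then have "\<Phi> (D f) \<in> \<Phi> ` Jac f" by (rule imageI)
    then show ?thesis by (simp add: D_def cps_aut_inv_apply[OF assms])
  qed
  moreover have "\<Phi> f \<in> \<Phi> ` Jac f" unfolding Jac_def by (intro imageI cps_module.span_base) simp
  ultimately have "insert (\<Phi> f) (range (\<lambda>i. pd i (\<Phi> f))) \<subseteq> \<Phi> ` Jac f"
    by (simp add: image_subset_iff)
  moreover have "cps_module.subspace (\<Phi> ` Jac f)"
    unfolding Jac_def cps_aut_image_span[OF assms] by (rule cps_module.subspace_span)
  ultimately show ?thesis
    unfolding Jac_def[of "\<Phi> f"] by (rule cps_module.span_minimal)
qed

lemma Jac_aut:
  assumes "cps_aut \<Phi>"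
  shows "Jac (\<Phi> f) = \<Phi> ` Jac f"
proof
  show "Jac (\<Phi> f) \<subseteq> \<Phi> ` Jac f" by (rule Jac_aut_subset[OF assms])
  have "\<Phi> ` Jac (inv \<Phi> (\<Phi> f)) \<subseteq> \<Phi> ` inv \<Phi> ` Jac (\<Phi> f)"
    by (intro image_mono Jac_aut_subset cps_aut_inv assms)
  then show "\<Phi> ` Jac f \<subseteq> Jac (\<Phi> f)"
    by (simp add: image_image cps_aut_inv_apply[OF assms])
qed

subsection \<open>Nakayama's lemma\<close>

text \<open>Eliminate one \<open>e a\<close> at a time: \<open>1 - \<mu> a\<close> is a unit, and
  substituting the solved relation into the others keeps all coefficients zero at the
  origin.\<close>

lemma nakayama:
  assumes "finite S" "cps_module.subspace J"
    and "\<And>s. s \<in> S \<Longrightarrow> \<exists>x\<in>J. \<exists>\<mu>. (\<forall>u\<in>S. cf (\<mu> u) 0 = 0) \<and> e s = x + (\<Sum>u\<in>S. \<mu> u * e u)"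
  shows "\<forall>s\<in>S. e s \<in> J"
  using assms(1,3)
proof (induction S)
  case (insert a S)
  note J = cps_module.subspace_add[OF assms(2)] cps_module.subspace_scale[OF assms(2)]
    cps_module.subspace_sum[OF assms(2)]
  obtain x \<mu> where x: "x \<in> J" "\<And>u. u \<in> insert a S \<Longrightarrow> cf (\<mu> u) 0 = 0"
    "e a = x + (\<Sum>u\<in>insert a S. \<mu> u * e u)" using insert.prems[OF insertI1] by blast
  obtain v where v: "(1 - \<mu> a) * v = 1" using cps_geometric_inverse[of "\<mu> a"] x(2) by auto
  have eq: "(1 - \<mu> a) * e a = x + (\<Sum>u\<in>S. \<mu> u * e u)"
  proof -
    have s: "(\<Sum>u\<in>insert a S. \<mu> u * e u) = \<mu> a * e a + (\<Sum>u\<in>S. \<mu> u * e u)"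
      using insert.hyps by simp
    have "e a = (x + (\<Sum>u\<in>S. \<mu> u * e u)) + \<mu> a * e a"
      by (rule trans[OF x(3)]) (simp add: s)
    then have *: "e a - \<mu> a * e a = x + (\<Sum>u\<in>S. \<mu> u * e u)"
      unfolding diff_eq_eq .
    have "(1 - \<mu> a) * e a = e a - \<mu> a * e a" by (simp add: left_diff_distrib)
    then show ?thesis using * by (rule trans)
  qed
  have "e a = ((1 - \<mu> a) * v) * e a" by (simp only: v mult_1)
  also have "\<dots> = v * ((1 - \<mu> a) * e a)"
    unfolding mult.commute[of "1 - \<mu> a" v] by (rule mult.assoc)
  also have "\<dots> = v * x + (\<Sum>u\<in>S. (v * \<mu> u) * e u)"
    by (subst eq) (simp add: distrib_left sum_distrib_left mult.assoc)
  finally have ea: "e a = v * x + (\<Sum>u\<in>S. (v * \<mu> u) * e u)" .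
  have "\<forall>s\<in>S. e s \<in> J"
  proof (rule insert.IH)
    fix s assume s: "s \<in> S"
    obtain y \<nu> where y: "y \<in> J" "\<And>u. u \<in> insert a S \<Longrightarrow> cf (\<nu> u) 0 = 0"
      "e s = y + (\<Sum>u\<in>insert a S. \<nu> u * e u)" using insert.prems[OF insertI2[OF s]] by blast
    have "e s = (y + \<nu> a * (v * x)) + (\<Sum>u\<in>S. (\<nu> u + \<nu> a * (v * \<mu> u)) * e u)"
    proof -
      have "(\<Sum>u\<in>insert a S. \<nu> u * e u) = \<nu> a * e a + (\<Sum>u\<in>S. \<nu> u * e u)"
        using insert.hyps by simp
      then have "e s = y + \<nu> a * e a + (\<Sum>u\<in>S. \<nu> u * e u)" by (simp only: y(3) add.assoc)
      also have "\<dots> = y + \<nu> a * (v * x + (\<Sum>u\<in>S. (v * \<mu> u) * e u)) + (\<Sum>u\<in>S. \<nu> u * e u)"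
        by (subst ea) (rule refl)
      also have "\<dots> = (y + \<nu> a * (v * x)) + ((\<Sum>u\<in>S. \<nu> a * ((v * \<mu> u) * e u)) + (\<Sum>u\<in>S. \<nu> u * e u))"
        by (simp only: distrib_left sum_distrib_left add.assoc)
      also have "\<dots> = (y + \<nu> a * (v * x)) + (\<Sum>u\<in>S. (\<nu> u + \<nu> a * (v * \<mu> u)) * e u)"
        by (simp only: sum.distrib[symmetric]) (simp add: distrib_right mult.assoc add.commute)
      finally show ?thesis .
    qed
    moreover have "y + \<nu> a * (v * x) \<in> J" by (rule J(1)[OF y(1) J(2)[OF J(2)[OF x(1)]]])
    moreover have "\<forall>u\<in>S. cf (\<nu> u + \<nu> a * (v * \<mu> u)) 0 = 0" using y(2) by simp
    ultimately show "\<exists>x\<in>J. \<exists>\<mu>. (\<forall>u\<in>S. cf (\<mu> u) 0 = 0) \<and> e s = x + (\<Sum>u\<in>S. \<mu> u * e u)"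
      by (intro bexI[of _ "y + \<nu> a * (v * x)"] exI[of _ "\<lambda>u. \<nu> u + \<nu> a * (v * \<mu> u)"] conjI)
  qed
  moreover from this have "e a \<in> J"
    unfolding ea by (intro J(1)[OF J(2)[OF x(1)]] J(3) J(2)) simp
  ultimately show ?case by auto
qed simp

subsection \<open>Monomial Jacobian ideals\<close>

text \<open>Coefficients are indexed by \<open>i\<close> and not by elements, since different
  partial derivatives may coincide.\<close>

lemma span_range_imp_combination:
  assumes "x \<in> ideal_span (range (F :: 'm::finite \<Rightarrow> 'n::finite cps))"
  shows "\<exists>c. x = (\<Sum>i\<in>UNIV. c i * F i)"
  using assms
proof (induction rule: cps_module.span_induct_alt)
  case base
  show ?case by (rule exI[of _ "\<lambda>_. 0"]) simp
next
  case (step k x y)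
  then obtain i c where x: "x = F i" and y: "y = (\<Sum>j\<in>UNIV. c j * F j)" by blast
  have "k * F i = (\<Sum>j\<in>UNIV. if j = i then k * F j else 0)" by simp
  then have "k * x + y = (\<Sum>j\<in>UNIV. (if j = i then k * F j else 0) + c j * F j)"
    unfolding x y sum.distrib by simp
  also have "\<dots> = (\<Sum>j\<in>UNIV. ((if j = i then k else 0) + c j) * F j)"
    by (intro sum.cong refl) (simp add: distrib_right)
  finally show ?case by (rule exI[of _ "\<lambda>j. (if j = i then k else 0) + c j"])
qed

definition min_gens :: "('n \<Rightarrow> nat) set \<Rightarrow> ('n \<Rightarrow> nat) set" where
  "min_gens M = {\<beta> \<in> M. \<forall>\<gamma>\<in>M. \<gamma> \<le> \<beta> \<longrightarrow> \<gamma> = \<beta>}"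

lemma min_gens_le:
  assumes "\<alpha> \<in> upset (M :: ('n::finite \<Rightarrow> nat) set)"
  obtains \<gamma> where "\<gamma> \<in> min_gens M" "\<gamma> \<le> \<alpha>"
proof -
  obtain \<beta> where "\<beta> \<in> M \<and> \<beta> \<le> \<alpha>" using assms by (auto simp: upset_def)
  from ex_has_least_nat[of "\<lambda>\<beta>. \<beta> \<in> M \<and> \<beta> \<le> \<alpha>", OF this, of mdeg]
  obtain \<gamma> where \<gamma>: "\<gamma> \<in> M" "\<gamma> \<le> \<alpha>" "\<And>\<delta>. \<delta> \<in> M \<Longrightarrow> \<delta> \<le> \<alpha> \<Longrightarrow> mdeg \<gamma> \<le> mdeg \<delta>" by blast
  have "\<delta> = \<gamma>" if "\<delta> \<in> M" "\<delta> \<le> \<gamma>" for \<delta>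
    by (rule mdeg_le_imp_eq[OF that(2) \<gamma>(3)[OF that(1) order_trans[OF that(2) \<gamma>(2)]]])
  then have "\<gamma> \<in> min_gens M" using \<gamma>(1) by (simp add: min_gens_def)
  then show ?thesis using \<gamma>(2) by (rule that)
qed

lemma min_gens_antichain: "\<beta> \<in> min_gens M \<Longrightarrow> \<gamma> \<in> min_gens M \<Longrightarrow> \<gamma> \<le> \<beta> \<Longrightarrow> \<gamma> = \<beta>"
  by (simp add: min_gens_def)

lemma min_gens_minimal:
  assumes "\<beta> \<in> min_gens M" "\<alpha> \<in> upset M" "\<alpha> \<le> \<beta>"
  shows "\<alpha> = \<beta>"
proof -
  obtain \<gamma> where \<gamma>: "\<gamma> \<in> M" "\<gamma> \<le> \<alpha>" using assms(2) by (auto simp: upset_def)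
  then have "\<gamma> = \<beta>" using assms order_trans[OF \<gamma>(2) assms(3)] by (simp add: min_gens_def)
  then show ?thesis using \<gamma>(2) assms(3) by (simp add: order_antisym)
qed

lemma supported_upset_min_gens: "supported (upset M) f \<Longrightarrow> supported (upset (min_gens M)) f"
  unfolding supported_def by (metis (mono_tags, lifting) mem_Collect_eq min_gens_le upset_def)

lemma span_mono_supported:
  assumes "x \<in> ideal_span (mon ` M)"
  shows "supported (upset M) x"
  using assms
proof (induction rule: cps_module.span_induct_alt)
  case base
  show ?case by (rule supported_0)
next
  case (step c x y)
  have "supported (upset M) x" using step(1) by (auto simp: supported_def upset_def cf_cterm split: if_splits)
  then show ?case by (intro supported_add supported_mult step)
qed

text \<open>No exponent in the up-set lies strictly below a minimal one, so only the constant term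
  of \<open>c\<close> contributes. Reading coefficients at the minimal generators thus kills the
  maximal ideal times the monomial ideal.\<close>

lemma cf_mult_min_gens:
  assumes "supported (upset M) x" "\<beta> \<in> min_gens M"
  shows "cf (c * x) \<beta> = cf c 0 * cf x \<beta>"
proof -
  have zero: "cf c \<gamma> * cf x \<delta> = 0" if "(\<gamma>, \<delta>) \<in> splits \<beta> - {(0, \<beta>)}" for \<gamma> \<delta>
  proof (rule ccontr)
    assume "cf c \<gamma> * cf x \<delta> \<noteq> 0"
    then have "\<delta> \<in> upset M" using supportedD[OF assms(1)] by simp
    moreover have sp: "\<gamma> + \<delta> = \<beta>" "\<not> (\<gamma> = 0 \<and> \<delta> = \<beta>)" using that by (auto simp: splits_def)
    moreover have "\<delta> \<le> \<beta>" using sp(1) by auto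
    ultimately have "\<delta> = \<beta>" using min_gens_minimal[OF assms(2)] by blast
    then show False using sp by simp
  qed
  have "cf (c * x) \<beta> = (\<Sum>(\<gamma>, \<delta>)\<in>{(0, \<beta>)}. cf c \<gamma> * cf x \<delta>)"
    unfolding cf_mult
  proof (rule sum.mono_neutral_right)
    show "{(0, \<beta>)} \<subseteq> splits \<beta>" by (simp add: splits_def)
    show "\<forall>p\<in>splits \<beta> - {(0, \<beta>)}. (case p of (\<gamma>, \<delta>) \<Rightarrow> cf c \<gamma> * cf x \<delta>) = 0"
      using zero by (metis (mono_tags, lifting) case_prodE' case_prod_conv surj_pair)
  qed simp
  then show ?thesis by simp
qed

lemma supported_imp_in_subspace:
  assumes "supported (upset M) x" "finite (min_gens M)" "cps_module.subspace J"
    and "\<And>\<beta>. \<beta> \<in> min_gens M \<Longrightarrow> mon \<beta> \<in> J"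
  shows "x \<in> J"
proof -
  obtain h where "x = (\<Sum>\<beta>\<in>min_gens M. h \<beta> * mon \<beta>)"
    using supported_imp_mono_combination[OF assms(2) supported_upset_min_gens[OF assms(1)]] by blast
  then show ?thesis
    using assms(3,4) by (simp add: cps_module.subspace_sum cps_module.subspace_scale)
qed

lemma mono_in_span_pd:
  assumes fin: "finite (min_gens M)"
    and supp: "\<And>j. supported (upset M) (pd j g)"
    and inv: "left_inv (min_gens M) (\<lambda>j \<beta>. cf (pd j g) \<beta>)"
  shows "\<forall>\<beta>\<in>min_gens M. mon \<beta> \<in> ideal_span (range (\<lambda>j. pd j g))"
proof (rule nakayama[OF fin cps_module.subspace_span])
  obtain C where C: "\<And>\<beta> \<gamma>. \<beta> \<in> min_gens M \<Longrightarrow> \<gamma> \<in> min_gens M \<Longrightarrow>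
      (\<Sum>j\<in>UNIV. C \<beta> j * cf (pd j g) \<gamma>) = (if \<beta> = \<gamma> then 1 else 0)"
    using inv unfolding left_inv_def by blast
  fix \<beta> assume \<beta>: "\<beta> \<in> min_gens M"
  \<comment> \<open>By the choice of \<open>C\<close>, \<open>x\<close> agrees with
    \<open>mon \<beta>\<close> at all minimal generators. So the difference lies in the maximal
    ideal times the monomial ideal, which is the relation for Nakayama.\<close>
  define x where "x = (\<Sum>j\<in>UNIV. cst (C \<beta> j) * pd j g)"
  have x: "x \<in> ideal_span (range (\<lambda>j. pd j g))"
    unfolding x_def by (rule cps_module.span_sum, rule cps_module.span_scale, rule cps_module.span_base) simp
  have "supported (upset M) (mon \<beta>)"
    using \<beta> by (auto simp: supported_def upset_def cf_cterm min_gens_def split: if_splits)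
  moreover have "supported (upset M) x"
    unfolding x_def by (intro supported_sum supported_mult supp)
  ultimately have "supported (upset (min_gens M)) (mon \<beta> - x)"
    by (intro supported_upset_min_gens supported_diff)
  from supported_imp_mono_combination[OF fin this] obtain \<mu> where
    \<mu>: "mon \<beta> - x = (\<Sum>\<gamma>\<in>min_gens M. \<mu> \<gamma> * mon \<gamma>)"
       "\<forall>\<gamma>\<in>min_gens M. cf (mon \<beta> - x) \<gamma> = 0 \<longrightarrow> cf (\<mu> \<gamma>) 0 = 0" by blast
  have "cf (mon \<beta> - x) \<gamma> = 0" if "\<gamma> \<in> min_gens M" for \<gamma>
    using C[OF \<beta> that] by (auto simp: x_def cf_cterm)
  then have "\<forall>\<gamma>\<in>min_gens M. cf (\<mu> \<gamma>) 0 = 0" using \<mu>(2) by blast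
  moreover have "mon \<beta> = x + (\<Sum>\<gamma>\<in>min_gens M. \<mu> \<gamma> * mon \<gamma>)" using \<mu>(1) by (simp add: algebra_simps)
  ultimately show "\<exists>x\<in>ideal_span (range (\<lambda>j. pd j g)). \<exists>\<mu>. (\<forall>u\<in>min_gens M. cf (\<mu> u) 0 = 0) \<and>
      mon \<beta> = x + (\<Sum>u\<in>min_gens M. \<mu> u * mon u)"
    using x by blast
qed

text \<open>The partial derivatives of \<open>g\<close> span the monomial ideal. As no minimal
  generator occurs in \<open>h\<close>, its coefficients with respect to them can be chosen zero at
  the origin; the derivatives of \<open>h\<close> give the matrix of the homotopy field.\<close>

lemma local_triviality_monomial:
  assumes fin: "finite (min_gens M)"
    and supp: "\<And>j. supported (upset M) (pd j g)"
    and inv: "left_inv (min_gens M) (\<lambda>j \<beta>. cf (pd j g) \<beta>)"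
    and supp_h: "supported (upset M) h" "\<And>\<beta>. \<beta> \<in> min_gens M \<Longrightarrow> cf h \<beta> = 0"
    and supp_pd_h: "\<And>j. supported (upset M) (pd j h)"
  obtains \<epsilon> where "0 < \<epsilon>" "\<And>t. norm t < \<epsilon> \<Longrightarrow> \<exists>\<Phi>. cps_aut \<Phi> \<and> \<Phi> (g + cst t * h) = g"
proof -
  let ?J = "ideal_span (range (\<lambda>j. pd j g))"
  have mon_J: "mon \<beta> \<in> ?J" if "\<beta> \<in> min_gens M" for \<beta>
    using mono_in_span_pd[OF fin supp inv] that by blast
  have "\<forall>\<beta>\<in>min_gens M. \<exists>c. mon \<beta> = (\<Sum>i\<in>UNIV. c i * pd i g)"
    using span_range_imp_combination mon_J by blast
  then obtain b where b: "\<And>\<beta>. \<beta> \<in> min_gens M \<Longrightarrow> mon \<beta> = (\<Sum>i\<in>UNIV. b \<beta> i * pd i g)"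
    using bchoice[of "min_gens M" "\<lambda>\<beta> c. mon \<beta> = (\<Sum>i\<in>UNIV. c i * pd i g)"] by blast
  obtain \<mu> where \<mu>: "h = (\<Sum>\<beta>\<in>min_gens M. \<mu> \<beta> * mon \<beta>)" "\<And>\<beta>. \<beta> \<in> min_gens M \<Longrightarrow> cf (\<mu> \<beta>) 0 = 0"
    using supported_imp_mono_combination[OF fin supported_upset_min_gens[OF supp_h(1)]] supp_h(2) by blast
  define a where "a = (\<lambda>i. \<Sum>\<beta>\<in>min_gens M. \<mu> \<beta> * b \<beta> i)"
  have "h = (\<Sum>\<beta>\<in>min_gens M. \<Sum>i\<in>UNIV. \<mu> \<beta> * b \<beta> i * pd i g)"
    unfolding \<mu>(1) by (intro sum.cong refl) (simp add: b sum_distrib_left mult.assoc)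
  also have "\<dots> = (\<Sum>i\<in>UNIV. a i * pd i g)"
    unfolding a_def by (subst sum.swap) (simp add: sum_distrib_right)
  finally have h: "h = (\<Sum>i\<in>UNIV. a i * pd i g)" .
  have a0: "cf (a i) 0 = 0" for i using \<mu>(2) by (simp add: a_def)
  have "\<forall>i. \<exists>c. pd i h = (\<Sum>j\<in>UNIV. c j * pd j g)"
    using supported_imp_in_subspace[OF supp_pd_h fin cps_module.subspace_span mon_J]
      span_range_imp_combination by blast
  then obtain N where N: "\<And>i. pd i h = (\<Sum>j\<in>UNIV. N i j * pd j g)"
    using choice[of "\<lambda>i c. pd i h = (\<Sum>j\<in>UNIV. c j * pd j g)"] by blast
  show ?thesis by (rule local_triviality[OF h a0 N]) (rule that)
qed

section \<open>Right equivalence along a pencil\<close>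

definition cps_equiv :: "'n::finite cps \<Rightarrow> 'n cps \<Rightarrow> bool" where
  "cps_equiv f g \<longleftrightarrow> (\<exists>\<Phi>. cps_aut \<Phi> \<and> \<Phi> f = g)"

lemma cps_equiv_sym: "cps_equiv f g \<Longrightarrow> cps_equiv g f"
  unfolding cps_equiv_def using cps_aut_inv cps_aut_inv_apply(1) by blast

lemma cps_equiv_trans:
  assumes "cps_equiv f g" "cps_equiv g h"
  shows "cps_equiv f h"
proof -
  obtain \<Phi> \<Psi> where "cps_aut \<Phi>" "\<Phi> f = g" "cps_aut \<Psi>" "\<Psi> g = h"
    using assms unfolding cps_equiv_def by blast
  then show ?thesis
    unfolding cps_equiv_def using cps_aut_comp[of \<Psi> \<Phi>] by (intro exI[of _ "\<lambda>x. \<Psi> (\<Phi> x)"]) simp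
qed

lemma cps_equiv_of_pencil:
  fixes f g :: "'n::finite cps"
  assumes fin: "finite (min_gens M)" and inj: "inj_on \<iota> (min_gens M)"
    and f: "supported (upset M) f" "\<And>\<beta>. \<beta> \<in> min_gens M \<Longrightarrow> cf f \<beta> = 0" "\<And>j. supported (upset M) (pd j f)"
      "rows_indep (\<iota> ` min_gens M) (min_gens M) (\<lambda>j \<beta>. cf (pd j f) \<beta>)"
    and g: "supported (upset M) g" "\<And>\<beta>. \<beta> \<in> min_gens M \<Longrightarrow> cf g \<beta> = 0" "\<And>j. supported (upset M) (pd j g)"
      "rows_indep (\<iota> ` min_gens M) (min_gens M) (\<lambda>j \<beta>. cf (pd j g) \<beta>)"
  shows "cps_equiv f g"
proof -
  let ?G = "min_gens M"
  define h where "h = g - f"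
  have pd_h: "pd j h = pd j g - pd j f" for j
    by (rule cps_eqI) (simp add: cf_pd h_def algebra_simps)
  define N where "N = (\<lambda>t. padded (\<lambda>j \<beta>. cf (pd j f) \<beta> + t * cf (pd j h) \<beta>) ?G \<iota>)"
  \<comment> \<open>The minor is nonzero at \<open>t = 0\<close>, hence at all but finitely many
    \<open>t\<close>; at \<open>t = 1\<close> it is the minor of \<open>g\<close>.\<close>
  define Z where "Z = {t. det (N t) = 0}"
  have Z: "finite Z"
    unfolding Z_def N_def
    by (rule finite_det_padded_zero) (use f(4) det_padded_nz_iff[OF fin inj] in simp)
  have "N 0 = padded (\<lambda>j \<beta>. cf (pd j f) \<beta>) ?G \<iota>" "N 1 = padded (\<lambda>j \<beta>. cf (pd j g) \<beta>) ?G \<iota>"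
    by (simp_all add: N_def pd_h)
  then have Z01: "0 \<in> - Z" "1 \<in> - Z"
    using f(4) g(4) det_padded_nz_iff[OF fin inj] by (simp_all add: Z_def)
  have supp_h: "supported (upset M) h" "\<And>\<beta>. \<beta> \<in> ?G \<Longrightarrow> cf h \<beta> = 0" "\<And>j. supported (upset M) (pd j h)"
    using f g by (auto simp: h_def pd_h[unfolded h_def] intro: supported_diff)
  define F where "F = (\<lambda>t. f + cst t * h)"
  have pdF: "pd j (F t) = pd j f + cst t * pd j h" for j t by (simp add: F_def)
  have "connected (- Z)"
    by (intro path_connected_imp_connected path_connected_complement_countable countable_finite Z) simp
  then have "cps_equiv (F 0) (F 1)"
  \<comment> \<open>Local triviality makes the equivalence classes open in \<open>- Z\<close>, so
    connectedness leaves a single one.\<close>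
  proof (rule connected_equivalence_relation[of "- Z" 0 1 "\<lambda>s t. cps_equiv (F s) (F t)"])
    fix s assume s: "s \<in> - Z"
    obtain \<epsilon> where \<epsilon>: "0 < \<epsilon>" "\<And>t. norm t < \<epsilon> \<Longrightarrow> \<exists>\<Phi>. cps_aut \<Phi> \<and> \<Phi> (F s + cst t * h) = F s"
    proof (rule local_triviality_monomial[OF fin _ _ supp_h])
      show "supported (upset M) (pd j (F s))" for j
        unfolding pdF by (intro supported_add supported_mult f supp_h)
      have "left_inv ?G (\<lambda>j \<beta>. cf (pd j f) \<beta> + s * cf (pd j h) \<beta>)"
        using s by (intro det_padded_nz_imp_left_inv[OF fin inj]) (simp add: Z_def N_def)
      then show "left_inv ?G (\<lambda>j \<beta>. cf (pd j (F s)) \<beta>)" by (simp add: pdF)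
    qed (assumption, rule that)
    have "cps_equiv (F s) (F t)" if "t \<in> ball s \<epsilon>" for t
    proof -
      have "F s + cst (t - s) * h = F t"
        by (rule cps_eqI) (simp only: F_def cf_add cf_cst_mult, simp add: algebra_simps)
      moreover have "norm (t - s) < \<epsilon>" using that by (simp add: dist_norm norm_minus_commute)
      ultimately have "cps_equiv (F t) (F s)" using \<epsilon>(2)[of "t - s"] unfolding cps_equiv_def by simp
      then show ?thesis by (rule cps_equiv_sym)
    qed
    then show "\<exists>T. openin (top_of_set (- Z)) T \<and> s \<in> T \<and> (\<forall>t\<in>T. cps_equiv (F s) (F t))"
      using s \<epsilon>(1) by (intro exI[of _ "- Z \<inter> ball s \<epsilon>"]) (simp add: openin_open_Int)
  qed (use Z01 cps_equiv_sym cps_equiv_trans in blast)+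
  moreover have "F 0 = f" "F 1 = g" by (simp_all add: F_def h_def)
  ultimately show ?thesis by simp
qed

lemma pd_cterm: "pd i (cterm c \<beta>) = cterm (of_nat (\<beta> i) * c) (\<beta> - unit_mi i)"
proof (rule cps_eqI)
  fix \<alpha>
  show "cf (pd i (cterm c \<beta>)) \<alpha> = cf (cterm (of_nat (\<beta> i) * c) (\<beta> - unit_mi i)) \<alpha>"
  proof (cases "\<beta> i = 0")
    case True
    then have "\<alpha> + unit_mi i \<noteq> \<beta>" by auto
    then show ?thesis using True by (simp add: cf_pd cf_cterm)
  next
    case False
    then have eq: "(\<beta> - unit_mi i) + unit_mi i = \<beta>" by simp
    have "\<alpha> + unit_mi i = \<beta> \<longleftrightarrow> \<alpha> = \<beta> - unit_mi i"
    proof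
      assume "\<alpha> = \<beta> - unit_mi i" then show "\<alpha> + unit_mi i = \<beta>" using eq by (simp only:)
    qed auto
    moreover have "of_nat (\<alpha> i + 1) = (of_nat (\<beta> i) :: complex)" if "\<alpha> + unit_mi i = \<beta>" using that by auto
    ultimately show ?thesis by (simp only: cf_pd cf_cterm) simp
  qed
qed

theorem monomial_Jac_imp_thom_sebastiani:
  fixes f :: "'n::finite cps"
  assumes J: "Jac f = ideal_span (mon ` M)" and f0: "f \<noteq> 0" "cf f 0 = 0"
  obtains g where "thom_sebastiani (cf g)" "cps_equiv f g"
proof -
  let ?G = "min_gens M"
  have gen: "f \<in> Jac f" "\<And>j. pd j f \<in> Jac f"
    unfolding Jac_def by (auto intro: cps_module.span_base)
  have supp_f: "supported (upset M) f" "\<And>j. supported (upset M) (pd j f)"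
    using gen unfolding J by (auto intro: span_mono_supported)
  \<comment> \<open>In characteristic zero the coefficient \<open>\<alpha> j\<close> acquired by
    differentiation does not vanish.\<close>
  have shadow: "\<alpha> - unit_mi j \<in> upset M" if "cf f \<alpha> \<noteq> 0" "\<alpha> j \<noteq> 0" for \<alpha> j
  proof -
    have "(\<alpha> - unit_mi j) + unit_mi j = \<alpha>" using that(2) by simp
    then have "cf (pd j f) (\<alpha> - unit_mi j) \<noteq> 0" using that(1) unfolding cf_pd by (simp del: of_nat_Suc of_nat_add)
    then show ?thesis by (rule supportedD[OF supp_f(2)])
  qed
  have not_eq: "\<alpha> - unit_mi j \<noteq> \<alpha>" if "\<alpha> j \<noteq> 0" for \<alpha> :: "'n \<Rightarrow> nat" and j
  proof
    assume "\<alpha> - unit_mi j = \<alpha>"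
    then have "(\<alpha> - unit_mi j) j = \<alpha> j" by (simp only:)
    then show False using that by simp
  qed
  have diff_le: "\<alpha> - unit_mi j \<le> \<alpha>" for \<alpha> :: "'n \<Rightarrow> nat" and j
    by (simp add: mi_le_iff)
  \<comment> \<open>A monomial of \<open>f\<close> is not constant, and lowering it stays in the
    up-set, contrary to minimality.\<close>
  have avoid_f: "cf f \<beta> = 0" if \<beta>: "\<beta> \<in> ?G" for \<beta>
  proof (rule ccontr)
    assume nz: "cf f \<beta> \<noteq> 0"
    then have "\<beta> \<noteq> 0" using f0(2) by metis
    then obtain j where j: "\<beta> j \<noteq> 0" using mi_nonzero_ex by blast
    show False using min_gens_minimal[OF \<beta> shadow[OF nz j] diff_le] not_eq[of \<beta> j] j by simp
  qed
  have mono_J: "mon \<beta> \<in> Jac f" if "\<beta> \<in> ?G" for \<beta>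
    using that unfolding J min_gens_def by (intro cps_module.span_base) simp
  \<comment> \<open>In a representation of \<open>mon \<beta>\<close> the multiple of
    \<open>f\<close> does not contribute at minimal generators, by \<open>avoid_f\<close>. The
    constant terms of the coefficients of the partial derivatives form the left inverse.\<close>
  have inv: "left_inv ?G (\<lambda>j \<beta>. cf (pd j f) \<beta>)"
  proof -
    have "\<exists>c. \<forall>\<gamma>\<in>?G. (\<Sum>j\<in>UNIV. c j * cf (pd j f) \<gamma>) = (if \<beta> = \<gamma> then 1 else 0)" if \<beta>: "\<beta> \<in> ?G" for \<beta>
    proof -
      obtain k where "mon \<beta> - k * f \<in> ideal_span (range (\<lambda>j. pd j f))"
        using mono_J[OF \<beta>] unfolding Jac_def cps_module.span_breakdown_eq by blast
      then obtain c where "mon \<beta> - k * f = (\<Sum>j\<in>UNIV. c j * pd j f)"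
        using span_range_imp_combination by blast
      then have c: "mon \<beta> = k * f + (\<Sum>j\<in>UNIV. c j * pd j f)" by (simp add: algebra_simps)
      have "(\<Sum>j\<in>UNIV. cf (c j) 0 * cf (pd j f) \<gamma>) = (if \<beta> = \<gamma> then 1 else 0)" if \<gamma>: "\<gamma> \<in> ?G" for \<gamma>
      proof -
        have "cf (mon \<beta>) \<gamma> = cf (k * f) \<gamma> + (\<Sum>j\<in>UNIV. cf (c j * pd j f) \<gamma>)"
          by (subst c) simp
        then show ?thesis
          unfolding cf_mult_min_gens[OF supp_f(1) \<gamma>] cf_mult_min_gens[OF supp_f(2) \<gamma>] avoid_f[OF \<gamma>]
          by (auto simp: cf_cterm)
      qed
      then show ?thesis by (intro exI[of _ "\<lambda>j. cf (c j) 0"]) blast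
    qed
    then have "\<forall>\<beta>\<in>?G. \<exists>c. \<forall>\<gamma>\<in>?G. (\<Sum>j\<in>UNIV. c j * cf (pd j f) \<gamma>) = (if \<beta> = \<gamma> then 1 else 0)"
      by blast
    from bchoice[OF this] show ?thesis unfolding left_inv_def by blast
  qed
  \<comment> \<open>Finiteness of the minimal generators comes from the linear independence of the
    columns.\<close>
  have fin: "finite ?G" by (rule left_inv_finite[OF inv])
  obtain \<iota>0 where \<iota>0: "inj_on \<iota>0 ?G" "\<And>\<beta>. \<beta> \<in> ?G \<Longrightarrow> cf (pd (\<iota>0 \<beta>) f) \<beta> \<noteq> 0"
    "rows_indep (\<iota>0 ` ?G) ?G (\<lambda>j \<beta>. cf (pd j f) \<beta>)"
    by (rule left_inv_representatives[OF inv]) (rule that)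
  interpret exchange_system ?G \<iota>0
  proof
    fix \<beta> j assume \<beta>: "\<beta> \<in> ?G" and j: "\<beta> j \<noteq> 0"
    have "cf f (\<beta> + unit_mi (\<iota>0 \<beta>)) \<noteq> 0" using \<iota>0(2)[OF \<beta>] by (simp add: cf_pd)
    from shadow[OF this, of j] j have "\<beta> + unit_mi (\<iota>0 \<beta>) - unit_mi j \<in> upset M" by simp
    then show "\<exists>\<gamma>\<in>?G. \<gamma> \<le> \<beta> + unit_mi (\<iota>0 \<beta>) - unit_mi j" by (rule min_gens_le) blast
  qed (use fin min_gens_antichain \<iota>0(1) in blast)+
  obtain \<iota> where \<iota>: "inj_on \<iota> ?G" "\<iota> ` ?G = \<iota>0 ` ?G"
    "\<And>\<beta> j. \<beta> \<in> ?G \<Longrightarrow> (\<beta> + unit_mi (\<iota> \<beta>)) j \<noteq> 0 \<Longrightarrow>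
      \<beta> + unit_mi (\<iota> \<beta>) - unit_mi j \<in> ?G \<and> \<iota> (\<beta> + unit_mi (\<iota> \<beta>) - unit_mi j) = j"
    by (rule exchange_disjoint) (rule that)
  \<comment> \<open>A set, because different generators may give the same product: for
    \<open>x y z\<close> all three generators of degree two give the monomial itself.\<close>
  define A where "A = (\<lambda>\<beta>. \<beta> + unit_mi (\<iota> \<beta>)) ` ?G"
  have finA: "finite A" using fin by (simp add: A_def)
  have A: "\<alpha> - unit_mi j \<in> ?G" "\<iota> (\<alpha> - unit_mi j) = j" if "\<alpha> \<in> A" "\<alpha> j \<noteq> 0" for \<alpha> j
    using \<iota>(3) that by (auto simp: A_def)
  \<comment> \<open>Lowering an element of \<open>A\<close> recovers a generator together with its
    \<open>\<iota>\<close>-value. So at the minimal generators the matrix of partial derivatives of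
    \<open>g\<close> has one nonzero entry per column.\<close>
  have mem_A: "\<beta> + unit_mi j \<in> A \<longleftrightarrow> \<beta> \<in> ?G \<and> \<iota> \<beta> = j" for \<beta> j
  proof
    assume "\<beta> + unit_mi j \<in> A"
    then show "\<beta> \<in> ?G \<and> \<iota> \<beta> = j" using A[of "\<beta> + unit_mi j" j] by simp
  qed (auto simp: A_def)
  define g where "g = (\<Sum>\<alpha>\<in>A. mon \<alpha>)"
  have cf_g: "cf g \<alpha> = (if \<alpha> \<in> A then 1 else 0)" for \<alpha>
    using finA by (simp add: g_def cf_cterm)
  have cf_pd_g: "cf (pd j g) \<beta> = (if \<beta> \<in> ?G \<and> \<iota> \<beta> = j then of_nat (\<beta> j + 1) else 0)" for j \<beta>
    unfolding cf_pd cf_g mem_A by simp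
  have GM: "\<beta> \<in> upset M" if "\<beta> \<in> ?G" for \<beta>
    using that by (auto simp: min_gens_def upset_def)
  have equiv: "cps_equiv f g"
  proof (rule cps_equiv_of_pencil[OF fin \<iota>(1) supp_f(1) avoid_f supp_f(2)])
    show "rows_indep (\<iota> ` ?G) ?G (\<lambda>j \<beta>. cf (pd j f) \<beta>)" unfolding \<iota>(2) by (rule \<iota>0(3))
    show "supported (upset M) g"
      unfolding supported_def
    proof (intro allI impI)
      fix \<alpha> assume "cf g \<alpha> \<noteq> 0"
      then have "\<alpha> \<in> A" by (simp add: cf_g split: if_splits)
      then obtain \<beta> where "\<beta> \<in> ?G" "\<alpha> = \<beta> + unit_mi (\<iota> \<beta>)" by (auto simp: A_def)
      then show "\<alpha> \<in> upset M" using upset_mono[OF GM, of \<beta> \<alpha>] by simp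
    qed
    show "cf g \<beta> = 0" if \<beta>: "\<beta> \<in> ?G" for \<beta>
    proof (rule ccontr)
      assume "cf g \<beta> \<noteq> 0"
      then have "\<beta> \<in> A" by (simp add: cf_g split: if_splits)
      then obtain \<gamma> where \<gamma>: "\<gamma> \<in> ?G" "\<beta> = \<gamma> + unit_mi (\<iota> \<gamma>)" by (auto simp: A_def)
      then have "\<gamma> = \<beta>" using min_gens_antichain[OF \<beta> \<gamma>(1)] by simp
      then show False using \<gamma>(2) by simp
    qed
    show "supported (upset M) (pd j g)" for j
      unfolding supported_def cf_pd_g using GM by simp
    show "rows_indep (\<iota> ` ?G) ?G (\<lambda>j \<beta>. cf (pd j g) \<beta>)"
      unfolding rows_indep_def
    proof (intro allI impI ballI)
      fix c \<beta> assume c: "\<forall>j\<in>\<iota> ` ?G. (\<Sum>\<gamma>\<in>?G. cf (pd j g) \<gamma> * c \<gamma>) = 0" and \<beta>: "\<beta> \<in> ?G"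
      have "(\<Sum>\<gamma>\<in>?G. cf (pd (\<iota> \<beta>) g) \<gamma> * c \<gamma>) = (\<Sum>\<gamma>\<in>?G. if \<gamma> = \<beta> then of_nat (\<beta> (\<iota> \<beta>) + 1) * c \<beta> else 0)"
        using \<beta> inj_onD[OF \<iota>(1)] by (intro sum.cong refl) (auto simp: cf_pd_g)
      also have "\<dots> = of_nat (\<beta> (\<iota> \<beta>) + 1) * c \<beta>" using fin \<beta> by simp
      finally have "of_nat (\<beta> (\<iota> \<beta>) + 1) * c \<beta> = 0" using c \<beta> by simp
      then show "c \<beta> = 0" by (simp del: of_nat_Suc of_nat_add)
    qed
  qed
  obtain as where as: "set as = A" "distinct as" using finite_distinct_list[OF finA] by blast
  have "thom_sebastiani (cf g)"
    unfolding thom_sebastiani_def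
  proof (intro exI[of _ as] conjI allI impI)
    \<comment> \<open>A nonzero \<open>f\<close> has a monomial in the ideal, so there is a
      generator and the sum is not empty.\<close>
    obtain \<alpha> where "cf f \<alpha> \<noteq> 0" using f0(1) by (metis cps_eqI cf_zero)
    then have "\<alpha> \<in> upset M" by (rule supportedD[OF supp_f(1)])
    then have "?G \<noteq> {}" by (metis empty_iff min_gens_le)
    then show "as \<noteq> []" using as(1) by (auto simp: A_def)
    show "as ! j \<noteq> (\<lambda>i. 0)" if "j < length as" for j
    proof -
      have "as ! j \<in> A" using that as(1) nth_mem by blast
      then obtain \<beta> where "as ! j = \<beta> + unit_mi (\<iota> \<beta>)" by (auto simp: A_def)
      then have "(as ! j) (\<iota> \<beta>) \<noteq> 0" by simp
      then show ?thesis by metis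
    qed
    show "supp_mi (as ! j) \<inter> supp_mi (as ! k) = {}" if "j < length as" "k < length as" "j \<noteq> k" for j k
    proof (rule equals0I)
      fix i assume "i \<in> supp_mi (as ! j) \<inter> supp_mi (as ! k)"
      then have i: "(as ! j) i \<noteq> 0" "(as ! k) i \<noteq> 0" by (auto simp: supp_mi_def)
      have mem: "as ! j \<in> A" "as ! k \<in> A" using that as(1) nth_mem by blast+
      \<comment> \<open>Both lowered exponents are generators with \<open>\<iota>\<close>-value
        \<open>i\<close>, so injectivity identifies them.\<close>
      have "as ! j - unit_mi i = as ! k - unit_mi i"
        using A[OF mem(1) i(1)] A[OF mem(2) i(2)] inj_onD[OF \<iota>(1)] by metis
      then have "(as ! j - unit_mi i) + unit_mi i = (as ! k - unit_mi i) + unit_mi i" by (simp only:)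
      then have "as ! j = as ! k" using i by simp
      then show False using that as(2) nth_eq_iff_index_eq by blast
    qed
    show "cf g = (\<lambda>\<alpha>. \<Sum>j<length as. monom_ps (as ! j) \<alpha>)"
    proof
      fix \<alpha>
      have "cf g \<alpha> = (\<Sum>\<beta>\<in>set as. monom_ps \<beta> \<alpha>)"
        by (simp add: g_def cf_cterm as(1) monom_ps_def)
      also have "\<dots> = (\<Sum>j<length as. monom_ps (as ! j) \<alpha>)"
        by (rule sum.reindex_bij_betw[symmetric, OF bij_betw_nth[OF as(2) refl refl]])
      finally show "cf g \<alpha> = (\<Sum>j<length as. monom_ps (as ! j) \<alpha>)" .
    qed
  qed
  then show ?thesis using equiv that by blast
qed

text \<open>Every variable occurs in at most one summand, so each partial derivative is zero or a
  nonzero multiple of one monomial. As the summands are not constant, \<open>g\<close> is a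
  combination of these monomials.\<close>

theorem thom_sebastiani_Jac:
  assumes "thom_sebastiani (cf g)"
  obtains M where "Jac g = ideal_span (mon ` M)"
proof -
  obtain as where as: "\<And>j. j < length as \<Longrightarrow> as ! j \<noteq> (\<lambda>i. 0)"
    "\<And>j k. j < length as \<Longrightarrow> k < length as \<Longrightarrow> j \<noteq> k \<Longrightarrow> supp_mi (as ! j) \<inter> supp_mi (as ! k) = {}"
    "cf g = (\<lambda>\<alpha>. \<Sum>j<length as. monom_ps (as ! j) \<alpha>)"
    using assms unfolding thom_sebastiani_def by blast
  have g: "g = (\<Sum>j<length as. mon (as ! j))"
    by (rule cps_eqI) (simp add: as(3) monom_ps_def cf_cterm)
  define M where "M = {as ! j - unit_mi i |j i. j < length as \<and> (as ! j) i \<noteq> 0}"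
  have pd_g: "pd i g = (\<Sum>j<length as. cterm (of_nat ((as ! j) i)) (as ! j - unit_mi i))" for i
    unfolding g cps_linear_sum[OF cps_linear_pd] pd_cterm by simp
  have cterm_eq: "cterm c \<beta> = cst c * mon \<beta>" for c and \<beta> :: "'a \<Rightarrow> nat" by (simp add: cterm_mult)
  have "Jac g \<subseteq> ideal_span (mon ` M)"
    unfolding Jac_def
  proof (rule cps_module.span_minimal)
    have "mon (as ! j) \<in> ideal_span (mon ` M)" if j: "j < length as" for j
    proof -
      obtain i where i: "(as ! j) i \<noteq> 0" using as(1)[OF j] by fastforce
      have "unit_mi i + (as ! j - unit_mi i) = as ! j" using i by (intro mi_add_diff) simp
      then have "mon (as ! j) = var i * mon (as ! j - unit_mi i)" by (simp add: cterm_mult)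
      moreover have "as ! j - unit_mi i \<in> M" using j i by (auto simp: M_def)
      ultimately show ?thesis by (simp add: cps_module.span_scale cps_module.span_base)
    qed
    then have "g \<in> ideal_span (mon ` M)" unfolding g by (intro cps_module.span_sum) simp
    moreover have "pd i g \<in> ideal_span (mon ` M)" for i
      unfolding pd_g
    proof (rule cps_module.span_sum)
      fix j assume j: "j \<in> {..<length as}"
      show "cterm (of_nat ((as ! j) i)) (as ! j - unit_mi i) \<in> ideal_span (mon ` M)"
      proof (cases "(as ! j) i = 0")
        case True
        then show ?thesis by (simp add: cps_module.span_zero)
      next
        case False
        then have "as ! j - unit_mi i \<in> M" using j by (auto simp: M_def)
        then show ?thesis
          by (subst cterm_eq) (intro cps_module.span_scale cps_module.span_base imageI)
      qed
    qed
    ultimately show "insert g (range (\<lambda>i. pd i g)) \<subseteq> ideal_span (mon ` M)"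
      by (simp add: image_subset_iff)
  qed (rule cps_module.subspace_span)
  moreover have "ideal_span (mon ` M) \<subseteq> Jac g"
  proof (rule cps_module.span_minimal)
    have "mon (as ! j - unit_mi i) \<in> Jac g" if j: "j < length as" and i: "(as ! j) i \<noteq> 0" for j i
    proof -
      have "(as ! k) i = 0" if "k < length as" "k \<noteq> j" for k
        using as(2)[OF j that(1)] that(2) i by (auto simp: supp_mi_def)
      then have "pd i g = (\<Sum>k<length as. if k = j then cterm (of_nat ((as ! j) i)) (as ! j - unit_mi i) else 0)"
        unfolding pd_g by (intro sum.cong refl) auto
      also have "\<dots> = cterm (of_nat ((as ! j) i)) (as ! j - unit_mi i)" using j by simp
      finally have "cst (1 / of_nat ((as ! j) i)) * pd i g = mon (as ! j - unit_mi i)"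
        using i by (simp add: cterm_mult)
      moreover have "cst (1 / of_nat ((as ! j) i)) * pd i g \<in> Jac g"
        unfolding Jac_def by (intro cps_module.span_scale cps_module.span_base) simp
      ultimately show ?thesis by simp
    qed
    then show "mon ` M \<subseteq> Jac g" by (auto simp: M_def)
    show "cps_module.subspace (Jac g)" unfolding Jac_def by (rule cps_module.subspace_span)
  qed
  ultimately show ?thesis by (intro that[of M]) (rule subset_antisym)
qed

subsection \<open>Transfer to coefficient functions\<close>

lemma ideal_gen_cf_image: "ideal_gen (cf ` S) = cf ` ideal_span S"
proof
  have "is_ideal_ps (cf ` ideal_span S)"
    unfolding is_ideal_ps_def
  proof (intro conjI ballI)
    show "cf ` ideal_span S \<subseteq> CS" using cf by auto
    show "ps_zero \<in> cf ` ideal_span S"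
      using cps_module.span_zero by (metis imageI zero_cps.rep_eq)
    show "ps_add x y \<in> cf ` ideal_span S" if "x \<in> cf ` ideal_span S" "y \<in> cf ` ideal_span S" for x y
    proof -
      from that obtain u v where uv: "x = cf u" "u \<in> ideal_span S" "y = cf v" "v \<in> ideal_span S"
        by (elim imageE)
      have "ps_add x y = cf (u + v)" by (simp only: uv plus_cps.rep_eq)
      then show ?thesis using cps_module.span_add[OF uv(2,4)] by simp
    qed
    show "ps_mult a x \<in> cf ` ideal_span S" if "a \<in> CS" "x \<in> cf ` ideal_span S" for a x
    proof -
      from that(2) obtain u where u: "x = cf u" "u \<in> ideal_span S" by (elim imageE)
      have "ps_mult a x = cf (Abs_cps a * u)"
        using that(1) by (simp only: u times_cps.rep_eq Abs_cps_inverse)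
      then show ?thesis using cps_module.span_scale[OF u(2)] by simp
    qed
  qed
  moreover have "cf ` S \<subseteq> cf ` ideal_span S" by (rule image_mono[OF cps_module.span_superset])
  ultimately show "ideal_gen (cf ` S) \<subseteq> cf ` ideal_span S" unfolding ideal_gen_def by blast
  show "cf ` ideal_span S \<subseteq> ideal_gen (cf ` S)"
    unfolding ideal_gen_def
  proof (intro Inter_greatest)
    fix I assume "I \<in> {I. is_ideal_ps I \<and> cf ` S \<subseteq> I}"
    then have I: "is_ideal_ps I" "cf ` S \<subseteq> I" by auto
    have "cps_module.subspace {x. cf x \<in> I}"
    proof (rule cps_module.subspaceI)
      show "0 \<in> {x. cf x \<in> I}" using I(1) by (simp add: is_ideal_ps_def zero_cps.rep_eq)
      show "x + y \<in> {x. cf x \<in> I}" if "x \<in> {x. cf x \<in> I}" "y \<in> {x. cf x \<in> I}" for x y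
        using I(1) that by (simp add: is_ideal_ps_def plus_cps.rep_eq)
      show "c * x \<in> {x. cf x \<in> I}" if "x \<in> {x. cf x \<in> I}" for c x
        using I(1) that cf[of c] by (simp add: is_ideal_ps_def times_cps.rep_eq)
    qed
    moreover have "S \<subseteq> {x. cf x \<in> I}" using I(2) by auto
    ultimately have "ideal_span S \<subseteq> {x. cf x \<in> I}" by (intro cps_module.span_minimal)
    then show "cf ` ideal_span S \<subseteq> I" by auto
  qed
qed

lemma ext_jacobian_cf: "ext_jacobian (cf f) = cf ` Jac f"
proof -
  have "insert (cf f) (range (\<lambda>i. pderiv_ps i (cf f))) = cf ` insert f (range (\<lambda>i. pd i f))"
    by (simp add: pd.rep_eq image_image)
  then show ?thesis unfolding ext_jacobian_def Jac_def by (simp only: ideal_gen_cf_image)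
qed

lemma ps_smult_cf: "ps_smult c (cf f) = cf (cst c * f)"
  by (rule ext) (simp add: ps_smult_def)

lemma cps_aut_of_alg_aut:
  assumes "is_alg_aut \<phi>"
  obtains \<Phi> where "cps_aut \<Phi>" "\<And>f. \<phi> (cf f) = cf (\<Phi> f)"
proof -
  define \<Phi> where "\<Phi> = (\<lambda>f. Abs_cps (\<phi> (cf f)))"
  have bij: "bij_betw \<phi> CS CS" using assms by (simp add: is_alg_aut_def)
  have \<Phi>: "cf (\<Phi> f) = \<phi> (cf f)" for f
    unfolding \<Phi>_def using bij_betwE[OF bij] cf[of f] by (simp add: Abs_cps_inverse)
  have "cps_aut \<Phi>"
    unfolding cps_aut_def
  proof (intro conjI allI)
    show "\<Phi> (f + g) = \<Phi> f + \<Phi> g" for f g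
      unfolding cf_inject[symmetric] plus_cps.rep_eq \<Phi> using assms cf[of f] cf[of g] by (simp add: is_alg_aut_def)
    show "\<Phi> (f * g) = \<Phi> f * \<Phi> g" for f g
      unfolding cf_inject[symmetric] times_cps.rep_eq \<Phi> using assms cf[of f] cf[of g] by (simp add: is_alg_aut_def)
    show "\<Phi> (cst c * f) = cst c * \<Phi> f" for c f
      unfolding cf_inject[symmetric] ps_smult_cf[symmetric] \<Phi> using assms cf[of f] by (simp add: is_alg_aut_def)
    show "bij \<Phi>"
    proof (rule bijI)
      show "inj \<Phi>"
      proof (rule injI)
        fix x y assume "\<Phi> x = \<Phi> y"
        then have "\<phi> (cf x) = \<phi> (cf y)" unfolding \<Phi>[symmetric] by simp
        then have "cf x = cf y" using inj_onD[OF bij_betw_imp_inj_on[OF bij]] cf by blast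
        then show "x = y" by (simp add: cf_inject)
      qed
      show "surj \<Phi>"
        unfolding surj_def
      proof
        fix y
        have "cf y \<in> \<phi> ` CS" using bij_betw_imp_surj_on[OF bij] cf[of y] by simp
        then obtain x where x: "x \<in> CS" "cf y = \<phi> x" by blast
        then have "cf (\<Phi> (Abs_cps x)) = cf y" by (simp add: \<Phi> Abs_cps_inverse)
        then show "\<exists>x. y = \<Phi> x" unfolding cf_inject by metis
      qed
    qed
  qed
  then show ?thesis using that \<Phi> by metis
qed

lemma alg_aut_of_cps_aut:
  fixes \<Phi> :: "'n::finite cps \<Rightarrow> 'n cps"
  assumes "cps_aut \<Phi>"
  shows "is_alg_aut (\<lambda>f. cf (\<Phi> (Abs_cps f)))"
proof -
  have ex: "\<exists>x. f = cf x" if "f \<in> CS" for f :: "'n ps"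
    using that by (intro exI[of _ "Abs_cps f"]) (simp add: Abs_cps_inverse)
  show ?thesis
    unfolding is_alg_aut_def
  proof (intro conjI ballI allI)
    show "bij_betw (\<lambda>f. cf (\<Phi> (Abs_cps f))) CS CS"
      by (rule bij_betw_byWitness[where f' = "\<lambda>f. cf (inv \<Phi> (Abs_cps f))"])
         (auto simp: cf_inverse Abs_cps_inverse cps_aut_inv_apply[OF assms] cf)
    show "cf (\<Phi> (Abs_cps ps_one)) = ps_one"
      unfolding one_cps.abs_eq[symmetric] cps_aut_one[OF assms] by (rule one_cps.rep_eq)
    fix f :: "'n ps" assume "f \<in> CS"
    then obtain u where u: "f = cf u" using ex by blast
    show "cf (\<Phi> (Abs_cps (ps_smult c f))) = ps_smult c (cf (\<Phi> (Abs_cps f)))" for c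
      unfolding u ps_smult_cf cf_inverse cps_aut_cst_mult[OF assms] ..
    fix g :: "'n ps" assume "g \<in> CS"
    then obtain v where v: "g = cf v" using ex by blast
    show "cf (\<Phi> (Abs_cps (ps_add f g))) = ps_add (cf (\<Phi> (Abs_cps f))) (cf (\<Phi> (Abs_cps g)))"
      unfolding u v plus_cps.rep_eq[symmetric] cf_inverse cps_aut_add[OF assms] ..
    show "cf (\<Phi> (Abs_cps (ps_mult f g))) = ps_mult (cf (\<Phi> (Abs_cps f))) (cf (\<Phi> (Abs_cps g)))"
      unfolding u v times_cps.rep_eq[symmetric] cf_inverse cps_aut_mult[OF assms] ..
  qed
qed

lemma right_equiv_cf: "right_equiv (cf f) g \<longleftrightarrow> (\<exists>h. cps_equiv f h \<and> g = cf h)"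
proof
  assume "right_equiv (cf f) g"
  then obtain \<phi> where \<phi>: "is_alg_aut \<phi>" "\<phi> (cf f) = g" unfolding right_equiv_def by blast
  obtain \<Phi> where \<Phi>: "cps_aut \<Phi>" "\<And>f. \<phi> (cf f) = cf (\<Phi> f)" by (rule cps_aut_of_alg_aut[OF \<phi>(1)]) (rule that)
  then show "\<exists>h. cps_equiv f h \<and> g = cf h"
    using \<phi>(2) unfolding cps_equiv_def by (intro exI[of _ "\<Phi> f"]) auto
next
  assume "\<exists>h. cps_equiv f h \<and> g = cf h"
  then obtain \<Phi> where \<Phi>: "cps_aut \<Phi>" "g = cf (\<Phi> f)" unfolding cps_equiv_def by blast
  show "right_equiv (cf f) g"
    unfolding right_equiv_def
    by (rule exI[of _ "\<lambda>f. cf (\<Phi> (Abs_cps f))"]) (simp add: alg_aut_of_cps_aut[OF \<Phi>(1)] cf_inverse \<Phi>(2))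
qed

lemma monom_ps_cf: "monom_ps \<beta> = cf (mon \<beta>)"
  by (rule ext) (simp add: monom_ps_def cf_cterm)

text \<open>Automorphisms commute with spans, so an ideal generated by monomials in other
  coordinates is the image of one generated by monomials in the given variables.\<close>

lemma monomial_ideal_cf:
  "monomial_ideal (cf ` I) \<longleftrightarrow> (\<exists>\<Phi> M. cps_aut \<Phi> \<and> I = \<Phi> ` ideal_span (mon ` M))"
proof
  assume "monomial_ideal (cf ` I)"
  then obtain \<phi> M where \<phi>: "is_alg_aut \<phi>" "cf ` I = ideal_gen (\<phi> ` monom_ps ` M)"
    unfolding monomial_ideal_def by blast
  obtain \<Phi> where \<Phi>: "cps_aut \<Phi>" "\<And>f. \<phi> (cf f) = cf (\<Phi> f)" by (rule cps_aut_of_alg_aut[OF \<phi>(1)]) (rule that)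
  have "\<phi> ` monom_ps ` M = cf ` \<Phi> ` mon ` M" by (simp add: image_image monom_ps_cf \<Phi>(2))
  then have "cf ` I = cf ` \<Phi> ` ideal_span (mon ` M)"
    unfolding \<phi>(2) by (simp only: ideal_gen_cf_image cps_aut_image_span[OF \<Phi>(1)])
  then have "I = \<Phi> ` ideal_span (mon ` M)" by (rule inj_image_eq_iff[THEN iffD1, rotated]) (simp add: inj_def cf_inject)
  then show "\<exists>\<Phi> M. cps_aut \<Phi> \<and> I = \<Phi> ` ideal_span (mon ` M)" using \<Phi>(1) by blast
next
  assume "\<exists>\<Phi> M. cps_aut \<Phi> \<and> I = \<Phi> ` ideal_span (mon ` M)"
  then obtain \<Phi> M where \<Phi>: "cps_aut \<Phi>" "I = \<Phi> ` ideal_span (mon ` M)" by blast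
  have "(\<lambda>f. cf (\<Phi> (Abs_cps f))) ` monom_ps ` M = cf ` \<Phi> ` mon ` M"
    by (simp add: image_image monom_ps_cf cf_inverse)
  then have "cf ` I = ideal_gen ((\<lambda>f. cf (\<Phi> (Abs_cps f))) ` monom_ps ` M)"
    by (simp only: ideal_gen_cf_image cps_aut_image_span[OF \<Phi>(1)] \<Phi>(2))
  then show "monomial_ideal (cf ` I)"
    unfolding monomial_ideal_def using alg_aut_of_cps_aut[OF \<Phi>(1)] by blast
qed

theorem theorem1p10:
  fixes f :: "('n::finite \<Rightarrow> nat) \<Rightarrow> complex"
  assumes "f \<in> CS" and "f \<noteq> ps_zero" and "f (\<lambda>i. 0) = 0"
  shows "monomial_ideal (ext_jacobian f) \<longleftrightarrow> (\<exists>g. thom_sebastiani g \<and> right_equiv f g)"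
proof -
  define F where "F = Abs_cps f"
  have f: "f = cf F" using assms(1) by (simp add: F_def Abs_cps_inverse)
  have F: "F \<noteq> 0" "cf F 0 = 0"
    using assms(2,3) unfolding f zero_fun_def zero_cps.rep_eq[symmetric] by (auto simp only: cf_inject)
  show ?thesis
    unfolding f ext_jacobian_cf monomial_ideal_cf
  proof
    assume "\<exists>\<Phi> M. cps_aut \<Phi> \<and> Jac F = \<Phi> ` ideal_span (mon ` M)"
    then obtain \<Phi> M where \<Phi>: "cps_aut \<Phi>" and J: "Jac F = \<Phi> ` ideal_span (mon ` M)" by blast
    note i = cps_aut_inv[OF \<Phi>] cps_aut_inv_apply[OF \<Phi>]
    \<comment> \<open>Going back by \<open>\<Phi>\<close> makes the ideal monomial in the given
      variables; \<open>inv \<Phi> F\<close> is still nonzero and vanishes at the origin.\<close>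
    have "Jac (inv \<Phi> F) = ideal_span (mon ` M)"
      unfolding Jac_aut[OF i(1)] J by (simp add: image_image i)
    moreover have "inv \<Phi> F \<noteq> 0"
    proof
      assume "inv \<Phi> F = 0"
      then have "\<Phi> (inv \<Phi> F) = 0" using cps_linear_0[OF cps_aut_linear[OF \<Phi>]] by simp
      then show False using F(1) i(3) by simp
    qed
    moreover have "cf (inv \<Phi> F) 0 = 0" by (rule cps_aut_const_zero[OF i(1) F(2)])
    ultimately obtain g where g: "thom_sebastiani (cf g)" "cps_equiv (inv \<Phi> F) g"
      by (rule monomial_Jac_imp_thom_sebastiani)
    have "cps_equiv F (inv \<Phi> F)" unfolding cps_equiv_def using i(1) by blast
    then have "cps_equiv F g" using g(2) by (rule cps_equiv_trans)
    then show "\<exists>g. thom_sebastiani g \<and> right_equiv (cf F) g"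
      using g(1) unfolding right_equiv_cf by blast
  next
    assume "\<exists>g. thom_sebastiani g \<and> right_equiv (cf F) g"
    then obtain g where g: "thom_sebastiani (cf g)" "cps_equiv F g" unfolding right_equiv_cf by blast
    obtain M where M: "Jac g = ideal_span (mon ` M)" by (rule thom_sebastiani_Jac[OF g(1)])
    obtain \<Phi> where \<Phi>: "cps_aut \<Phi>" "\<Phi> g = F" using cps_equiv_sym[OF g(2)] unfolding cps_equiv_def by blast
    have "Jac F = \<Phi> ` ideal_span (mon ` M)" using Jac_aut[OF \<Phi>(1), of g] \<Phi>(2) M by simp
    then show "\<exists>\<Phi> M. cps_aut \<Phi> \<and> Jac F = \<Phi> ` ideal_span (mon ` M)" using \<Phi>(1) by blast
  qed
qed

end
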